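(* Let $\mathsf X=\{1,\dots,d\}$, let $\mathsf Y$ be a Polish space, let $\Theta$ be a compact metric space, and for each $\theta\in\Theta$ let the signal transition kernel $Q_\theta$ be given by a transition probability matrix $\mathcal Q_\theta$ and let $g_\theta$ be the observation density. Let $\theta^\star\in\Theta$ and assume: (F1) the stochastic matrix $\mathcal Q_{\theta^\star}$ is irreducible; (F2) $\bar{\mathbb E}_{\theta^\star}[|\log g_{\theta^\star}(x,Y_0)|]<\infty$ for every $x\in\mathsf X$; (F3) for every $\theta\in\Theta$ there is a neighborhood $\mathcal U_\theta$ of $\theta$ such that $\bar{\mathbb E}_{\theta^\star}[\sup_{\theta'\in\mathcal U_\theta}(\log g_{\theta'}(x,Y_0))^+]<\infty$ for all $x\in\mathsf X$; (F4) $\theta\mapsto\mathcal Q_\theta$ and $\theta\mapsto g_\theta(x,y)$ are continuous for any $x\in\mathsf X$, $y\in\mathsf Y$. Then for every probability measure $\nu$ on $\mathsf X$ that charges every point of $\mathsf X$, every approximate maximum likelihood estimator $(\hat\theta_{\nu,n})_{n\ge0}$ satisfies $\hat\theta_{\nu,n}\to[\theta^\star]$ as $n\to\infty$, $\bar{\mathbb P}_{\theta^\star}$-a.s.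
   Context: $\mu$ is a $\sigma$-finite measure on $\mathsf Y$ (with its Borel $\sigma$-field), and $g:\Theta\times\mathsf X\times\mathsf Y\to\mathbb R_+$ is measurable with $\int g_\theta(x,y)\,\mu(dy)=1$ for all $\theta,x$. For a probability measure $\nu$ on $\mathsf X$, $\mathbb P^\nu_\theta$ is the law of the hidden Markov model $(X_k,Y_k)_{k\ge0}$: $(X_k)$ is a Markov chain with initial law $\nu$ and transition matrix $\mathcal Q_\theta$, and conditionally on $(X_k)$ the $Y_k$ are independent, $Y_k$ having density $g_\theta(X_k,\cdot)$ with respect to $\mu$. $\mathbb P^{\nu,Y}_\theta$ is the marginal law of $(Y_k)_{k\ge0}$. $\pi_{\theta^\star}$ is the unique invariant probability of $\mathcal Q_{\theta^\star}$, $\bar{\mathbb P}_{\theta^\star}=\mathbb P^{\pi_{\theta^\star}}_{\theta^\star}$, with expectation $\bar{\mathbb E}_{\theta^\star}$. The relation on $\Theta$ is: $\theta\sim\theta'$ iff there exist invariant distributions $\pi,\pi'$ for $\mathcal Q_\theta,\mathcal Q_{\theta'}$, respectively, such that $\mathbb P^{\pi,Y}_\theta=\mathbb P^{\pi',Y}_{\theta'}$; $[\theta]=\{\theta'\in\Theta:\theta'\sim\theta\}$. (For $\theta\ne\theta^\star$, $\mathcal Q_\theta$ need not be ergodic.) The likelihood is $p^\nu(y_0^n;\theta)=\sum_{x_0,\dots,x_n}\nu(x_0)g_\theta(x_0,y_0)\prod_{u=1}^n\mathcal Q_\theta(x_{u-1},x_u)g_\theta(x_u,y_u)$, where $y_0^n=(y_0,\dots,y_n)$,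 and $\ell_{\nu,n}(\theta)=\log p^\nu(Y_0^n;\theta)$. An approximate maximum likelihood estimator is a sequence of universally measurable $\Theta$-valued functions $\hat\theta_{\nu,n}$ of $Y_0^n$ such that $n^{-1}\ell_{\nu,n}(\hat\theta_{\nu,n})\ge\sup_{\theta\in\Theta}n^{-1}\ell_{\nu,n}(\theta)-o_{\mathrm{a.s.}}(1)$, where $o_{\mathrm{a.s.}}(1)$ is a stochastic process converging to zero $\bar{\mathbb P}_{\theta^\star}$-a.s. as $n\to\infty$. Convergence $\hat\theta_{\nu,n}\to[\theta^\star]$ means that the distance of $\hat\theta_{\nu,n}$ to the set $[\theta^\star]$ tends to zero. *)

theory Defs
  imports "HOL-Probability.Probability"
begin

definition stochastic_matrix :: "real^'x^'x \<Rightarrow> bool" where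
  "stochastic_matrix A \<longleftrightarrow> (\<forall>x x'. 0 \<le> A $ x $ x') \<and> (\<forall>x. (\<Sum>x'\<in>UNIV. A $ x $ x') = 1)"

definition matrix_power :: "real^'x^'x \<Rightarrow> nat \<Rightarrow> real^'x^'x" where
  "matrix_power A n = (((**) A) ^^ n) (mat 1)"

definition irreducible_matrix :: "real^'x^'x \<Rightarrow> bool" where
  "irreducible_matrix A \<longleftrightarrow> (\<forall>x x'. \<exists>n. 0 < matrix_power A n $ x $ x')"

definition invariant_distribution :: "real^'x^'x \<Rightarrow> 'x pmf \<Rightarrow> bool" where
  "invariant_distribution A \<pi> \<longleftrightarrow> (\<forall>x'. (\<Sum>x\<in>UNIV. pmf \<pi> x * A $ x $ x') = pmf \<pi> x')"

definition stationary_distribution :: "real^'x^'x \<Rightarrow> 'x pmf" where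
  "stationary_distribution A = (THE \<pi>. invariant_distribution A \<pi>)"

text \<open>
  The kernels fed to the Ionescu Tulcea theorem to build the law of the Markov chain: the
  conditional law of the state at time \<open>i\<close> given the states \<open>x\<close> at the times \<open>< i\<close>.
\<close>

definition chain_kernel :: "'x::finite pmf \<Rightarrow> real^'x^'x \<Rightarrow> nat \<Rightarrow> (nat \<Rightarrow> 'x) \<Rightarrow> 'x measure" where
  "chain_kernel \<nu> A i x =
     (if i = 0 then measure_pmf \<nu> else point_measure UNIV (\<lambda>x'. ennreal (A $ x (i - 1) $ x')))"

text \<open>
  The next right-hand side is what the constant \<open>PF.lim\<close> of the locale \<^locale>\<open>Ionescu_Tulcea\<close>
  unfolds to, see \<open>Ionescu_Tulcea_chain\<close> and \<open>emeasure_chain_law\<close> below.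
\<close>

definition chain_law :: "'x::finite pmf \<Rightarrow> real^'x^'x \<Rightarrow> (nat \<Rightarrow> 'x) measure" where
  "chain_law \<nu> A =
     projective_family.lim UNIV
       (Ionescu_Tulcea.CI (chain_kernel \<nu> A) (\<lambda>_. count_space UNIV)) (\<lambda>_. count_space UNIV)"

text \<open>
  The joint law of the pair \<open>((X\<^sub>k)\<^sub>k, (Y\<^sub>k)\<^sub>k)\<close>: draw the whole path \<open>x\<close> of the chain and then,
  given \<open>x\<close>, independent observations, the \<open>k\<close>-th one with \<open>\<mu>\<close>-density \<open>G (x k)\<close>.
\<close>

definition hmm_law ::
  "'y::topological_space measure \<Rightarrow> 'x::finite pmf \<Rightarrow> real^'x^'x \<Rightarrow> ('x \<Rightarrow> 'y \<Rightarrow> real) \<Rightarrow>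
   ((nat \<Rightarrow> 'x) \<times> (nat \<Rightarrow> 'y)) measure" where
  "hmm_law \<mu> \<nu> A G =
     chain_law \<nu> A \<bind> (\<lambda>x.
       distr (\<Pi>\<^sub>M k\<in>UNIV. density \<mu> (\<lambda>y. ennreal (G (x k) y)))
         ((\<Pi>\<^sub>M k\<in>UNIV. count_space UNIV) \<Otimes>\<^sub>M (\<Pi>\<^sub>M k\<in>UNIV. borel))
         (\<lambda>y. (x, y)))"

definition observation_law ::
  "'y::topological_space measure \<Rightarrow> 'x::finite pmf \<Rightarrow> real^'x^'x \<Rightarrow> ('x \<Rightarrow> 'y \<Rightarrow> real) \<Rightarrow>
   (nat \<Rightarrow> 'y) measure" where
  "observation_law \<mu> \<nu> A G = distr (hmm_law \<mu> \<nu> A G) (\<Pi>\<^sub>M k\<in>UNIV. borel) snd"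

definition stationary_hmm_law ::
  "'y::topological_space measure \<Rightarrow> real^'x::finite^'x \<Rightarrow> ('x \<Rightarrow> 'y \<Rightarrow> real) \<Rightarrow>
   ((nat \<Rightarrow> 'x) \<times> (nat \<Rightarrow> 'y)) measure" where
  "stationary_hmm_law \<mu> A G = hmm_law \<mu> (stationary_distribution A) A G"

definition equivalent_parameters ::
  "'y::topological_space measure \<Rightarrow> ('p \<Rightarrow> real^'x::finite^'x) \<Rightarrow> ('p \<Rightarrow> 'x \<Rightarrow> 'y \<Rightarrow> real) \<Rightarrow>
   'p \<Rightarrow> 'p \<Rightarrow> bool" where
  "equivalent_parameters \<mu> Q g \<theta> \<theta>' \<longleftrightarrow>
     (\<exists>\<pi> \<pi>'. invariant_distribution (Q \<theta>) \<pi> \<and> invariant_distribution (Q \<theta>') \<pi>' \<and>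
       observation_law \<mu> \<pi> (Q \<theta>) (g \<theta>) = observation_law \<mu> \<pi>' (Q \<theta>') (g \<theta>'))"

definition parameter_class ::
  "'y::topological_space measure \<Rightarrow> ('p \<Rightarrow> real^'x::finite^'x) \<Rightarrow> ('p \<Rightarrow> 'x \<Rightarrow> 'y \<Rightarrow> real) \<Rightarrow>
   'p \<Rightarrow> 'p set" where
  "parameter_class \<mu> Q g \<theta> = {\<theta>'. equivalent_parameters \<mu> Q g \<theta>' \<theta>}"

text \<open>The logarithm with \<open>log 0 = -\<infinity>\<close>; note that \<^term>\<open>ln (0::real)\<close> is \<open>0\<close>.\<close>

definition elog :: "real \<Rightarrow> ereal" where
  "elog t = (if 0 < t then ereal (ln t) else -\<infinity>)"

definition likelihood ::
  "'x::finite pmf \<Rightarrow> real^'x^'x \<Rightarrow> ('x \<Rightarrow> 'y \<Rightarrow> real) \<Rightarrow> nat \<Rightarrow> (nat \<Rightarrow> 'y) \<Rightarrow> real" where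
  "likelihood \<nu> A G n y =
     (\<Sum>x \<in> {..n} \<rightarrow>\<^sub>E UNIV. pmf \<nu> (x 0) * G (x 0) (y 0) *
        (\<Prod>u = 1..n. A $ x (u - 1) $ x u * G (x u) (y u)))"

definition log_likelihood ::
  "'x::finite pmf \<Rightarrow> real^'x^'x \<Rightarrow> ('x \<Rightarrow> 'y \<Rightarrow> real) \<Rightarrow> nat \<Rightarrow> (nat \<Rightarrow> 'y) \<Rightarrow> ereal" where
  "log_likelihood \<nu> A G n y = elog (likelihood \<nu> A G n y)"

definition universally_measurable :: "'a measure \<Rightarrow> 'b measure \<Rightarrow> ('a \<Rightarrow> 'b) set" where
  "universally_measurable M N =
     {f \<in> space M \<rightarrow> space N.
        \<forall>P. prob_space P \<and> sets P = sets M \<longrightarrow> f \<in> measurable (completion P) N}"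

text \<open>
  The \<open>n\<close>-th estimator takes the observations \<open>y\<^sub>0, \<dots>, y\<^sub>n\<close>, encoded as an extensional function
  on \<open>{..n}\<close>. The process \<open>R\<close> is the \<open>o(1)\<close> term. Since the estimator is only
  universally measurable, \<open>R\<close> need not be measurable for more than the completed \<open>\<sigma>\<close>-field.
\<close>

definition approximate_mle ::
  "'y::topological_space measure \<Rightarrow> ('p::metric_space \<Rightarrow> real^'x::finite^'x) \<Rightarrow>
   ('p \<Rightarrow> 'x \<Rightarrow> 'y \<Rightarrow> real) \<Rightarrow> 'p \<Rightarrow> 'x pmf \<Rightarrow> (nat \<Rightarrow> (nat \<Rightarrow> 'y) \<Rightarrow> 'p) \<Rightarrow> bool" where
  "approximate_mle \<mu> Q g \<theta>\<^sub>0 \<nu> \<theta>h \<longleftrightarrow>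
     (\<forall>n. \<theta>h n \<in> universally_measurable (\<Pi>\<^sub>M k\<in>{..n}. borel) borel) \<and>
     (\<exists>R :: nat \<Rightarrow> (nat \<Rightarrow> 'x) \<times> (nat \<Rightarrow> 'y) \<Rightarrow> real.
        (\<forall>n. R n \<in> borel_measurable (completion (stationary_hmm_law \<mu> (Q \<theta>\<^sub>0) (g \<theta>\<^sub>0)))) \<and>
        (AE (x, y) in stationary_hmm_law \<mu> (Q \<theta>\<^sub>0) (g \<theta>\<^sub>0). (\<lambda>n. R n (x, y)) \<longlonglongrightarrow> 0) \<and>
        (AE (x, y) in stationary_hmm_law \<mu> (Q \<theta>\<^sub>0) (g \<theta>\<^sub>0). \<forall>n\<ge>1.
           (let \<theta>n = \<theta>h n (restrict y {..n}) in
            ereal (1 / real n) * log_likelihood \<nu> (Q \<theta>n) (g \<theta>n) n y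
              \<ge> (SUP \<theta>. ereal (1 / real n) * log_likelihood \<nu> (Q \<theta>) (g \<theta>) n y)
                 - ereal (R n (x, y)))))"

lemma Ionescu_Tulcea_chain:
  assumes "stochastic_matrix A"
  shows "Ionescu_Tulcea (chain_kernel \<nu> A) (\<lambda>_. count_space UNIV)"
proof -
  have p: "prob_space (point_measure UNIV (\<lambda>x'. ennreal (A $ a $ x')))" for a
    using assms by (intro prob_spaceI)
      (simp add: space_point_measure emeasure_point_measure_finite stochastic_matrix_def sum_ennreal)
  have s: "point_measure UNIV (\<lambda>x'. ennreal (A $ a $ x'))
             \<in> space (subprob_algebra (count_space UNIV))" for a
    using p by (auto simp: space_subprob_algebra sets_point_measure prob_space_imp_subprob_space)
  have ps: "prob_space (chain_kernel \<nu> A i x)" for i x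
    using p by (auto simp: chain_kernel_def measure_pmf.prob_space_axioms)
  show ?thesis
  proof (rule Ionescu_Tulcea.intro)
    fix i
    show "chain_kernel \<nu> A i
            \<in> measurable (PiM {0..<i} (\<lambda>_. count_space UNIV)) (subprob_algebra (count_space UNIV))"
    proof (cases "i = 0")
      case True
      then show ?thesis
        by (auto simp: chain_kernel_def[abs_def] intro!: measurable_const measure_pmf_in_subprob_space)
    next
      case False
      have "(\<lambda>a. point_measure UNIV (\<lambda>x'. ennreal (A $ a $ x'))) \<circ> (\<lambda>x. x (i - 1))
        \<in> measurable (PiM {0..<i} (\<lambda>_. count_space UNIV)) (subprob_algebra (count_space UNIV))"
        using False s
        by (intro measurable_comp[where N="count_space UNIV"] measurable_component_singleton) auto
      with False show ?thesis by (simp add: chain_kernel_def[abs_def] comp_def)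
    qed
  qed (rule ps)
qed

lemma sets_chain_law:
  assumes "stochastic_matrix A"
  shows "sets (chain_law \<nu> A) = sets (\<Pi>\<^sub>M k\<in>UNIV. count_space UNIV)"
proof -
  interpret Ionescu_Tulcea "chain_kernel \<nu> A" "\<lambda>_. count_space UNIV"
    using assms by (rule Ionescu_Tulcea_chain)
  show ?thesis by (simp add: chain_law_def)
qed

lemma emeasure_chain_law:
  fixes A :: "real^'x::finite^'x"
  assumes A: "stochastic_matrix A"
  shows "emeasure (chain_law \<nu> A) {x. \<forall>k\<le>n. x k = a k} =
           ennreal (pmf \<nu> (a 0) * (\<Prod>u = 1..n. A $ a (u - 1) $ a u))"
proof -
  interpret Ionescu_Tulcea "chain_kernel \<nu> A" "\<lambda>_. count_space UNIV"
    using A by (rule Ionescu_Tulcea_chain)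
  let ?M = "\<lambda>_::nat. count_space (UNIV :: 'x set)"
  let ?S = "\<lambda>n. {restrict a {0..<n}}"
  have S: "?S n = (\<Pi>\<^sub>E k\<in>{0..<n}. {a k})" for n
  proof -
    have "(\<Pi>\<^sub>E k\<in>{0..<n}. {a k}) = (\<Pi>\<^sub>E k\<in>{0..<n}. {restrict a {0..<n} k})"
      by (intro PiE_cong) simp
    also have "\<dots> = ?S n" by (rule PiE_singleton) (rule restrict_extensional)
    finally show ?thesis by simp
  qed
  have S_sets[measurable]: "?S n \<in> sets (PiM {0..<n} ?M)" for n
    unfolding S by (intro sets_PiM_I_finite) auto
  have r: "restrict a {0..<n} \<in> space (PiM {0..<n} ?M)" for n
    by (simp add: space_PiM)
  have upd: "fun_upd \<omega> n y = restrict a {0..<Suc n} \<longleftrightarrow> \<omega> = restrict a {0..<n} \<and> y = a n"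
    if "\<omega> \<in> extensional {0..<n}" for \<omega> :: "nat \<Rightarrow> 'x" and y n
    using that by (auto simp: fun_eq_iff extensional_def)
  have C_Suc: "emeasure (C 0 (Suc n) (\<lambda>_. undefined)) (?S (Suc n)) =
      emeasure (chain_kernel \<nu> A n (restrict a {0..<n})) {a n} *
      emeasure (C 0 n (\<lambda>_. undefined)) (?S n)" for n
  proof -
    have "emeasure (C 0 (Suc n) (\<lambda>_. undefined)) (?S (Suc n)) =
        (\<integral>\<^sup>+\<omega>. emeasure (eP n \<omega>) (?S (Suc n)) \<partial>C 0 n (\<lambda>_. undefined))"
      unfolding C.simps add_0
      by (rule emeasure_bind[OF _ _ S_sets])
         (auto simp: space_C prob_space.not_empty[OF prob_space_C] measurable_cong_sets[OF sets_C])
    also have "\<dots> = (\<integral>\<^sup>+\<omega>. emeasure (chain_kernel \<nu> A n (restrict a {0..<n})) {a n} *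
        indicator (?S n) \<omega> \<partial>C 0 n (\<lambda>_. undefined))"
    proof (intro nn_integral_cong)
      fix \<omega> assume "\<omega> \<in> space (C 0 n (\<lambda>_. undefined))"
      then have \<omega>: "\<omega> \<in> space (PiM {0..<n} ?M)" by (simp add: space_C)
      then have "fun_upd \<omega> n -` ?S (Suc n) = (if \<omega> \<in> ?S n then {a n} else {})"
        using upd[of \<omega> n] by (simp add: space_PiM PiE_def vimage_def)
      then show "emeasure (eP n \<omega>) (?S (Suc n)) =
          emeasure (chain_kernel \<nu> A n (restrict a {0..<n})) {a n} * indicator (?S n) \<omega>"
        by (subst emeasure_eP[OF \<omega> S_sets]) auto
    qed
    also have "\<dots> = emeasure (chain_kernel \<nu> A n (restrict a {0..<n})) {a n} *
        emeasure (C 0 n (\<lambda>_. undefined)) (?S n)"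
      by (rule nn_integral_cmult_indicator) (simp add: sets_C S_sets)
    finally show ?thesis .
  qed
  have nonneg: "0 \<le> A $ i $ j" for i j
    using A by (simp add: stochastic_matrix_def)
  have C: "emeasure (C 0 (Suc n) (\<lambda>_. undefined)) (?S (Suc n)) =
             ennreal (pmf \<nu> (a 0) * (\<Prod>u = 1..n. A $ a (u - 1) $ a u))" for n
  proof (induction n)
    case 0
    show ?case
      by (subst C_Suc) (simp add: chain_kernel_def emeasure_pmf_single restrict_def PiM_empty)
  next
    case (Suc n)
    have "emeasure (chain_kernel \<nu> A (Suc n) (restrict a {0..<Suc n})) {a (Suc n)} =
            ennreal (A $ a n $ a (Suc n))"
      by (simp add: chain_kernel_def emeasure_point_measure_finite)
    then show ?case
      unfolding C_Suc[of "Suc n"] Suc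
      by (simp add: nonneg prod_nonneg ennreal_mult[symmetric] mult_ac)
  qed
  have "restrict x {0..<Suc n} = restrict a {0..<Suc n} \<longleftrightarrow> (\<forall>k\<le>n. x k = a k)" for x
  proof
    assume eq: "restrict x {0..<Suc n} = restrict a {0..<Suc n}"
    show "\<forall>k\<le>n. x k = a k"
    proof (intro allI impI)
      fix k assume "k \<le> n"
      then show "x k = a k" using fun_cong[OF eq, of k] by simp
    qed
  qed (auto intro!: restrict_ext)
  then have emb: "{x. \<forall>k\<le>n. x k = a k} = PF.emb UNIV {0..<Suc n} (?S (Suc n))"
    by (auto simp: prod_emb_def space_PiM)
  have id: "PF.emb {0..<Suc n} {0..<Suc n} (?S (Suc n)) = ?S (Suc n)"
    by (rule prod_emb_id) auto
  have "emeasure (chain_law \<nu> A) {x. \<forall>k\<le>n. x k = a k} = emeasure (CI {0..<Suc n}) (?S (Suc n))"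
    unfolding emb chain_law_def by (rule lim) (auto intro: S_sets)
  also have "\<dots> = emeasure (C 0 (Suc n) (\<lambda>_. undefined)) (?S (Suc n))"
    using emeasure_CI[of "{0..<Suc n}" "Suc n", OF _ S_sets]
    by (simp only: id order_refl)
  finally show ?thesis by (simp only: C)
qed

lemma prob_space_chain_law:
  assumes "stochastic_matrix A"
  shows "prob_space (chain_law \<nu> A)"
proof -
  interpret Ionescu_Tulcea "chain_kernel \<nu> A" "\<lambda>_. count_space UNIV"
    using assms by (rule Ionescu_Tulcea_chain)
  have "prob_space (distr PF.lim (PiM {} (\<lambda>_. count_space UNIV)) (\<lambda>x. restrict x {}))"
    by (simp only: distr_lim finite.emptyI PF.prob_space_P subset_UNIV)
  then show ?thesis
    unfolding chain_law_def
    by (rule prob_space_distrD[rotated])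
       (auto intro!: measurable_restrict simp: measurable_cong_sets[OF PF.sets_lim refl])
qed

context
  fixes \<mu> :: "'y::topological_space measure" and G :: "'x::finite \<Rightarrow> 'y \<Rightarrow> real"
  assumes sets_\<mu>: "sets \<mu> = sets borel"
    and G_measurable: "\<And>x. G x \<in> borel_measurable borel"
    and G_density: "\<And>x. (\<integral>\<^sup>+ y. ennreal (G x y) \<partial>\<mu>) = 1"
begin

lemma prob_space_density_G: "prob_space (density \<mu> (\<lambda>y. ennreal (G x y)))"
proof (rule prob_spaceI)
  have [measurable]: "G x \<in> borel_measurable \<mu>"
    using G_measurable by (simp add: measurable_cong_sets[OF sets_\<mu> refl])
  show "emeasure (density \<mu> (\<lambda>y. ennreal (G x y))) (space (density \<mu> (\<lambda>y. ennreal (G x y)))) = 1"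
    by (simp add: emeasure_density G_density cong: nn_integral_cong)
qed

lemma measurable_hmm_kernel:
  "(\<lambda>x. distr (\<Pi>\<^sub>M k\<in>UNIV. density \<mu> (\<lambda>y. ennreal (G (x k) y)))
      ((\<Pi>\<^sub>M k\<in>UNIV. count_space UNIV) \<Otimes>\<^sub>M (\<Pi>\<^sub>M k\<in>UNIV. borel)) (\<lambda>y. (x, y)))
   \<in> (\<Pi>\<^sub>M (k::nat)\<in>UNIV. count_space UNIV) \<rightarrow>\<^sub>M
     prob_algebra ((\<Pi>\<^sub>M k\<in>UNIV. count_space UNIV) \<Otimes>\<^sub>M (\<Pi>\<^sub>M k\<in>UNIV. borel))"
proof -
  let ?D = "\<lambda>x k. density \<mu> (\<lambda>y. ennreal (G (x k) y))"
  have pp: "product_prob_space (?D x)" for x :: "nat \<Rightarrow> 'x"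
    by (intro product_prob_spaceI prob_space_density_G)
  have sets_D: "sets (PiM UNIV (?D x)) = sets (\<Pi>\<^sub>M k\<in>UNIV. borel)" for x :: "nat \<Rightarrow> 'x"
    by (intro sets_PiM_cong) (simp_all add: sets_\<mu>)
  have prob: "prob_space (PiM UNIV (?D x))" for x :: "nat \<Rightarrow> 'x"
    by (intro prob_space_PiM prob_space_density_G)
  have K: "(\<lambda>x. PiM UNIV (?D x))
      \<in> (\<Pi>\<^sub>M k\<in>UNIV. count_space UNIV) \<rightarrow>\<^sub>M prob_algebra (\<Pi>\<^sub>M (k::nat)\<in>UNIV. borel)"
  proof (rule measurable_prob_algebra_generated[OF sets_PiM Int_stable_prod_algebra
        prod_algebra_sets_into_space])
    fix A :: "(nat \<Rightarrow> 'y) set" assume "A \<in> prod_algebra UNIV (\<lambda>k. borel)"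
    then obtain J E where A: "A = prod_emb UNIV (\<lambda>k. borel) J (\<Pi>\<^sub>E j\<in>J. E j)"
      and J: "finite J" and E: "\<And>j. j \<in> J \<Longrightarrow> E j \<in> sets borel"
      by (auto elim!: prod_algebraE)
    have "emeasure (PiM UNIV (?D x)) A = (\<Prod>j\<in>J. emeasure (?D x j) (E j))" for x
    proof -
      interpret product_prob_space "?D x" UNIV by (rule pp)
      have sp: "space \<mu> = UNIV" using sets_eq_imp_space_eq[OF sets_\<mu>] by simp
      have "A = prod_emb UNIV (?D x) J (\<Pi>\<^sub>E j\<in>J. E j)"
        by (simp add: A prod_emb_def sp)
      then show ?thesis
        using E J by (simp add: emeasure_PiM_emb sets_\<mu>)
    qed
    moreover have "(\<lambda>x. \<Prod>j\<in>J. emeasure (?D x j) (E j))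
        \<in> borel_measurable (\<Pi>\<^sub>M k\<in>UNIV. count_space UNIV)"
    proof (rule borel_measurable_prod_ennreal)
      fix j
      have "(\<lambda>a. emeasure (density \<mu> (\<lambda>y. ennreal (G a y))) (E j)) \<circ> (\<lambda>x. x j)
          \<in> borel_measurable (\<Pi>\<^sub>M k\<in>UNIV. count_space UNIV)"
        by (intro measurable_comp[where N="count_space UNIV"] measurable_component_singleton) auto
      then show "(\<lambda>x. emeasure (?D x j) (E j)) \<in> borel_measurable (\<Pi>\<^sub>M k\<in>UNIV. count_space UNIV)"
        by (simp add: comp_def)
    qed
    ultimately show "(\<lambda>x. emeasure (PiM UNIV (?D x)) A)
        \<in> borel_measurable (\<Pi>\<^sub>M k\<in>UNIV. count_space UNIV)"
      by simp
  qed (use prob sets_D in auto)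
  show ?thesis
    by (rule measurable_distr_prob_space2[OF K]) simp
qed

lemma prob_space_hmm_law:
  assumes "stochastic_matrix A"
  shows "prob_space (hmm_law \<mu> \<nu> A G)"
  unfolding hmm_law_def
  using measurable_hmm_kernel prob_space_chain_law[OF assms]
  by (intro prob_space_bind'[where M="\<Pi>\<^sub>M k\<in>UNIV. count_space UNIV"])
     (auto simp: space_prob_algebra sets_chain_law[OF assms])

lemma sets_hmm_law:
  assumes "stochastic_matrix A"
  shows "sets (hmm_law \<mu> \<nu> A G) =
           sets ((\<Pi>\<^sub>M k\<in>UNIV. count_space UNIV) \<Otimes>\<^sub>M (\<Pi>\<^sub>M k\<in>UNIV. borel))"
  unfolding hmm_law_def
  by (rule sets_bind) (auto simp: prob_space.not_empty[OF prob_space_chain_law[OF assms]])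

lemma emeasure_hmm_law:
  assumes A: "stochastic_matrix A" and B: "\<And>k. B k \<in> sets borel"
  shows "emeasure (hmm_law \<mu> \<nu> A G) {(x, y). \<forall>k\<le>n. x k = a k \<and> y k \<in> B k} =
           ennreal (pmf \<nu> (a 0) * (\<Prod>u = 1..n. A $ a (u - 1) $ a u)) *
           (\<Prod>k\<le>n. \<integral>\<^sup>+ y\<in>B k. ennreal (G (a k) y) \<partial>\<mu>)"
proof -
  let ?X = "\<Pi>\<^sub>M (k::nat)\<in>UNIV. count_space (UNIV :: 'x set)"
  let ?Y = "\<Pi>\<^sub>M (k::nat)\<in>UNIV. (borel :: 'y measure)"
  let ?D = "\<lambda>x k. density \<mu> (\<lambda>y. ennreal (G (x k) y))"
  let ?S = "{(x, y). \<forall>k\<le>n. x k = a k \<and> y k \<in> B k}"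
  let ?K = "\<lambda>x. distr (PiM UNIV (?D x)) (?X \<Otimes>\<^sub>M ?Y) (\<lambda>y. (x, y))"
  note [measurable] = B
  have sp: "space \<mu> = UNIV" using sets_eq_imp_space_eq[OF sets_\<mu>] by simp
  have sets_D: "sets (PiM UNIV (?D x)) = sets ?Y" for x :: "nat \<Rightarrow> 'x"
    by (intro sets_PiM_cong) (simp_all add: sets_\<mu>)
  have X: "{x. \<forall>k\<le>n. x k = a k} \<in> sets ?X"
  proof -
    have "{x \<in> space ?X. \<forall>k\<in>{..n}. x k \<in> {a k}} \<in> sets ?X" by measurable
    then show ?thesis by (simp add: space_PiM Ball_def)
  qed
  have Y: "{y. \<forall>k\<le>n. y k \<in> B k} \<in> sets ?Y"
  proof -
    have "{y \<in> space ?Y. \<forall>k\<in>{..n}. y k \<in> B k} \<in> sets ?Y" by measurable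
    then show ?thesis by (simp add: space_PiM Ball_def)
  qed
  have S_eq: "?S = {x. \<forall>k\<le>n. x k = a k} \<times> {y. \<forall>k\<le>n. y k \<in> B k}" by auto
  have S: "?S \<in> sets (?X \<Otimes>\<^sub>M ?Y)"
    unfolding S_eq using X Y by (rule pair_measureI)
  have K: "emeasure (?K x) ?S = (\<Prod>k\<le>n. \<integral>\<^sup>+ y\<in>B k. ennreal (G (a k) y) \<partial>\<mu>) *
             indicator {x. \<forall>k\<le>n. x k = a k} x" for x
  proof -
    interpret product_prob_space "?D x" UNIV
      by (intro product_prob_spaceI prob_space_density_G)
    have "(\<lambda>y. (x, y)) \<in> PiM UNIV (?D x) \<rightarrow>\<^sub>M ?X \<Otimes>\<^sub>M ?Y"
      unfolding measurable_cong_sets[OF sets_D refl] by (rule measurable_Pair1') (simp add: space_PiM)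
    then have "emeasure (?K x) ?S = emeasure (PiM UNIV (?D x)) {y. (x, y) \<in> ?S}"
      using S by (subst emeasure_distr) (auto simp: space_PiM sp vimage_def)
    also have "\<dots> = (\<Prod>k\<le>n. emeasure (?D x k) (B k)) * indicator {x. \<forall>k\<le>n. x k = a k} x"
    proof (cases "\<forall>k\<le>n. x k = a k")
      case True
      then have "{y. (x, y) \<in> ?S} = prod_emb UNIV (?D x) {..n} (\<Pi>\<^sub>E k\<in>{..n}. B k)"
        by (auto simp: prod_emb_def sp PiE_iff)
      then show ?thesis
        using True by (simp add: emeasure_PiM_emb sets_\<mu> B)
    next
      case False
      then have "{y. (x, y) \<in> ?S} = {}" by auto
      with False show ?thesis by (simp del: not_all)
    qed
    also have "\<dots> = (\<Prod>k\<le>n. \<integral>\<^sup>+ y\<in>B k. ennreal (G (a k) y) \<partial>\<mu>) *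
        indicator {x. \<forall>k\<le>n. x k = a k} x"
      using G_measurable
      by (auto simp: emeasure_density sets_\<mu> B measurable_cong_sets[OF sets_\<mu> refl]
            split: split_indicator intro!: prod.cong)
    finally show ?thesis .
  qed
  have "emeasure (hmm_law \<mu> \<nu> A G) ?S = (\<integral>\<^sup>+ x. emeasure (?K x) ?S \<partial>chain_law \<nu> A)"
    unfolding hmm_law_def
    using measurable_prob_algebraD[OF measurable_hmm_kernel]
    by (intro emeasure_bind[OF _ _ S])
       (auto simp: prob_space.not_empty[OF prob_space_chain_law[OF A]]
          measurable_cong_sets[OF sets_chain_law[OF A] refl])
  also have "\<dots> = (\<Prod>k\<le>n. \<integral>\<^sup>+ y\<in>B k. ennreal (G (a k) y) \<partial>\<mu>) *
      emeasure (chain_law \<nu> A) {x. \<forall>k\<le>n. x k = a k}"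
    unfolding K using X by (intro nn_integral_cmult_indicator) (simp add: sets_chain_law[OF A])
  finally show ?thesis
    by (simp add: emeasure_chain_law[OF A] mult.commute)
qed

end

end

theory Submission
  imports Defs
begin

text \<open>
  Let \<open>p\<^sub>n\<close> be the stationary likelihood of the true parameter and \<open>\<lambda>\<^sub>n(\<theta>)\<close> the sum over all initial
  states of the likelihoods of \<open>\<theta>\<close>, which is submultiplicative in \<open>n\<close>. If no stationary version of
  \<open>\<theta>\<close> has the true observation law, Gordan's alternative yields a bounded function of finitely many
  observations whose conditional mean under \<open>\<theta>\<close>, from every initial state, stays below its true
  stationary mean. Exponentiating its block sums and using \<open>ln z \<le> z - 1\<close> shows that
  \<open>ln (\<lambda>\<^sub>N(\<theta>) / p\<^sub>N)\<close> has negative mean for some \<open>N\<close>; by domination this persists for the supremum over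
  a small ball around \<open>\<theta>\<close>. The maximal ergodic inequality, ergodicity of the observations, and the
  fact that a product of block densities exceeds \<open>p\<^sub>n\<close> at most polynomially (a density quotient has
  mean at most one) then make the supremum of \<open>\<lambda>\<^sub>n / p\<^sub>n\<close> over the ball exponentially small.
\<close>

section \<open>Path sums and sequences\<close>

text \<open>A model \<theta> outside the class may be reducible and its densities may vanish, so it
  need not forget its initial state. The proof therefore identifies no limit of normalised
  log-likelihoods. Only upper bounds on likelihood ratios enter, and for these the sum over initial
  states is the natural majorant, since at any time the chain restarts from one of finitely many
  states. A lower bound on a likelihood is required only at the true parameter, where
  \<open>\<nu>\<close> dominates a multiple of the stationary law because it charges every state.
  Three obstacles shape the rest. The true chain may be periodic, so blocks sampled every
  \<open>N\<close> steps need not be ergodic; the starting phase of the blocks is chosen along each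
  path, which is why the block densities carry single observations at both ends. A likelihood ratio
  may vanish, so a small constant \<open>c\<close> is added inside the logarithm. A supremum over a
  ball need not be measurable, so it is taken over a countable dense set and extended by
  continuity.\<close>

definition path_sum ::
  "nat \<Rightarrow> ('x::finite \<Rightarrow> 'a::comm_semiring_1) \<Rightarrow> (nat \<Rightarrow> 'x \<Rightarrow> 'x \<Rightarrow> 'a) \<Rightarrow> ('x \<Rightarrow> 'a) \<Rightarrow> 'a" where
  "path_sum n f w t =
     (\<Sum>x \<in> {..n} \<rightarrow>\<^sub>E UNIV. f (x 0) * (\<Prod>u = 1..n. w u (x (u - 1)) (x u)) * t (x n))"

lemma path_sum_0: "path_sum 0 f w t = (\<Sum>x\<in>UNIV. f x * t x)"
proof -
  have "path_sum 0 f w t = (\<Sum>x \<in> {0::nat} \<rightarrow>\<^sub>E UNIV. f (x 0) * t (x 0))"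
    by (simp add: path_sum_def)
  also have "\<dots> = (\<Sum>a\<in>UNIV. f a * t a)"
    by (rule sum.reindex_bij_witness[where i="\<lambda>a. \<lambda>k\<in>{0}. a" and j="\<lambda>x. x 0"])
       (auto simp: PiE_def extensional_def fun_eq_iff)
  finally show ?thesis .
qed

lemma path_sum_Suc_last:
  "path_sum (Suc n) f w t = path_sum n f w (\<lambda>a. \<Sum>b\<in>UNIV. w (Suc n) a b * t b)"
proof -
  let ?h = "\<lambda>(y, g). g(Suc n := y)"
  have ins: "{..Suc n} = insert (Suc n) {..n}" by auto
  have "path_sum (Suc n) f w t =
      (\<Sum>x \<in> ?h ` (UNIV \<times> ({..n} \<rightarrow>\<^sub>E UNIV)).
        f (x 0) * (\<Prod>u = 1..Suc n. w u (x (u - 1)) (x u)) * t (x (Suc n)))"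
    unfolding path_sum_def ins PiE_insert_eq by simp
  also have "\<dots> = (\<Sum>(b, x) \<in> UNIV \<times> ({..n} \<rightarrow>\<^sub>E UNIV).
        f (x 0) * ((\<Prod>u = 1..n. w u (x (u - 1)) (x u)) * w (Suc n) (x n) b) * t b)"
  proof (subst sum.reindex)
    show "inj_on ?h (UNIV \<times> ({..n} \<rightarrow>\<^sub>E UNIV))" by (rule inj_combinator) simp
    have "(\<Prod>u = 1..n. w u ((x(Suc n := b)) (u - 1)) ((x(Suc n := b)) u)) =
        (\<Prod>u = 1..n. w u (x (u - 1)) (x u))" for x b
      by (intro prod.cong) auto
    then show "sum ((\<lambda>x. f (x 0) * (\<Prod>u = 1..Suc n. w u (x (u - 1)) (x u)) * t (x (Suc n))) \<circ> ?h)
        (UNIV \<times> ({..n} \<rightarrow>\<^sub>E UNIV)) = (\<Sum>(b, x) \<in> UNIV \<times> ({..n} \<rightarrow>\<^sub>E UNIV).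
        f (x 0) * ((\<Prod>u = 1..n. w u (x (u - 1)) (x u)) * w (Suc n) (x n) b) * t b)"
      by (intro sum.cong refl) (simp split: prod.split)
  qed
  also have "\<dots> = path_sum n f w (\<lambda>a. \<Sum>b\<in>UNIV. w (Suc n) a b * t b)"
    unfolding path_sum_def sum_distrib_left
    by (subst sum.swap) (simp add: sum.cartesian_product mult_ac)
  finally show ?thesis .
qed

text \<open>Splitting off the last step only changes the terminal weight \<open>t\<close>. Keeping
  \<open>t\<close> arbitrary in the induction therefore turns the last-step formula into the
  first-step one, so paths are reindexed only once.\<close>

lemma path_sum_Suc_first:
  "path_sum (Suc n) f w t = path_sum n (\<lambda>b. \<Sum>a\<in>UNIV. f a * w 1 a b) (\<lambda>u. w (Suc u)) t"
proof (induction n arbitrary: t)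
  case 0
  show ?case
    unfolding path_sum_Suc_last path_sum_0 sum_distrib_left sum_distrib_right
    by (subst sum.swap) (simp add: mult_ac)
next
  case (Suc n)
  show ?case
    by (subst path_sum_Suc_last, subst Suc) (simp add: path_sum_Suc_last)
qed

lemma path_sum_cmult: "path_sum n (\<lambda>x. c * f x) w t = c * path_sum n f w t"
  by (simp add: path_sum_def sum_distrib_left mult_ac)

lemma path_sum_sum: "finite I \<Longrightarrow> path_sum n (\<lambda>x. \<Sum>i\<in>I. f i x) w t = (\<Sum>i\<in>I. path_sum n (f i) w t)"
  unfolding path_sum_def sum_distrib_right by (rule sum.swap)

section \<open>Shifts and functions of finitely many observations\<close>

definition drop_seq :: "nat \<Rightarrow> (nat \<Rightarrow> 'y) \<Rightarrow> nat \<Rightarrow> 'y" where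
  "drop_seq n y = (\<lambda>k. y (n + k))"

lemma drop_seq_apply: "drop_seq n y k = y (n + k)"
  by (simp add: drop_seq_def)

lemma drop_seq_0 [simp]: "drop_seq 0 y = y"
  by (simp add: drop_seq_def)

lemma drop_seq_drop_seq [simp]: "drop_seq m (drop_seq n y) = drop_seq (n + m) y"
  by (simp add: drop_seq_def fun_eq_iff add.assoc)

lemma drop_seq_Suc_case_nat [simp]: "drop_seq (Suc n) (case_nat a w) = drop_seq n w"
  by (simp add: drop_seq_def fun_eq_iff)

abbreviation seqs :: "(nat \<Rightarrow> 'y::topological_space) measure" where
  "seqs \<equiv> \<Pi>\<^sub>M k\<in>UNIV. borel"

lemma measurable_drop_seq [measurable]: "drop_seq n \<in> seqs \<rightarrow>\<^sub>M seqs"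
  unfolding drop_seq_def by (rule measurable_PiM_single') (auto simp: space_PiM)

lemma measurable_case_nat_seqs [measurable]:
  "(\<lambda>(y, w). case_nat y w) \<in> borel \<Otimes>\<^sub>M seqs \<rightarrow>\<^sub>M seqs"
  by (simp add: split_beta')

text \<open>Dependence on finitely many coordinates is expressed pointwise and on whole sequences,
  so that shifted and unshifted functions keep one type.\<close>

definition depends_on_first :: "nat \<Rightarrow> ((nat \<Rightarrow> 'y) \<Rightarrow> 'a) \<Rightarrow> bool" where
  "depends_on_first n f \<longleftrightarrow> (\<forall>y y'. (\<forall>i<n. y i = y' i) \<longrightarrow> f y = f y')"

lemma depends_on_firstD: "depends_on_first n f \<Longrightarrow> (\<And>i. i < n \<Longrightarrow> y i = y' i) \<Longrightarrow> f y = f y'"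
  by (simp add: depends_on_first_def)

lemma depends_on_first_case_nat:
  "depends_on_first (Suc n) f \<Longrightarrow> depends_on_first n (\<lambda>w. f (case_nat a w))"
  by (auto simp: depends_on_first_def split: nat.splits)

lemma depends_on_first_mono: "depends_on_first m f \<Longrightarrow> m \<le> n \<Longrightarrow> depends_on_first n f"
  by (auto simp: depends_on_first_def)

lemma depends_on_first_comp: "depends_on_first n f \<Longrightarrow> depends_on_first n (\<lambda>y. F (f y))"
  unfolding depends_on_first_def by (intro allI impI arg_cong[where f=F]) blast

lemma depends_on_first_comp2:
  "depends_on_first n f \<Longrightarrow> depends_on_first n g \<Longrightarrow> depends_on_first n (\<lambda>y. F (f y) (g y))"
  unfolding depends_on_first_def by (intro allI impI arg_cong2[where f=F]) blast+

lemma depends_on_first_drop_seq: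
  "depends_on_first n f \<Longrightarrow> depends_on_first (m + n) (\<lambda>y. f (drop_seq m y))"
  by (auto simp: depends_on_first_def drop_seq_apply)

lemma depends_on_first_coord: "i < n \<Longrightarrow> depends_on_first n (\<lambda>y. F (y i))"
  by (auto simp: depends_on_first_def)

lemma depends_on_first_const: "depends_on_first n (\<lambda>y. c)"
  by (auto simp: depends_on_first_def)

lemma depends_on_first_cylinder: "depends_on_first (Suc n) (indicator {y. \<forall>k\<le>n. y k \<in> B k})"
  unfolding depends_on_first_def
proof (intro allI impI)
  fix y y' :: "nat \<Rightarrow> 'a" assume "\<forall>i<Suc n. y i = y' i"
  then have "y k = y' k" if "k \<le> n" for k using that by simp
  then have "y \<in> {y. \<forall>k\<le>n. y k \<in> B k} \<longleftrightarrow> y' \<in> {y. \<forall>k\<le>n. y k \<in> B k}" by simp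
  then show "indicator {y. \<forall>k\<le>n. y k \<in> B k} y = (indicator {y. \<forall>k\<le>n. y k \<in> B k} y' :: 'b)"
    by (simp only: indicator_def)
qed

lemma depends_on_first_sum:
  "(\<And>i. i \<in> I \<Longrightarrow> depends_on_first n (f i)) \<Longrightarrow> depends_on_first n (\<lambda>y. \<Sum>i\<in>I. f i y)"
  unfolding depends_on_first_def by (intro allI impI sum.cong) auto

lemma depends_on_first_prod:
  "(\<And>i. i \<in> I \<Longrightarrow> depends_on_first n (f i)) \<Longrightarrow> depends_on_first n (\<lambda>y. \<Prod>i\<in>I. f i y)"
  unfolding depends_on_first_def by (intro allI impI prod.cong) auto

text \<open>Cylinders over initial segments determine a finite measure. Only segments of length at
  least two are tested, so that a first-step decomposition always has a step to split off.\<close>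

lemma measure_eqI_seqs:
  fixes P Q :: "(nat \<Rightarrow> 'y::topological_space) measure"
  assumes P: "sets P = sets seqs" and Q: "sets Q = sets seqs"
    and eq: "\<And>n B. (\<And>k. B k \<in> sets borel) \<Longrightarrow>
      emeasure P {y. \<forall>k\<le>Suc n. y k \<in> B k} = emeasure Q {y. \<forall>k\<le>Suc n. y k \<in> B k}"
    and fin: "finite_measure P"
  shows "P = Q"
proof (rule measure_eqI_PiM_infinite[OF P Q _ fin])
  fix A and J :: "nat set"
  assume J: "finite J" and A: "\<And>i. i \<in> J \<Longrightarrow> A i \<in> sets (borel :: 'y measure)"
  obtain n where n: "J \<subseteq> {..n}" using J by (meson finite_nat_iff_bounded_le)
  define B where "B k = (if k \<in> J then A k else UNIV)" for k
  have "k \<le> Suc n" if "k \<in> J" for k using n that by auto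
  then have "prod_emb UNIV (\<lambda>_. borel) J (Pi\<^sub>E J A) = {y. \<forall>k\<le>Suc n. y k \<in> B k}"
    by (auto simp: prod_emb_def B_def PiE_iff)
  then show "emeasure P (prod_emb UNIV (\<lambda>_. borel) J (Pi\<^sub>E J A)) =
      emeasure Q (prod_emb UNIV (\<lambda>_. borel) J (Pi\<^sub>E J A))"
    using A by (simp, intro eq) (auto simp: B_def)
qed

lemma cylinder_sets:
  assumes "\<And>k. B k \<in> sets (borel :: 'y::topological_space measure)"
  shows "{y. \<forall>k\<le>(n::nat). y k \<in> B k} \<in> sets seqs"
proof -
  note [measurable] = assms
  have "{y \<in> space seqs. \<forall>k\<in>{..n}. y k \<in> B k} \<in> sets seqs" by measurable
  then show ?thesis by (simp add: space_PiM Ball_def)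
qed

text \<open>The recursion behind the backward algorithm. Here \<open>n\<close> counts observations,
  whereas \<open>likelihood\<close> at \<open>n\<close> involves \<open>n + 1\<close> of them; hence
  the \<open>Suc n\<close> when the two are compared.\<close>

primrec state_likelihood ::
  "real^'x::finite^'x \<Rightarrow> ('x \<Rightarrow> 'y \<Rightarrow> real) \<Rightarrow> nat \<Rightarrow> 'x \<Rightarrow> (nat \<Rightarrow> 'y) \<Rightarrow> real" where
  "state_likelihood A G 0 x y = 1"
| "state_likelihood A G (Suc n) x y =
     G x (y 0) * (\<Sum>b\<in>UNIV. A $ x $ b * state_likelihood A G n b (drop_seq 1 y))"

lemma likelihood_eq_state_likelihood:
  assumes A: "stochastic_matrix A"
  shows "likelihood \<nu> A G n y = (\<Sum>x\<in>UNIV. pmf \<nu> x * state_likelihood A G (Suc n) x y)"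
proof -
  have row: "(\<Sum>b\<in>UNIV. A $ a $ b) = 1" for a
    using A by (simp add: stochastic_matrix_def)
  \<comment> \<open>Arbitrary weights \<open>c\<close> replace the initial law because the induction
    step passes to unnormalised forward weights, which need not sum to one.\<close>
  have *: "path_sum n (\<lambda>x. c x * G x (y 0)) (\<lambda>u a b. A $ a $ b * G b (y u)) (\<lambda>_. 1) =
      (\<Sum>x\<in>UNIV. c x * state_likelihood A G (Suc n) x y)" for c :: "_ \<Rightarrow> real" and y
  proof (induction n arbitrary: c y)
    case 0
    show ?case by (simp add: path_sum_0 row)
  next
    case (Suc n)
    have "path_sum (Suc n) (\<lambda>x. c x * G x (y 0)) (\<lambda>u a b. A $ a $ b * G b (y u)) (\<lambda>_. 1) =
        path_sum n (\<lambda>b. (\<Sum>a\<in>UNIV. c a * G a (y 0) * A $ a $ b) * G b (drop_seq 1 y 0))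
          (\<lambda>u a b. A $ a $ b * G b (drop_seq 1 y u)) (\<lambda>_. 1)"
      by (simp add: path_sum_Suc_first sum_distrib_right mult.assoc drop_seq_apply)
    also have "\<dots> = (\<Sum>b\<in>UNIV. (\<Sum>a\<in>UNIV. c a * G a (y 0) * A $ a $ b) *
        state_likelihood A G (Suc n) b (drop_seq 1 y))"
      by (rule Suc)
    also have "\<dots> = (\<Sum>x\<in>UNIV. c x * state_likelihood A G (Suc (Suc n)) x y)"
      unfolding state_likelihood.simps(2)[of A G "Suc n"] sum_distrib_left sum_distrib_right
      by (subst sum.swap) (simp add: mult_ac)
    finally show ?case .
  qed
  show ?thesis
    unfolding *[symmetric] by (simp add: likelihood_def path_sum_def)
qed

lemma depends_on_first_state_likelihood: "depends_on_first n (state_likelihood A G n x)"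
proof (induction n arbitrary: x)
  case 0
  show ?case by (simp add: depends_on_first_def)
next
  case (Suc n)
  have "depends_on_first (Suc n) (\<lambda>y. state_likelihood A G n b (drop_seq 1 y))" for b
    using depends_on_first_drop_seq[OF Suc[of b], of 1] by (simp only: plus_1_eq_Suc)
  then show ?case
    unfolding state_likelihood.simps
    by (intro depends_on_first_comp2[where F="(*)"] depends_on_first_sum depends_on_first_const
        depends_on_first_coord) auto
qed

section \<open>The first-step decomposition of the observation law\<close>

definition row_pmf :: "real^'x::finite^'x \<Rightarrow> 'x \<Rightarrow> 'x pmf" where
  "row_pmf A x = embed_pmf (\<lambda>b. A $ x $ b)"

lemma pmf_row_pmf: "stochastic_matrix A \<Longrightarrow> pmf (row_pmf A x) b = A $ x $ b"
  unfolding row_pmf_def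
  by (rule pmf_embed_pmf) (auto simp: stochastic_matrix_def nn_integral_count_space_finite sum_ennreal)

locale hmm =
  fixes \<mu> :: "'y::polish_space measure" and A :: "real^'x::finite^'x" and G :: "'x \<Rightarrow> 'y \<Rightarrow> real"
  assumes sets_\<mu>: "sets \<mu> = sets borel"
    and sigma_finite_\<mu>: "sigma_finite_measure \<mu>"
    and stochastic: "stochastic_matrix A"
    and G_measurable: "\<And>x. G x \<in> borel_measurable borel"
    and G_nonneg: "\<And>x y. 0 \<le> G x y"
    and G_density: "\<And>x. (\<integral>\<^sup>+ y. ennreal (G x y) \<partial>\<mu>) = 1"
begin

lemma measurable_\<mu>_iff: "f \<in> measurable \<mu> N \<longleftrightarrow> f \<in> measurable borel N"
  by (simp add: measurable_cong_sets[OF sets_\<mu> refl])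

lemma space_\<mu>: "space \<mu> = UNIV"
  using sets_eq_imp_space_eq[OF sets_\<mu>] by simp

lemma A_nonneg: "0 \<le> A $ x $ b"
  using stochastic by (simp add: stochastic_matrix_def)

lemma A_row_sum: "(\<Sum>b\<in>UNIV. A $ x $ b) = 1"
  using stochastic by (simp add: stochastic_matrix_def)

abbreviation obs :: "'x pmf \<Rightarrow> (nat \<Rightarrow> 'y) measure" where
  "obs \<nu> \<equiv> observation_law \<mu> \<nu> A G"

abbreviation obs_from :: "'x \<Rightarrow> (nat \<Rightarrow> 'y) measure" where
  "obs_from x \<equiv> obs (return_pmf x)"

abbreviation emission :: "'x \<Rightarrow> 'y measure" where
  "emission x \<equiv> density \<mu> (\<lambda>y. ennreal (G x y))"

lemma sets_obs [measurable_cong]: "sets (obs \<nu>) = sets seqs"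
  by (simp add: observation_law_def)

lemma space_obs [simp]: "space (obs \<nu>) = UNIV"
  using sets_eq_imp_space_eq[OF sets_obs] by (simp add: space_PiM)

lemma measurable_snd_hmm_law:
  "snd \<in> hmm_law \<mu> \<nu> A G \<rightarrow>\<^sub>M seqs"
  by (simp add: measurable_cong_sets[OF sets_hmm_law[OF sets_\<mu> G_measurable G_density stochastic] refl])

lemma prob_space_obs: "prob_space (obs \<nu>)"
  unfolding observation_law_def
  by (intro prob_space.prob_space_distr measurable_snd_hmm_law
      prob_space_hmm_law[OF sets_\<mu> G_measurable G_density stochastic])

lemma sets_emission [measurable_cong]: "sets (emission x) = sets borel"
  by (simp add: sets_\<mu>)

lemma prob_space_emission: "prob_space (emission x)"
  by (rule prob_space_density_G[OF sets_\<mu> G_measurable G_density])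

text \<open>The event is split according to the hidden path up to time \<open>n\<close>. The result
  is a path sum in \<open>ennreal\<close>; the algebra of \<open>path_sum\<close>, stated for
  semirings, is thus shared with the real likelihoods.\<close>

lemma emeasure_obs_cylinder:
  assumes B: "\<And>k. B k \<in> sets borel"
  shows "emeasure (obs \<nu>) {y. \<forall>k\<le>n. y k \<in> B k} =
    path_sum n (\<lambda>x. ennreal (pmf \<nu> x) * emission x (B 0))
      (\<lambda>u a b. ennreal (A $ a $ b) * emission b (B u)) (\<lambda>_. 1)"
proof -
  let ?H = "hmm_law \<mu> \<nu> A G"
  let ?C = "\<lambda>a :: nat \<Rightarrow> 'x. {(x, y). \<forall>k\<le>n. x k = a k \<and> y k \<in> B k}"
  let ?X = "\<Pi>\<^sub>M (k::nat)\<in>UNIV. count_space (UNIV :: 'x set)"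
  have sets_H: "sets ?H = sets (?X \<Otimes>\<^sub>M seqs)"
    by (rule sets_hmm_law[OF sets_\<mu> G_measurable G_density stochastic])
  have C_sets: "?C a \<in> sets ?H" for a
  proof -
    have "{x \<in> space ?X. \<forall>k\<in>{..n}. x k \<in> {a k}} \<in> sets ?X" by measurable
    then have X: "{x. \<forall>k\<le>n. x k = a k} \<in> sets ?X" by (simp add: space_PiM Ball_def)
    have "?C a = {x. \<forall>k\<le>n. x k = a k} \<times> {y. \<forall>k\<le>n. y k \<in> B k}" by auto
    then show ?thesis unfolding sets_H using X cylinder_sets[OF B] by (simp add: pair_measureI)
  qed
  have em: "(\<integral>\<^sup>+ y\<in>S. ennreal (G a y) \<partial>\<mu>) = emission a S" if "S \<in> sets borel" for a S
    using that G_measurable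
    by (subst emeasure_density) (auto simp: measurable_\<mu>_iff sets_\<mu>)
  have split_prod: "(\<Prod>k\<le>n. h k) = h 0 * (\<Prod>u = 1..n. h u)" for h :: "nat \<Rightarrow> ennreal"
    by (simp add: atMost_atLeast0 prod.atLeast_Suc_atMost)
  have "emeasure (obs \<nu>) {y. \<forall>k\<le>n. y k \<in> B k} =
      emeasure ?H (snd -` {y. \<forall>k\<le>n. y k \<in> B k} \<inter> space ?H)"
    unfolding observation_law_def
    by (rule emeasure_distr[OF measurable_snd_hmm_law cylinder_sets[OF B]])
  also have "snd -` {y. \<forall>k\<le>n. y k \<in> B k} \<inter> space ?H = (\<Union>a \<in> {..n} \<rightarrow>\<^sub>E UNIV. ?C a)"
  proof -
    have sp: "space ?H = UNIV"
      using sets_eq_imp_space_eq[OF sets_H] by (simp add: space_pair_measure space_PiM)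
    have "(x, y) \<in> (\<Union>a \<in> {..n} \<rightarrow>\<^sub>E UNIV. ?C a)" if "\<forall>k\<le>n. y k \<in> B k" for x y
      using that by (intro UN_I[of "restrict x {..n}"]) auto
    then show ?thesis unfolding sp by auto
  qed
  also have "emeasure ?H (\<Union>a \<in> {..n} \<rightarrow>\<^sub>E UNIV. ?C a) = (\<Sum>a \<in> {..n} \<rightarrow>\<^sub>E UNIV. emeasure ?H (?C a))"
  proof (rule sum_emeasure[symmetric])
    show "disjoint_family_on ?C ({..n} \<rightarrow>\<^sub>E UNIV)"
      unfolding disjoint_family_on_def
    proof (intro ballI impI)
      fix a b :: "nat \<Rightarrow> 'x"
      assume ab: "a \<in> {..n} \<rightarrow>\<^sub>E UNIV" "b \<in> {..n} \<rightarrow>\<^sub>E UNIV" "a \<noteq> b"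
      then obtain k where "k \<le> n" "a k \<noteq> b k"
        by (metis PiE_ext atMost_iff)
      then show "?C a \<inter> ?C b = {}" by auto
    qed
  qed (auto simp: C_sets finite_PiE)
  also have "\<dots> = (\<Sum>a \<in> {..n} \<rightarrow>\<^sub>E UNIV. ennreal (pmf \<nu> (a 0)) * emission (a 0) (B 0) *
      (\<Prod>u = 1..n. ennreal (A $ a (u - 1) $ a u) * emission (a u) (B u)))"
  proof (intro sum.cong refl)
    fix a
    have "ennreal (pmf \<nu> (a 0) * (\<Prod>u = 1..n. A $ a (u - 1) $ a u)) =
        ennreal (pmf \<nu> (a 0)) * (\<Prod>u = 1..n. ennreal (A $ a (u - 1) $ a u))"
      by (simp add: ennreal_mult prod_nonneg A_nonneg prod_ennreal)
    moreover have "emeasure ?H (?C a) = ennreal (pmf \<nu> (a 0) * (\<Prod>u = 1..n. A $ a (u - 1) $ a u)) *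
        (\<Prod>k\<le>n. emission (a k) (B k))"
      using emeasure_hmm_law[where B=B and n=n and \<nu>=\<nu> and a=a,
          OF sets_\<mu> G_measurable G_density stochastic B]
      by (simp only: em[OF B])
    ultimately show "emeasure ?H (?C a) = ennreal (pmf \<nu> (a 0)) * emission (a 0) (B 0) *
      (\<Prod>u = 1..n. ennreal (A $ a (u - 1) $ a u) * emission (a u) (B u))"
      by (simp add: split_prod prod.distrib mult_ac)
  qed
  finally show ?thesis by (simp add: path_sum_def)
qed

lemma emeasure_obs_cylinder_mix:
  assumes B: "\<And>k. B k \<in> sets borel"
  shows "emeasure (obs \<nu>) {y. \<forall>k\<le>n. y k \<in> B k} =
    (\<Sum>x\<in>UNIV. ennreal (pmf \<nu> x) * emeasure (obs_from x) {y. \<forall>k\<le>n. y k \<in> B k})"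
proof -
  have ind: "ennreal (pmf (return_pmf x) z) = indicator {x} z" for x z :: 'x
    by (simp add: pmf_return indicator_def)
  have "(\<Sum>x\<in>UNIV. ennreal (pmf \<nu> x) * (ennreal (pmf (return_pmf x) z) * c)) =
      (\<Sum>x\<in>UNIV. if x = z then ennreal (pmf \<nu> z) * c else 0)" for z c
    by (intro sum.cong refl) (auto simp: ind)
  then have "(\<lambda>z. ennreal (pmf \<nu> z) * emission z (B 0)) =
      (\<lambda>z. \<Sum>x\<in>UNIV. ennreal (pmf \<nu> x) * (ennreal (pmf (return_pmf x) z) * emission z (B 0)))"
    by simp
  then show ?thesis
    by (simp only: emeasure_obs_cylinder[OF B] path_sum_sum[OF finite] path_sum_cmult)
qed

lemma obs_eq_bind: "obs \<nu> = measure_pmf \<nu> \<bind> obs_from"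
proof (rule measure_eqI_seqs)
  have m: "obs_from \<in> measure_pmf \<nu> \<rightarrow>\<^sub>M subprob_algebra seqs"
    by (auto simp: measurable_def space_subprob_algebra prob_space_imp_subprob_space[OF prob_space_obs] sets_obs)
  show "sets (measure_pmf \<nu> \<bind> obs_from) = sets seqs"
    by (rule sets_bind) (auto simp: sets_obs)
  fix n and B :: "nat \<Rightarrow> 'y set" assume B: "\<And>k. B k \<in> sets borel"
  have "emeasure (measure_pmf \<nu> \<bind> obs_from) {y. \<forall>k\<le>Suc n. y k \<in> B k} =
      (\<integral>\<^sup>+x. emeasure (obs_from x) {y. \<forall>k\<le>Suc n. y k \<in> B k} \<partial>measure_pmf \<nu>)"
    by (rule emeasure_bind[OF _ m cylinder_sets[OF B]]) simp
  then show "emeasure (obs \<nu>) {y. \<forall>k\<le>Suc n. y k \<in> B k} =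
      emeasure (measure_pmf \<nu> \<bind> obs_from) {y. \<forall>k\<le>Suc n. y k \<in> B k}"
    by (subst emeasure_obs_cylinder_mix[OF B])
       (simp add: nn_integral_measure_pmf nn_integral_count_space_finite)
qed (simp_all add: sets_obs prob_space.finite_measure[OF prob_space_obs])

lemma nn_integral_obs:
  assumes [measurable]: "h \<in> borel_measurable seqs"
  shows "(\<integral>\<^sup>+y. h y \<partial>obs \<nu>) = (\<Sum>x\<in>UNIV. ennreal (pmf \<nu> x) * (\<integral>\<^sup>+y. h y \<partial>obs_from x))"
proof -
  have m: "obs_from \<in> measure_pmf \<nu> \<rightarrow>\<^sub>M subprob_algebra seqs"
    by (auto simp: measurable_def space_subprob_algebra prob_space_imp_subprob_space[OF prob_space_obs] sets_obs)
  show ?thesis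
    by (subst obs_eq_bind)
       (simp add: nn_integral_bind[OF assms m] nn_integral_measure_pmf nn_integral_count_space_finite)
qed

text \<open>The Markov property at time one in product form: from a known state the first
  observation is independent of the later ones, which come from a chain restarted with a row of
  \<open>A\<close>. All recursions for integrals below rest on it.\<close>

lemma obs_from_eq_distr:
  "obs_from x = distr (emission x \<Otimes>\<^sub>M obs (row_pmf A x)) seqs (\<lambda>(y, w). case_nat y w)"
proof (rule measure_eqI_seqs)
  interpret E: prob_space "emission x" by (rule prob_space_emission)
  interpret R: prob_space "obs (row_pmf A x)" by (rule prob_space_obs)
  interpret pair_prob_space "emission x" "obs (row_pmf A x)" ..
  have m: "(\<lambda>(y, w). case_nat y w) \<in> emission x \<Otimes>\<^sub>M obs (row_pmf A x) \<rightarrow>\<^sub>M seqs"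
    by measurable
  fix n and B :: "nat \<Rightarrow> 'y set" assume B: "\<And>k. B k \<in> sets borel"
  have "emeasure (distr (emission x \<Otimes>\<^sub>M obs (row_pmf A x)) seqs (\<lambda>(y, w). case_nat y w))
      {y. \<forall>k\<le>Suc n. y k \<in> B k} = emeasure (emission x \<Otimes>\<^sub>M obs (row_pmf A x))
        ((\<lambda>(y, w). case_nat y w) -` {y. \<forall>k\<le>Suc n. y k \<in> B k} \<inter> space (emission x \<Otimes>\<^sub>M obs (row_pmf A x)))"
    by (rule emeasure_distr[OF m cylinder_sets[OF B]])
  also have "(\<lambda>(y, w). case_nat y w) -` {y. \<forall>k\<le>Suc n. y k \<in> B k} \<inter> space (emission x \<Otimes>\<^sub>M obs (row_pmf A x))
      = B 0 \<times> {w. \<forall>k\<le>n. w k \<in> B (Suc k)}"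
    by (auto simp: space_pair_measure space_\<mu> split: nat.splits)
  also have "emeasure (emission x \<Otimes>\<^sub>M obs (row_pmf A x)) (B 0 \<times> {w. \<forall>k\<le>n. w k \<in> B (Suc k)}) =
      emission x (B 0) * obs (row_pmf A x) {w. \<forall>k\<le>n. w k \<in> B (Suc k)}"
    using B cylinder_sets[of "\<lambda>k. B (Suc k)" n] by (intro R.emeasure_pair_measure_Times) (auto simp: sets_\<mu> sets_obs)
  also have "obs (row_pmf A x) {w. \<forall>k\<le>n. w k \<in> B (Suc k)} =
     path_sum n (\<lambda>b. ennreal (A $ x $ b) * emission b (B 1))
      (\<lambda>u a b. ennreal (A $ a $ b) * emission b (B (Suc u))) (\<lambda>_. 1)"
    by (subst emeasure_obs_cylinder) (auto simp: B pmf_row_pmf[OF stochastic])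
  also have "emission x (B 0) * \<dots> = path_sum n (\<lambda>b. emission x (B 0) * (ennreal (A $ x $ b) * emission b (B 1)))
      (\<lambda>u a b. ennreal (A $ a $ b) * emission b (B (Suc u))) (\<lambda>_. 1)"
    by (simp only: path_sum_cmult)
  also have "\<dots> = emeasure (obs_from x) {y. \<forall>k\<le>Suc n. y k \<in> B k}"
  proof -
    have ind: "ennreal (pmf (return_pmf x) z) = indicator {x} z" for z :: 'x
      by (simp add: pmf_return indicator_def)
    have "(\<Sum>a\<in>UNIV. ennreal (pmf (return_pmf x) a) * emission a (B 0) *
            (ennreal (A $ a $ b) * emission b (B 1)))
        = emission x (B 0) * (ennreal (A $ x $ b) * emission b (B 1))" for b
    proof -
      have "(\<Sum>a\<in>UNIV. ennreal (pmf (return_pmf x) a) * emission a (B 0) *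
            (ennreal (A $ a $ b) * emission b (B 1))) =
          (\<Sum>a\<in>UNIV. if a = x then emission x (B 0) * (ennreal (A $ x $ b) * emission b (B 1)) else 0)"
        by (intro sum.cong refl) (auto simp: ind)
      then show ?thesis by simp
    qed
    then show ?thesis
      by (simp only: emeasure_obs_cylinder[OF B] path_sum_Suc_first)
  qed
  finally show "emeasure (obs_from x) {y. \<forall>k\<le>Suc n. y k \<in> B k} =
      emeasure (distr (emission x \<Otimes>\<^sub>M obs (row_pmf A x)) seqs (\<lambda>(y, w). case_nat y w))
      {y. \<forall>k\<le>Suc n. y k \<in> B k}" by simp
qed (simp_all add: sets_obs prob_space.finite_measure[OF prob_space_obs])

lemma nn_integral_obs_from:
  assumes [measurable]: "h \<in> borel_measurable seqs"
  shows "(\<integral>\<^sup>+y. h y \<partial>obs_from x) =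
    (\<integral>\<^sup>+y. ennreal (G x y) * (\<Sum>b\<in>UNIV. ennreal (A $ x $ b) * (\<integral>\<^sup>+w. h (case_nat y w) \<partial>obs_from b)) \<partial>\<mu>)"
proof -
  interpret E: prob_space "emission x" by (rule prob_space_emission)
  interpret R: prob_space "obs (row_pmf A x)" by (rule prob_space_obs)
  interpret pair_prob_space "emission x" "obs (row_pmf A x)" ..
  have [measurable]: "G x \<in> borel_measurable \<mu>" by (simp add: measurable_\<mu>_iff G_measurable)
  have inner: "(\<integral>\<^sup>+w. h (case_nat y w) \<partial>obs (row_pmf A x)) =
      (\<Sum>b\<in>UNIV. ennreal (A $ x $ b) * (\<integral>\<^sup>+w. h (case_nat y w) \<partial>obs_from b))" for y
    by (subst nn_integral_obs) (auto simp: pmf_row_pmf[OF stochastic])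
  have meas: "(\<lambda>y. \<integral>\<^sup>+w. h (case_nat y w) \<partial>obs (row_pmf A x)) \<in> borel_measurable \<mu>"
    by (simp add: measurable_\<mu>_iff) measurable
  have "(\<integral>\<^sup>+y. h y \<partial>obs_from x) =
     (\<integral>\<^sup>+p. h (case p of (y, w) \<Rightarrow> case_nat y w) \<partial>(emission x \<Otimes>\<^sub>M obs (row_pmf A x)))"
    by (subst obs_from_eq_distr, subst nn_integral_distr) auto
  also have "\<dots> = (\<integral>\<^sup>+y. \<integral>\<^sup>+w. h (case_nat y w) \<partial>obs (row_pmf A x) \<partial>emission x)"
    by (subst R.nn_integral_fst[symmetric]) auto
  also have "\<dots> = (\<integral>\<^sup>+y. ennreal (G x y) * (\<integral>\<^sup>+w. h (case_nat y w) \<partial>obs (row_pmf A x)) \<partial>\<mu>)"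
    using meas by (subst nn_integral_density) auto
  finally show ?thesis by (simp only: inner)
qed

end

section \<open>Likelihoods, ergodicity and the maximal ergodic inequality\<close>

text \<open>Integral over the first \<open>n\<close> coordinates against the \<open>n\<close>-fold
  power of \<open>\<mu>\<close>, in a recursive form that matches \<open>state_likelihood\<close>.
  Coordinates beyond \<open>n\<close> receive a dummy value, harmless for functions that depend on
  the first \<open>n\<close> only.\<close>

primrec iter_integral :: "'y measure \<Rightarrow> nat \<Rightarrow> ((nat \<Rightarrow> 'y) \<Rightarrow> ennreal) \<Rightarrow> ennreal" where
  "iter_integral \<mu> 0 = (\<lambda>f. f (\<lambda>_. undefined))"
| "iter_integral \<mu> (Suc n) = (\<lambda>f. \<integral>\<^sup>+y. iter_integral \<mu> n (\<lambda>w. f (case_nat y w)) \<partial>\<mu>)"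

lemma iter_integral_mono: "(\<And>y. f y \<le> g y) \<Longrightarrow> iter_integral \<mu> n f \<le> iter_integral \<mu> n g"
  by (induction n arbitrary: f g) (auto intro!: nn_integral_mono)

section \<open>Likelihoods as densities for iterated integrals\<close>

context hmm
begin

interpretation \<mu>: sigma_finite_measure \<mu> by (rule sigma_finite_\<mu>)

text \<open>The parameter is a whole sequence so that the variable being integrated can be pushed
  onto its front; the induction hypothesis then covers the inner integrals jointly in both.\<close>

lemma measurable_iter_integral_param:
  fixes f :: "(nat \<Rightarrow> 'y) \<times> (nat \<Rightarrow> 'y) \<Rightarrow> ennreal"
  assumes "f \<in> borel_measurable (seqs \<Otimes>\<^sub>M seqs)"
  shows "(\<lambda>z. iter_integral \<mu> n (\<lambda>w. f (z, w))) \<in> borel_measurable seqs"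
  using assms
proof (induction n arbitrary: f)
  case 0
  have "(\<lambda>z. (z, \<lambda>_. undefined)) \<in> seqs \<rightarrow>\<^sub>M seqs \<Otimes>\<^sub>M seqs"
    by (intro measurable_Pair measurable_ident_sets measurable_const refl) (simp add: space_PiM)
  from measurable_compose[OF this 0] show ?case by simp
next
  case (Suc n)
  note [measurable] = Suc.prems
  have [measurable]: "(\<lambda>z. iter_integral \<mu> n (\<lambda>w. f (drop_seq 1 z, case_nat (z 0) w))) \<in> borel_measurable seqs"
    using Suc.IH[of "\<lambda>(z, w). f (drop_seq 1 z, case_nat (z 0) w)"] by simp
  have cn: "(\<lambda>(z, y). case_nat y z) \<in> seqs \<Otimes>\<^sub>M \<mu> \<rightarrow>\<^sub>M seqs"
    by (simp add: measurable_cong_sets[OF sets_pair_measure_cong[OF refl sets_\<mu>] refl] split_beta')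
  have "(\<lambda>p. iter_integral \<mu> n (\<lambda>w. f (drop_seq 1 (case p of (z, y) \<Rightarrow> case_nat y z),
        case_nat ((case p of (z, y) \<Rightarrow> case_nat y z) 0) w))) \<in> borel_measurable (seqs \<Otimes>\<^sub>M \<mu>)"
    by (rule measurable_compose[OF cn]) measurable
  then have "(\<lambda>(z, y). iter_integral \<mu> n (\<lambda>w. f (z, case_nat y w))) \<in> borel_measurable (seqs \<Otimes>\<^sub>M \<mu>)"
    by (simp add: split_beta')
  then show ?case
    by (simp add: \<mu>.borel_measurable_nn_integral)
qed

lemma measurable_iter_integral_case_nat:
  assumes [measurable]: "f \<in> borel_measurable seqs"
  shows "(\<lambda>y. iter_integral \<mu> n (\<lambda>w. f (case_nat y w))) \<in> borel_measurable \<mu>"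
proof -
  have *: "(\<lambda>z. iter_integral \<mu> n (\<lambda>w. f (case_nat (z 0) w))) \<in> borel_measurable seqs"
    using measurable_iter_integral_param[of "\<lambda>(z, w). f (case_nat (z 0) w)" n] by simp
  \<comment> \<open>The constant sequence embeds a single observation; only its coordinate 0 is
    read.\<close>
  have "(\<lambda>y. (\<lambda>z. iter_integral \<mu> n (\<lambda>w. f (case_nat (z 0) w))) (\<lambda>_. y)) \<in> borel_measurable borel"
    by (rule measurable_compose[OF _ *]) (rule measurable_PiM_single', auto)
  then show ?thesis by (simp add: measurable_\<mu>_iff)
qed

lemma iter_integral_cmult:
  assumes "f \<in> borel_measurable seqs"
  shows "iter_integral \<mu> n (\<lambda>y. c * f y) = c * iter_integral \<mu> n f"
  using assms
proof (induction n arbitrary: f)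
  case (Suc n)
  note [measurable] = Suc.prems
  have "(\<lambda>w. f (case_nat y w)) \<in> borel_measurable seqs" for y
    by measurable
  then show ?case
    by (simp add: Suc.IH nn_integral_cmult measurable_iter_integral_case_nat)
qed simp

lemma iter_integral_add:
  assumes "f \<in> borel_measurable seqs" "g \<in> borel_measurable seqs"
  shows "iter_integral \<mu> n (\<lambda>y. f y + g y) = iter_integral \<mu> n f + iter_integral \<mu> n g"
  using assms
proof (induction n arbitrary: f g)
  case (Suc n)
  note [measurable] = Suc.prems
  have "(\<lambda>w. f (case_nat y w)) \<in> borel_measurable seqs" "(\<lambda>w. g (case_nat y w)) \<in> borel_measurable seqs" for y
    by measurable
  then show ?case
    by (simp add: Suc.IH nn_integral_add measurable_iter_integral_case_nat)
qed simp

lemma iter_integral_zero: "iter_integral \<mu> n (\<lambda>y. 0) = 0"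
  by (induction n) auto

lemma iter_integral_sum:
  assumes "finite I" "\<And>i. i \<in> I \<Longrightarrow> f i \<in> borel_measurable seqs"
  shows "iter_integral \<mu> n (\<lambda>y. \<Sum>i\<in>I. f i y) = (\<Sum>i\<in>I. iter_integral \<mu> n (f i))"
  using assms by (induction rule: finite_induct) (simp_all add: iter_integral_zero iter_integral_add)

lemma iter_integral_append:
  assumes "f \<in> borel_measurable seqs" "depends_on_first m f" "g \<in> borel_measurable seqs"
  shows "iter_integral \<mu> (m + n) (\<lambda>y. f y * g (drop_seq m y)) = iter_integral \<mu> m f * iter_integral \<mu> n g"
  using assms(1,2)
proof (induction m arbitrary: f)
  case 0
  have "f y = f (\<lambda>_. undefined)" for y
    by (rule depends_on_firstD[OF 0(2)]) simp
  then have "(\<lambda>y. f y * g (drop_seq 0 y)) = (\<lambda>y. f (\<lambda>_. undefined) * g y)"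
    by (metis drop_seq_0)
  then show ?case
    using iter_integral_cmult[OF assms(3), of n "f (\<lambda>_. undefined)"] by simp
next
  case (Suc m)
  note [measurable] = Suc.prems(1)
  have "(\<lambda>w. f (case_nat y w)) \<in> borel_measurable seqs" for y
    by measurable
  then have "iter_integral \<mu> (m + n) (\<lambda>w. f (case_nat y w) * g (drop_seq m w)) =
      iter_integral \<mu> m (\<lambda>w. f (case_nat y w)) * iter_integral \<mu> n g" for y
    by (rule Suc.IH) (rule depends_on_first_case_nat[OF Suc.prems(2)])
  then show ?case
    by (simp add: nn_integral_multc measurable_iter_integral_case_nat)
qed

lemma measurable_state_likelihood [measurable]: "state_likelihood A G n x \<in> borel_measurable seqs"
proof (induction n arbitrary: x)
  case 0
  have "state_likelihood A G 0 x = (\<lambda>_. 1)" by (simp add: fun_eq_iff)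
  then show ?case by simp
next
  case (Suc n)
  note [measurable] = Suc G_measurable
  have "state_likelihood A G (Suc n) x =
      (\<lambda>y. G x (y 0) * (\<Sum>b\<in>UNIV. A $ x $ b * state_likelihood A G n b (drop_seq 1 y)))"
    by (simp add: fun_eq_iff)
  then show ?case by simp
qed

lemma state_likelihood_nonneg: "0 \<le> state_likelihood A G n x y"
  by (induction n arbitrary: x y) (auto intro!: mult_nonneg_nonneg sum_nonneg G_nonneg A_nonneg)

text \<open>Both sides obey the same first-step recursion. This is the sense in which
  \<open>state_likelihood\<close> is the density of the first \<open>n\<close> observations.\<close>

lemma nn_integral_obs_from_eq_iter_integral:
  assumes "f \<in> borel_measurable seqs" "depends_on_first n f"
  shows "(\<integral>\<^sup>+y. f y \<partial>obs_from x) = iter_integral \<mu> n (\<lambda>y. f y * ennreal (state_likelihood A G n x y))"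
  using assms
proof (induction n arbitrary: x f)
  case 0
  interpret prob_space "obs_from x" by (rule prob_space_obs)
  have "f y = f (\<lambda>_. undefined)" for y
    by (rule depends_on_firstD[OF 0(2)]) simp
  then have "(\<integral>\<^sup>+y. f y \<partial>obs_from x) = (\<integral>\<^sup>+y. f (\<lambda>_. undefined) \<partial>obs_from x)"
    by metis
  then show ?case by (simp add: emeasure_space_1[simplified])
next
  case (Suc n)
  note [measurable] = Suc.prems(1)
  have m[measurable]: "(\<lambda>w. f (case_nat y w)) \<in> borel_measurable seqs" for y
    by measurable
  note d = depends_on_first_case_nat[OF Suc.prems(2)]
  have "(\<integral>\<^sup>+y. f y \<partial>obs_from x) = (\<integral>\<^sup>+y. ennreal (G x y) * (\<Sum>b\<in>UNIV. ennreal (A $ x $ b) *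
      iter_integral \<mu> n (\<lambda>w. f (case_nat y w) * ennreal (state_likelihood A G n b w))) \<partial>\<mu>)"
    by (simp add: nn_integral_obs_from Suc.IH[OF m d])
  also have "\<dots> = (\<integral>\<^sup>+y. iter_integral \<mu> n (\<lambda>w. f (case_nat y w) *
      ennreal (state_likelihood A G (Suc n) x (case_nat y w))) \<partial>\<mu>)"
  proof (intro nn_integral_cong)
    fix y
    have "ennreal (G x y) * (\<Sum>b\<in>UNIV. ennreal (A $ x $ b) *
        iter_integral \<mu> n (\<lambda>w. f (case_nat y w) * ennreal (state_likelihood A G n b w))) =
      iter_integral \<mu> n (\<lambda>w. ennreal (G x y) * (\<Sum>b\<in>UNIV. ennreal (A $ x $ b) *
        (f (case_nat y w) * ennreal (state_likelihood A G n b w))))"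
      by (simp add: iter_integral_cmult iter_integral_sum)
    also have "(\<lambda>w. ennreal (G x y) * (\<Sum>b\<in>UNIV. ennreal (A $ x $ b) *
        (f (case_nat y w) * ennreal (state_likelihood A G n b w)))) =
        (\<lambda>w. f (case_nat y w) * ennreal (state_likelihood A G (Suc n) x (case_nat y w)))"
    proof
      fix w
      have "ennreal (state_likelihood A G (Suc n) x (case_nat y w)) =
         ennreal (G x y) * (\<Sum>b\<in>UNIV. ennreal (A $ x $ b) * ennreal (state_likelihood A G n b w))"
        by (simp add: ennreal_mult sum_ennreal[symmetric] G_nonneg A_nonneg state_likelihood_nonneg sum_nonneg
            del: sum_ennreal)
      then show "ennreal (G x y) * (\<Sum>b\<in>UNIV. ennreal (A $ x $ b) *
        (f (case_nat y w) * ennreal (state_likelihood A G n b w))) =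
        f (case_nat y w) * ennreal (state_likelihood A G (Suc n) x (case_nat y w))"
        by (simp add: sum_distrib_left mult_ac del: state_likelihood.simps)
    qed
    finally show "ennreal (G x y) * (\<Sum>b\<in>UNIV. ennreal (A $ x $ b) *
        iter_integral \<mu> n (\<lambda>w. f (case_nat y w) * ennreal (state_likelihood A G n b w))) =
        iter_integral \<mu> n (\<lambda>w. f (case_nat y w) *
      ennreal (state_likelihood A G (Suc n) x (case_nat y w)))" .
  qed
  finally show ?case by (simp del: state_likelihood.simps)
qed

section \<open>Likelihoods over initial states and the Markov property\<close>

definition mix_likelihood :: "'x pmf \<Rightarrow> nat \<Rightarrow> (nat \<Rightarrow> 'y) \<Rightarrow> real" where
  "mix_likelihood \<nu> n y = (\<Sum>x\<in>UNIV. pmf \<nu> x * state_likelihood A G n x y)"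

definition total_likelihood :: "nat \<Rightarrow> (nat \<Rightarrow> 'y) \<Rightarrow> real" where
  "total_likelihood n y = (\<Sum>x\<in>UNIV. state_likelihood A G n x y)"

lemma measurable_mix_likelihood [measurable]: "mix_likelihood \<nu> n \<in> borel_measurable seqs"
  unfolding mix_likelihood_def by measurable

lemma measurable_total_likelihood [measurable]: "total_likelihood n \<in> borel_measurable seqs"
  unfolding total_likelihood_def by measurable

lemma mix_likelihood_nonneg: "0 \<le> mix_likelihood \<nu> n y"
  unfolding mix_likelihood_def by (intro sum_nonneg mult_nonneg_nonneg state_likelihood_nonneg) auto

lemma total_likelihood_nonneg: "0 \<le> total_likelihood n y"
  unfolding total_likelihood_def by (intro sum_nonneg state_likelihood_nonneg)

lemma depends_on_first_mix_likelihood: "depends_on_first n (mix_likelihood \<nu> n)"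
  unfolding mix_likelihood_def
  by (intro depends_on_first_sum depends_on_first_comp2[where F="(*)"] depends_on_first_const
      depends_on_first_state_likelihood)

lemma depends_on_first_total_likelihood: "depends_on_first n (total_likelihood n)"
  unfolding total_likelihood_def
  by (intro depends_on_first_sum depends_on_first_state_likelihood)

lemma nn_integral_obs_eq_iter_integral:
  assumes [measurable]: "f \<in> borel_measurable seqs" and "depends_on_first n f"
  shows "(\<integral>\<^sup>+y. f y \<partial>obs \<nu>) = iter_integral \<mu> n (\<lambda>y. f y * ennreal (mix_likelihood \<nu> n y))"
proof -
  have "(\<integral>\<^sup>+y. f y \<partial>obs \<nu>) = (\<Sum>x\<in>UNIV. ennreal (pmf \<nu> x) *
      iter_integral \<mu> n (\<lambda>y. f y * ennreal (state_likelihood A G n x y)))"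
    by (subst nn_integral_obs) (simp_all add: nn_integral_obs_from_eq_iter_integral[OF assms])
  also have "\<dots> = iter_integral \<mu> n (\<lambda>y. \<Sum>x\<in>UNIV. ennreal (pmf \<nu> x) *
      (f y * ennreal (state_likelihood A G n x y)))"
    by (simp add: iter_integral_cmult iter_integral_sum)
  also have "(\<lambda>y. \<Sum>x\<in>UNIV. ennreal (pmf \<nu> x) * (f y * ennreal (state_likelihood A G n x y))) =
      (\<lambda>y. f y * ennreal (mix_likelihood \<nu> n y))"
    by (simp add: mix_likelihood_def sum_ennreal[symmetric] ennreal_mult state_likelihood_nonneg
        sum_distrib_left mult_ac fun_eq_iff del: sum_ennreal)
  finally show ?thesis .
qed

lemma nn_integral_total_likelihood:
  assumes [measurable]: "f \<in> borel_measurable seqs" and "depends_on_first n f"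
  shows "iter_integral \<mu> n (\<lambda>y. f y * ennreal (total_likelihood n y)) = (\<Sum>x\<in>UNIV. \<integral>\<^sup>+y. f y \<partial>obs_from x)"
proof -
  have "(\<Sum>x\<in>UNIV. \<integral>\<^sup>+y. f y \<partial>obs_from x) =
      iter_integral \<mu> n (\<lambda>y. \<Sum>x\<in>UNIV. f y * ennreal (state_likelihood A G n x y))"
    by (simp add: nn_integral_obs_from_eq_iter_integral[OF assms] iter_integral_sum)
  also have "(\<lambda>y. \<Sum>x\<in>UNIV. f y * ennreal (state_likelihood A G n x y)) =
      (\<lambda>y. f y * ennreal (total_likelihood n y))"
    by (simp add: total_likelihood_def sum_ennreal[symmetric] state_likelihood_nonneg
        sum_distrib_left fun_eq_iff del: sum_ennreal)
  finally show ?thesis by simp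
qed

lemma iter_integral_mix_likelihood: "iter_integral \<mu> n (\<lambda>y. ennreal (mix_likelihood \<nu> n y)) = 1"
proof -
  interpret prob_space "obs \<nu>" by (rule prob_space_obs)
  show ?thesis
    using nn_integral_obs_eq_iter_integral[of "\<lambda>_. 1" n \<nu>]
    by (simp add: depends_on_first_const emeasure_space_1[simplified])
qed

text \<open>After \<open>m\<close> observations the chain continues from some state, and the sum
  over all states dominates the continuation whatever that state is.\<close>

lemma state_likelihood_append:
  "state_likelihood A G (m + n) x y \<le> state_likelihood A G m x y * total_likelihood n (drop_seq m y)"
proof (induction m arbitrary: x y)
  case 0
  then show ?case
    using member_le_sum[of x UNIV "\<lambda>x. state_likelihood A G n x y"]
    by (simp add: total_likelihood_def state_likelihood_nonneg)
next
  case (Suc m)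
  have "state_likelihood A G (Suc m + n) x y \<le>
     G x (y 0) * (\<Sum>b\<in>UNIV. A $ x $ b * (state_likelihood A G m b (drop_seq 1 y) *
       total_likelihood n (drop_seq m (drop_seq 1 y))))"
    unfolding add_Suc state_likelihood.simps
    by (intro mult_left_mono sum_mono Suc A_nonneg G_nonneg)
  then show ?case
    by (simp add: sum_distrib_left sum_distrib_right mult.assoc)
qed

lemma total_likelihood_append:
  "total_likelihood (m + n) y \<le> total_likelihood m y * total_likelihood n (drop_seq m y)"
  unfolding total_likelihood_def[of "m + n"] total_likelihood_def[of m] sum_distrib_right
  by (intro sum_mono state_likelihood_append)

text \<open>The Markov property as a comparison: given the first \<open>m\<close> observations the
  future is a mixture of the laws \<open>obs_from b\<close>, so a bound valid for every
  \<open>b\<close> survives multiplication by \<open>Z\<close>. Applied in both directions it yields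
  an equality.\<close>

lemma nn_integral_obs_from_markov_mono:
  assumes "Z \<in> borel_measurable seqs" "depends_on_first m Z"
    and F[measurable]: "F \<in> borel_measurable seqs" "F' \<in> borel_measurable seqs"
    and le: "\<And>b. (\<integral>\<^sup>+y. F y \<partial>obs_from b) \<le> (\<integral>\<^sup>+y. F' y \<partial>obs_from b)"
  shows "(\<integral>\<^sup>+y. Z y * F (drop_seq m y) \<partial>obs_from x) \<le> (\<integral>\<^sup>+y. Z y * F' (drop_seq m y) \<partial>obs_from x)"
  using assms(1,2)
proof (induction m arbitrary: x Z)
  case 0
  have "Z y = Z (\<lambda>_. undefined)" for y
    by (rule depends_on_firstD[OF 0(2)]) simp
  then have "(\<lambda>y. Z y * H (drop_seq 0 y)) = (\<lambda>y. Z (\<lambda>_. undefined) * H y)" for H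
    by (metis drop_seq_0)
  then show ?case
    by (simp add: nn_integral_cmult le mult_left_mono del: drop_seq_0)
next
  case (Suc m)
  note [measurable] = Suc.prems(1)
  have m[measurable]: "(\<lambda>w. Z (case_nat y w)) \<in> borel_measurable seqs" for y
    by measurable
  have "(\<integral>\<^sup>+y. Z y * H (drop_seq (Suc m) y) \<partial>obs_from x) = (\<integral>\<^sup>+y. ennreal (G x y) *
      (\<Sum>b\<in>UNIV. ennreal (A $ x $ b) * (\<integral>\<^sup>+w. Z (case_nat y w) * H (drop_seq m w) \<partial>obs_from b)) \<partial>\<mu>)"
    if [measurable]: "H \<in> borel_measurable seqs" for H
    by (subst nn_integral_obs_from) simp_all
  note eq = this[OF F(1)] this[OF F(2)]
  show ?case
    unfolding eq
    by (intro nn_integral_mono mult_left_mono sum_mono Suc.IH[OF m] depends_on_first_case_nat Suc.prems zero_le)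
qed

lemma nn_integral_obs_from_drop:
  assumes [measurable]: "h \<in> borel_measurable seqs"
  shows "(\<integral>\<^sup>+y. h (drop_seq 1 y) \<partial>obs_from x) = (\<Sum>b\<in>UNIV. ennreal (A $ x $ b) * (\<integral>\<^sup>+y. h y \<partial>obs_from b))"
proof -
  have [measurable]: "G x \<in> borel_measurable \<mu>" by (simp add: measurable_\<mu>_iff G_measurable)
  show ?thesis
    by (simp add: nn_integral_obs_from[of "\<lambda>y. h (drop_seq 1 y)", simplified] nn_integral_multc G_density)
qed

end

text \<open>A positive multi-step probability has a positive first step into a state from which the
  remaining steps still have positive probability. All later uses of irreducibility go through this
  closure principle.\<close>

lemma irreducible_closed_set:
  assumes irr: "irreducible_matrix A" and nn: "\<And>x b. 0 \<le> A $ x $ b"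
    and S: "x0 \<in> S" and closed: "\<And>x b. x \<in> S \<Longrightarrow> 0 < A $ x $ b \<Longrightarrow> b \<in> S"
  shows "S = (UNIV :: 'x::finite set)"
proof -
  have nn_pow: "0 \<le> matrix_power A n $ x $ b" for n x b
    by (induction n arbitrary: x b)
       (auto simp: matrix_power_def mat_def matrix_matrix_mult_def intro!: sum_nonneg mult_nonneg_nonneg nn)
  have "x' \<in> S" if "x \<in> S" "0 < matrix_power A n $ x $ x'" for x x' n
    using that
  proof (induction n arbitrary: x)
    case 0
    then show ?case by (auto simp: matrix_power_def mat_def split: if_splits)
  next
    case (Suc n)
    have "matrix_power A (Suc n) $ x $ x' = (\<Sum>b\<in>UNIV. A $ x $ b * matrix_power A n $ b $ x')"
      by (simp add: matrix_power_def matrix_matrix_mult_def)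
    with Suc.prems(2) have "\<not> (\<Sum>b\<in>UNIV. A $ x $ b * matrix_power A n $ b $ x') \<le> 0" by simp
    then have "\<not> (\<forall>b\<in>UNIV. A $ x $ b * matrix_power A n $ b $ x' \<le> 0)"
      using sum_nonpos[of UNIV "\<lambda>b. A $ x $ b * matrix_power A n $ b $ x'"] by blast
    then obtain b where b: "0 < A $ x $ b * matrix_power A n $ b $ x'"
      by (auto simp: not_le)
    then have "0 < A $ x $ b" "0 < matrix_power A n $ b $ x'"
      using nn[of x b] nn_pow[of n b x'] by (auto simp: zero_less_mult_iff)
    then show ?case using Suc.IH closed Suc.prems(1) by blast
  qed
  then show ?thesis using irr S unfolding irreducible_matrix_def by blast
qed

section \<open>Maximum principle, zero-one law and stationarity\<close>

context hmm
begin

text \<open>Maximum principle: at a maximiser the average of the nonnegative numbers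
  \<open>m - \<phi> b\<close> over a row vanishes, so the set of maximisers is closed under positive
  transitions.\<close>

lemma harmonic_constant:
  fixes \<phi> :: "'x \<Rightarrow> real"
  assumes irr: "irreducible_matrix A" and harm: "\<And>x. \<phi> x = (\<Sum>b\<in>UNIV. A $ x $ b * \<phi> b)"
  shows "\<exists>c. \<forall>x. \<phi> x = c"
proof -
  define m where "m = Max (range \<phi>)"
  have le: "\<phi> x \<le> m" for x by (simp add: m_def)
  have "m \<in> range \<phi>" unfolding m_def by (rule Max_in) auto
  then obtain x0 where x0: "\<phi> x0 = m" by auto
  have "{x. \<phi> x = m} = UNIV"
  proof (rule irreducible_closed_set[OF irr A_nonneg])
    fix x b assume x: "x \<in> {x. \<phi> x = m}" and b: "0 < A $ x $ b"
    have "(\<Sum>b\<in>UNIV. A $ x $ b * (m - \<phi> b)) = m * (\<Sum>b\<in>UNIV. A $ x $ b) - \<phi> x"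
      by (subst (2) harm) (simp add: algebra_simps sum_subtractf sum_distrib_left)
    then have "(\<Sum>b\<in>UNIV. A $ x $ b * (m - \<phi> b)) = 0" using x by (simp add: A_row_sum)
    then have "A $ x $ b * (m - \<phi> b) = 0"
      using le A_nonneg by (subst (asm) sum_nonneg_eq_0_iff) auto
    then show "b \<in> {x. \<phi> x = m}" using b by simp
  qed (use x0 in auto)
  then show ?thesis by blast
qed

text \<open>The probability of \<open>E\<close> from each initial state is harmonic, hence a
  constant \<open>c\<close>. By the Markov property \<open>c\<close> is also the conditional
  probability of \<open>E\<close> given any finite stretch of observations, so \<open>E\<close> is
  independent of all cylinders and finally of itself. Invariance under the shift by one makes this
  valid for periodic chains too.\<close>

lemma ergodic:
  assumes irr: "irreducible_matrix A"
    and E[measurable]: "E \<in> sets seqs" and inv: "\<And>y. drop_seq 1 y \<in> E \<longleftrightarrow> y \<in> E"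
  shows "emeasure (obs \<nu>) E = 0 \<or> emeasure (obs \<nu>) E = 1"
proof -
  define \<phi> where "\<phi> x = measure (obs_from x) E" for x
  have em: "emeasure (obs_from x) E = ennreal (\<phi> x)" for x
    unfolding \<phi>_def by (intro finite_measure.emeasure_eq_measure prob_space.finite_measure prob_space_obs)
  have nn: "0 \<le> \<phi> x" for x by (simp add: \<phi>_def)
  have ind: "(indicator E (drop_seq 1 y) :: ennreal) = indicator E y" for y
    using inv[of y] by (simp add: indicator_def)
  have h1: "ennreal (\<phi> x) = (\<Sum>b\<in>UNIV. ennreal (A $ x $ b) * ennreal (\<phi> b))" for x
    using nn_integral_obs_from_drop[of "indicator E" x] unfolding ind
    by (simp add: em sets_obs E)
  have h2: "(\<Sum>b\<in>UNIV. ennreal (A $ x $ b) * ennreal (\<phi> b)) = ennreal (\<Sum>b\<in>UNIV. A $ x $ b * \<phi> b)" for x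
    by (simp add: nn A_nonneg ennreal_mult sum_ennreal[symmetric] del: sum_ennreal)
  have "\<phi> x = (\<Sum>b\<in>UNIV. A $ x $ b * \<phi> b)" for x
    using h1[of x] unfolding h2
    by (subst (asm) ennreal_inj) (auto intro!: sum_nonneg mult_nonneg_nonneg nn A_nonneg)
  from harmonic_constant[OF irr this] obtain c where c: "\<And>x. \<phi> x = c" by blast
  have ind_n: "(indicator E (drop_seq n y) :: ennreal) = indicator E y" for n y
  proof (induction n)
    case (Suc n)
    then show ?case using ind[of "drop_seq n y"] by simp
  qed simp
  let ?P = "obs \<nu>"
  have mark: "(\<integral>\<^sup>+y. Z y * indicator E y \<partial>?P) = (\<integral>\<^sup>+y. Z y * ennreal c \<partial>?P)"
    if [measurable]: "Z \<in> borel_measurable seqs" and Z: "depends_on_first m Z" for Z m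
  proof -
    have int: "(\<integral>\<^sup>+y. indicator E y \<partial>obs_from b) = (\<integral>\<^sup>+y. ennreal c \<partial>obs_from b)" for b
      using prob_space.emeasure_space_1[OF prob_space_obs, of "return_pmf b"]
      by (simp add: em c sets_obs E)
    have "(\<integral>\<^sup>+y. Z y * indicator E y \<partial>obs_from x) = (\<integral>\<^sup>+y. Z y * ennreal c \<partial>obs_from x)" for x
    proof (rule antisym)
      show "(\<integral>\<^sup>+y. Z y * indicator E y \<partial>obs_from x) \<le> (\<integral>\<^sup>+y. Z y * ennreal c \<partial>obs_from x)"
        using nn_integral_obs_from_markov_mono[OF that(1) Z, of "indicator E" "\<lambda>_. ennreal c" x]
        by (simp only: ind_n int order_refl) simp
      show "(\<integral>\<^sup>+y. Z y * ennreal c \<partial>obs_from x) \<le> (\<integral>\<^sup>+y. Z y * indicator E y \<partial>obs_from x)"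
        using nn_integral_obs_from_markov_mono[OF that(1) Z, of "\<lambda>_. ennreal c" "indicator E" x]
        by (simp only: ind_n int order_refl) simp
    qed
    then show ?thesis by (subst (1 2) nn_integral_obs) simp_all
  qed
  \<comment> \<open>Independence from all cylinders, written as an equality of measures. Evaluating
    both sides at \<open>E\<close> itself gives \<open>c = c * c\<close>.\<close>
  have "density ?P (indicator E) = scale_measure (ennreal c) ?P"
  proof (rule measure_eqI_seqs)
    fix n and B :: "nat \<Rightarrow> 'y set" assume B: "\<And>k. B k \<in> sets borel"
    let ?C = "{y. \<forall>k\<le>Suc n. y k \<in> B k}"
    note C = cylinder_sets[where B=B and n="Suc n", OF B]
    have "emeasure (density ?P (indicator E)) ?C = (\<integral>\<^sup>+y. indicator ?C y * indicator E y \<partial>?P)"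
      using C by (subst emeasure_density) (simp_all add: sets_obs mult.commute)
    also have "\<dots> = (\<integral>\<^sup>+y. indicator ?C y * ennreal c \<partial>?P)"
    proof (rule mark[where m="Suc (Suc n)"])
      show "depends_on_first (Suc (Suc n)) (indicator ?C :: _ \<Rightarrow> ennreal)"
        by (rule depends_on_first_cylinder)
    qed (rule borel_measurable_indicator[OF C])
    also have "\<dots> = emeasure (scale_measure (ennreal c) ?P) ?C"
      using C by (simp add: mult.commute[of "indicator ?C _"] nn_integral_cmult_indicator sets_obs)
    finally show "emeasure (density ?P (indicator E)) ?C = emeasure (scale_measure (ennreal c) ?P) ?C" .
  next
    show "finite_measure (density ?P (indicator E))"
    proof (rule finite_measureI)
      have "emeasure (density ?P (indicator E)) (space ?P) = emeasure ?P E"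
        using sets.top[of "seqs :: (nat \<Rightarrow> 'y) measure"]
        by (subst emeasure_density) (auto simp: sets_obs space_PiM)
      also have "\<dots> \<noteq> \<infinity>"
        using prob_space.emeasure_le_1[OF prob_space_obs, of \<nu> E] by (auto simp: top_unique)
      finally show "emeasure (density ?P (indicator E)) (space (density ?P (indicator E))) \<noteq> \<infinity>"
        by simp
    qed
  qed (auto simp: sets_obs)
  then have "emeasure (density ?P (indicator E)) E = ennreal c * emeasure ?P E" by simp
  moreover have "emeasure (density ?P (indicator E)) E = emeasure ?P E"
    by (subst emeasure_density) (auto simp: sets_obs simp flip: indicator_inter_arith)
  moreover have "emeasure ?P E = ennreal c"
    using mark[of "\<lambda>_. 1" 0] prob_space.emeasure_space_1[OF prob_space_obs, of \<nu>]
    by (simp add: depends_on_first_const sets_obs)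
  moreover have "0 \<le> c" using nn c by metis
  ultimately have "ennreal c = ennreal (c * c)" by (simp add: ennreal_mult)
  then have "c = c * c" using \<open>0 \<le> c\<close> by (simp add: ennreal_inj)
  then have "c = 0 \<or> c = 1" by simp
  then show ?thesis using \<open>emeasure ?P E = ennreal c\<close> by auto
qed

lemma obs_invariant:
  assumes inv: "invariant_distribution A \<pi>"
  shows "distr (obs \<pi>) (obs \<pi>) (drop_seq n) = obs \<pi>"
proof -
  have one: "(\<integral>\<^sup>+y. h (drop_seq 1 y) \<partial>obs \<pi>) = (\<integral>\<^sup>+y. h y \<partial>obs \<pi>)"
    if [measurable]: "h \<in> borel_measurable seqs" for h
  proof -
    have "(\<integral>\<^sup>+y. h (drop_seq 1 y) \<partial>obs \<pi>) =
       (\<Sum>x\<in>UNIV. ennreal (pmf \<pi> x) * (\<Sum>b\<in>UNIV. ennreal (A $ x $ b) * (\<integral>\<^sup>+y. h y \<partial>obs_from b)))"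
      by (subst nn_integral_obs) (simp_all add: nn_integral_obs_from_drop[OF that] del: One_nat_def)
    also have "\<dots> = (\<Sum>b\<in>UNIV. (\<Sum>x\<in>UNIV. ennreal (pmf \<pi> x) * ennreal (A $ x $ b)) * (\<integral>\<^sup>+y. h y \<partial>obs_from b))"
      unfolding sum_distrib_left sum_distrib_right by (subst sum.swap) (simp add: mult_ac)
    also have "\<dots> = (\<Sum>b\<in>UNIV. ennreal (pmf \<pi> b) * (\<integral>\<^sup>+y. h y \<partial>obs_from b))"
    proof -
      have "(\<Sum>x\<in>UNIV. ennreal (pmf \<pi> x) * ennreal (A $ x $ b)) = ennreal (\<Sum>x\<in>UNIV. pmf \<pi> x * A $ x $ b)" for b
        by (simp add: A_nonneg ennreal_mult sum_ennreal[symmetric] del: sum_ennreal)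
      then show ?thesis using inv by (simp add: invariant_distribution_def)
    qed
    finally show ?thesis by (subst nn_integral_obs) auto
  qed
  have "(\<integral>\<^sup>+y. h (drop_seq n y) \<partial>obs \<pi>) = (\<integral>\<^sup>+y. h y \<partial>obs \<pi>)"
    if [measurable]: "h \<in> borel_measurable seqs" for h
  proof (induction n)
    case (Suc n)
    then show ?case using one[of "\<lambda>y. h (drop_seq n y)"] by simp
  qed simp
  note drop = this
  show ?thesis
  proof (rule measure_eqI)
    fix E assume "E \<in> sets (distr (obs \<pi>) (obs \<pi>) (drop_seq n))"
    then have E[measurable]: "E \<in> sets seqs" by (simp add: sets_obs)
    have "emeasure (distr (obs \<pi>) (obs \<pi>) (drop_seq n)) E = (\<integral>\<^sup>+y. indicator E y \<partial>distr (obs \<pi>) (obs \<pi>) (drop_seq n))"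
      by (simp add: sets_obs E)
    also have "\<dots> = (\<integral>\<^sup>+y. indicator E (drop_seq n y) \<partial>obs \<pi>)"
      by (rule nn_integral_distr) measurable
    also have "\<dots> = emeasure (obs \<pi>) E"
      by (subst drop) (auto simp: sets_obs)
    finally show "emeasure (distr (obs \<pi>) (obs \<pi>) (drop_seq n)) E = emeasure (obs \<pi>) E" .
  qed simp
qed

end

text \<open>It takes the place of a pointwise ergodic theorem: read contrapositively, a negative
  mean prevents the partial sums from being almost surely unbounded above. The event of
  unboundedness is invariant, and on it the running maxima of the partial sums are compared with
  their shifts.\<close>

lemma maximal_ergodic:
  fixes f :: "'a \<Rightarrow> real"
  assumes prob: "prob_space M" and T[measurable]: "T \<in> M \<rightarrow>\<^sub>M M" and inv: "distr M M T = M"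
    and f: "integrable M f"
  shows "0 \<le> (\<integral>x. indicator {x \<in> space M. \<forall>C::nat. \<exists>k. real C < (\<Sum>i<k. f ((T ^^ i) x))} x * f x \<partial>M)"
proof -
  interpret prob_space M by fact
  have [measurable]: "f \<in> borel_measurable M" using f by auto
  define S where "S k x = (\<Sum>i<k. f ((T ^^ i) x))" for k x
  define E where "E = {x \<in> space M. \<forall>C::nat. \<exists>k. real C < S k x}"
  have [measurable]: "S k \<in> borel_measurable M" for k
    unfolding S_def by (intro borel_measurable_sum measurable_compose[OF _ \<open>f \<in> borel_measurable M\<close>] measurable_compose_n T)
  have [measurable]: "E \<in> sets M" unfolding E_def by measurable
  have S_Suc: "S (Suc k) x = f x + S k (T x)" for k x
    unfolding S_def sum.lessThan_Suc_shift by (simp add: funpow_swap1)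
  \<comment> \<open>\<open>m n x\<close> is the maximum of the partial sums \<open>S 1 x, \<dots>, S (n + 1) x\<close>.\<close>
  define m where "m = rec_nat f (\<lambda>n h x. f x + max 0 (h (T x)))"
  have m_0: "m 0 = f" and m_Suc: "m (Suc n) = (\<lambda>x. f x + max 0 (m n (T x)))" for n
    by (simp_all add: m_def)
  have int_comp: "integrable M (\<lambda>x. h (T x))" if "integrable M h" for h :: "'a \<Rightarrow> real"
    using that by (subst (asm) inv[symmetric]) (simp add: integrable_distr_eq[OF T] integrable_distr[OF T])
  have m_int: "integrable M (m n)" for n
    by (induction n) (auto simp: m_0 m_Suc f int_comp)
  then have [measurable]: "m n \<in> borel_measurable M" for n by auto
  have m_mono: "m n x \<le> m (Suc n) x" for n x
    by (induction n arbitrary: x) (auto simp: m_0 m_Suc max.coboundedI2)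
  have m_ge: "f x \<le> m n x" for n x
    by (cases n) (auto simp: m_0 m_Suc)
  have S_le: "S (Suc n) x \<le> m n x" for n x
  proof (induction n arbitrary: x)
    case 0
    then show ?case by (simp add: m_0 S_def)
  next
    case (Suc n)
    then show ?case using Suc[of "T x"] by (simp add: m_Suc S_Suc[of "Suc n"] max.coboundedI2)
  qed
  have TE: "T x \<in> E" if "x \<in> E" for x
  proof -
    have "x \<in> space M" using that by (simp add: E_def)
    then have "T x \<in> space M" using T by (rule measurable_space[rotated])
    moreover have "\<exists>k. real C < S k (T x)" for C
    proof -
      obtain C' :: nat where C': "real C + \<bar>f x\<bar> < real C'" using reals_Archimedean2 by blast
      from that obtain k where k: "real C' < S k x" unfolding E_def by blast
      then have "k \<noteq> 0" using C' by (auto simp: S_def intro: ccontr)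
      then obtain k' where "k = Suc k'" using not0_implies_Suc by blast
      then have "real C < S k' (T x)" using k C' by (simp add: S_Suc)
      then show ?thesis ..
    qed
    ultimately show ?thesis by (simp add: E_def)
  qed
  have ET: "x \<in> E" if "T x \<in> E" "x \<in> space M" for x
  proof -
    have "\<exists>k. real C < S k x" for C
    proof -
      obtain C' :: nat where C': "real C + \<bar>f x\<bar> < real C'" using reals_Archimedean2 by blast
      from that(1) obtain k where k: "real C' < S k (T x)" unfolding E_def by blast
      then have "real C < S (Suc k) x" using C' by (simp add: S_Suc)
      then show ?thesis ..
    qed
    with that show ?thesis by (simp add: E_def)
  qed
  have TE_iff: "T x \<in> E \<longleftrightarrow> x \<in> E" if "x \<in> space M" for x
    using TE[of x] ET[of x] that by argo
  \<comment> \<open>Since max(0, a) - a = max(0, -a), the integrand is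
    \<open>m (Suc n) x - m n (T x)\<close> on \<open>E\<close>. Invariance lets
    \<open>m n (T x)\<close> be replaced by \<open>m n x\<close> in the integral, and
    \<open>m\<close> increases in \<open>n\<close>. On \<open>E\<close> the maxima eventually become
    nonnegative, so the correction disappears in the limit.\<close>
  have nonneg: "0 \<le> (\<integral>x. indicator E x * (f x + max 0 (- m n (T x))) \<partial>M)" for n
  proof -
    have "(\<integral>x. indicator E x * m n x \<partial>M) = (\<integral>x. indicator E (T x) * m n (T x) \<partial>M)"
      using integral_distr[OF T, of "\<lambda>x. indicator E x * m n x"] by (simp add: inv)
    also have "\<dots> = (\<integral>x. indicator E x * m n (T x) \<partial>M)"
      by (intro Bochner_Integration.integral_cong refl) (simp add: indicator_def TE_iff)
    finally have eq: "(\<integral>x. indicator E x * m n x \<partial>M) = (\<integral>x. indicator E x * m n (T x) \<partial>M)" .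
    have i1: "integrable M (\<lambda>x. indicator E x * m n x)"
      by (rule integrable_mult_indicator[OF _ m_int, simplified]) simp
    have i2: "integrable M (\<lambda>x. indicator E x * m (Suc n) x)"
      by (rule integrable_mult_indicator[OF _ m_int, simplified]) simp
    have i3: "integrable M (\<lambda>x. indicator E x * m n (T x))"
      by (rule integrable_mult_indicator[OF _ int_comp[OF m_int], simplified]) simp
    have "0 \<le> (\<integral>x. indicator E x * m (Suc n) x - indicator E x * m n x \<partial>M)"
      using m_mono by (intro Bochner_Integration.integral_nonneg) (auto simp: indicator_def)
    also have "\<dots> = (\<integral>x. indicator E x * m (Suc n) x - indicator E x * m n (T x) \<partial>M)"
      using i1 i2 i3 eq by simp
    also have "\<dots> = (\<integral>x. indicator E x * (f x + max 0 (- m n (T x))) \<partial>M)"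
      by (intro Bochner_Integration.integral_cong refl) (auto simp: m_Suc indicator_def)
    finally show ?thesis .
  qed
  have "(\<lambda>n. \<integral>x. indicator E x * (f x + max 0 (- m n (T x))) \<partial>M) \<longlonglongrightarrow> (\<integral>x. indicator E x * f x \<partial>M)"
  proof (rule integral_dominated_convergence[where w="\<lambda>x. \<bar>f x\<bar> + \<bar>f (T x)\<bar>"])
    show "integrable M (\<lambda>x. \<bar>f x\<bar> + \<bar>f (T x)\<bar>)"
      using f int_comp[OF f] by auto
    show "AE x in M. norm (indicator E x * (f x + max 0 (- m n (T x)))) \<le> \<bar>f x\<bar> + \<bar>f (T x)\<bar>" for n
    proof (intro AE_I2)
      fix x
      have "f (T x) \<le> m n (T x)" by (rule m_ge)
      then show "norm (indicator E x * (f x + max 0 (- m n (T x)))) \<le> \<bar>f x\<bar> + \<bar>f (T x)\<bar>"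
        by (auto simp: indicator_def)
    qed
    show "AE x in M. (\<lambda>n. indicator E x * (f x + max 0 (- m n (T x)))) \<longlonglongrightarrow> indicator E x * f x"
    proof (intro AE_I2)
      fix x
      show "(\<lambda>n. indicator E x * (f x + max 0 (- m n (T x)))) \<longlonglongrightarrow> indicator E x * f x"
      proof (cases "x \<in> E")
        case True
        from TE[OF True] obtain k where k: "real 0 < S k (T x)" unfolding E_def by blast
        then have "k \<noteq> 0" by (auto simp: S_def intro: ccontr)
        then obtain k' where "k = Suc k'" using not0_implies_Suc by blast
        then have "0 < m k' (T x)" using k S_le[of k' "T x"] by simp
        then have "0 \<le> m n (T x)" if "k' \<le> n" for n
          using lift_Suc_mono_le[of "\<lambda>n. m n (T x)", OF m_mono that] by simp
        then have "\<forall>\<^sub>F n in sequentially. indicator E x * (f x + max 0 (- m n (T x))) = indicator E x * f x"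
          by (auto intro!: eventually_sequentiallyI[of k'])
        then show ?thesis by (rule tendsto_eventually)
      qed simp
    qed
  qed auto
  then have "0 \<le> (\<integral>x. indicator E x * f x \<partial>M)"
    by (rule LIMSEQ_le_const) (use nonneg in auto)
  then show ?thesis by (simp add: E_def S_def)
qed

section \<open>Stationary distributions and recurrence of block sums\<close>

text \<open>Separate \<open>S\<close> from the open negative orthant. A linear functional bounded
  above on a subspace vanishes there, and one bounded below on the orthant has nonpositive
  coefficients only; its negative, normalised, is \<open>\<pi>\<close>.\<close>

lemma gordan_alternative:
  fixes S :: "(real^'n::finite) set"
  assumes S: "subspace S" and none: "\<not> (\<exists>u\<in>S. \<forall>i. u $ i < 0)"
  shows "\<exists>\<pi>. (\<forall>i. 0 \<le> \<pi> $ i) \<and> (\<Sum>i\<in>UNIV. \<pi> $ i) = 1 \<and> (\<forall>u\<in>S. (\<Sum>i\<in>UNIV. \<pi> $ i * u $ i) = 0)"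
proof -
  define T where "T = {t :: real^'n. \<forall>i. t $ i < 0}"
  have "convex T"
    unfolding convex_def T_def
  proof (intro ballI allI impI, clarsimp)
    fix x y :: "real^'n" and u v :: real and i
    assume h: "\<forall>i. x $ i < 0" "\<forall>i. y $ i < 0" "0 \<le> u" "0 \<le> v" "u + v = 1"
    show "u * x $ i + v * y $ i < 0"
    proof (cases "u = 0")
      case True
      with h show ?thesis by simp
    next
      case False
      then have "u * x $ i < 0" using h by (simp add: mult_pos_neg)
      moreover have "v * y $ i \<le> 0" using h by (simp add: mult_nonneg_nonpos less_imp_le)
      ultimately show ?thesis by simp
    qed
  qed
  moreover have "(\<chi> i. -1) \<in> T" by (simp add: T_def)
  moreover have "S \<inter> T = {}" using none by (auto simp: T_def)
  moreover have "S \<noteq> {}" using subspace_0[OF S] by auto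
  ultimately obtain a b where a: "a \<noteq> 0" and aS: "\<And>x. x \<in> S \<Longrightarrow> inner a x \<le> b" and aT: "\<And>x. x \<in> T \<Longrightarrow> b \<le> inner a x"
    using separating_hyperplane_sets[OF subspace_imp_convex[OF S], of T] by blast
  have b: "0 \<le> b" using aS[OF subspace_0[OF S]] by simp
  have orth: "inner a u = 0" if "u \<in> S" for u
  proof (rule ccontr)
    assume n: "inner a u \<noteq> 0"
    have "inner a (((b + 1) / inner a u) *\<^sub>R u) \<le> b"
      by (intro aS subspace_scale[OF S] that)
    with n show False by simp
  qed
  have neg: "a $ i \<le> 0" for i
  proof (rule ccontr)
    assume "\<not> a $ i \<le> 0"
    then have pos: "0 < a $ i" by simp
    \<comment> \<open>\<open>K\<close> is chosen so that coordinate \<open>i\<close> alone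
      contributes \<open>- (1 + s)\<close>, which the other coordinates, together at most
      \<open>s\<close>, cannot compensate.\<close>
    define s where "s = (\<Sum>j\<in>UNIV. \<bar>a $ j\<bar>)"
    define K where "K = (1 + s) / a $ i"
    have "0 \<le> s" by (simp add: s_def sum_nonneg)
    then have K: "0 < K" using pos by (simp add: K_def)
    define t where "t = (\<chi> j. if j = i then - K else - 1)"
    have "t \<in> T" using K by (simp add: T_def t_def)
    have "inner a t = a $ i * t $ i + (\<Sum>j\<in>UNIV - {i}. a $ j * t $ j)"
      by (simp add: inner_vec_def sum.remove[of UNIV i])
    also have "\<dots> \<le> - (1 + s) + (\<Sum>j\<in>UNIV - {i}. \<bar>a $ j\<bar>)"
      using pos by (intro add_mono sum_mono) (auto simp: t_def K_def)
    also have "\<dots> \<le> - (1 + s) + s"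
      unfolding s_def by (intro add_left_mono sum_mono2) auto
    finally have "inner a t < 0" by simp
    with aT[OF \<open>t \<in> T\<close>] b show False by simp
  qed
  define c where "c = - (\<Sum>i\<in>UNIV. a $ i)"
  have "c \<noteq> 0"
  proof
    assume "c = 0"
    then have "(\<Sum>i\<in>UNIV. - a $ i) = 0" by (simp add: c_def sum_negf)
    then have "\<forall>i\<in>UNIV. - a $ i = 0"
      using neg by (subst (asm) sum_nonneg_eq_0_iff) auto
    then show False using a by (auto simp: vec_eq_iff)
  qed
  moreover have "0 \<le> c" unfolding c_def using neg by (simp add: sum_nonpos)
  ultimately have c: "0 < c" by simp
  have "(\<Sum>i\<in>UNIV. (\<chi> i. - a $ i / c) $ i * u $ i) = 0" if "u \<in> S" for u
  proof -
    have "(\<Sum>i\<in>UNIV. (\<chi> i. - a $ i / c) $ i * u $ i) = - (inner a u) / c"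
      by (simp add: inner_vec_def sum_divide_distrib sum_negf)
    then show ?thesis using orth[OF that] by simp
  qed
  moreover have "(\<Sum>i\<in>UNIV. (\<chi> i. - a $ i / c) $ i) = 1"
    using c by (simp add: sum_negf flip: sum_divide_distrib c_def) (simp add: c_def)
  moreover have "0 \<le> (\<chi> i. - a $ i / c) $ i" for i
    using neg c by (simp add: divide_nonpos_pos)
  ultimately show ?thesis by blast
qed

lemma ex_pmf_of_vec:
  fixes \<pi> :: "real^'x::finite"
  assumes "\<And>i. 0 \<le> \<pi> $ i" "(\<Sum>i\<in>UNIV. \<pi> $ i) = 1"
  shows "\<exists>p. \<forall>i. pmf p i = \<pi> $ i"
proof -
  have "pmf (embed_pmf (\<lambda>i. \<pi> $ i)) i = \<pi> $ i" for i
    by (rule pmf_embed_pmf) (auto simp: assms nn_integral_count_space_finite sum_ennreal)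
  then show ?thesis by blast
qed

lemma invariant_distribution_of_orthogonal:
  fixes A :: "real^'x::finite^'x"
  assumes "\<And>v. (\<Sum>x\<in>UNIV. pmf p x * (A *v v - v) $ x) = 0"
  shows "invariant_distribution A p"
  unfolding invariant_distribution_def
proof
  fix b
  have 1: "(A *v axis b 1 - axis b 1) $ x = A $ x $ b - (if x = b then 1 else 0)" for x
    by (simp add: matrix_vector_mult_basis column_def) (simp add: axis_def)
  have "(\<Sum>x\<in>UNIV. pmf p x * (A $ x $ b - (if x = b then 1 else 0))) = 0"
    using assms[of "axis b 1"] unfolding 1 .
  then show "(\<Sum>x\<in>UNIV. pmf p x * A $ x $ b) = pmf p b"
    by (simp add: right_diff_distrib sum_subtractf if_distrib[where f="\<lambda>t. _ * t"] cong: if_cong)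
qed

lemma subspace_range_matrix_minus_id:
  fixes A :: "real^'x::finite^'x"
  shows "subspace (range (\<lambda>v. A *v v - v))"
  by (intro linear_subspace_image subspace_UNIV linear_compose_sub matrix_vector_mul_linear linear_ident)

text \<open>At a coordinate where \<open>v\<close> is minimal, averaging cannot decrease it, so
  \<open>A *v v - v\<close> is never negative throughout. The other branch of Gordan's alternative
  is a probability vector orthogonal to all these vectors, which is invariance.\<close>

lemma ex_invariant_distribution:
  fixes A :: "real^'x::finite^'x"
  assumes A: "stochastic_matrix A"
  shows "\<exists>p. invariant_distribution A p"
proof -
  have "\<not> (\<exists>u\<in>range (\<lambda>v. A *v v - v). \<forall>i. u $ i < 0)"
  proof safe
    fix v assume neg: "\<forall>i. (A *v v - v) $ i < 0"
    define m where "m = Min (range (($) v))"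
    have m: "m \<le> v $ b" for b by (simp add: m_def)
    have "m \<in> range (($) v)" unfolding m_def by (rule Min_in) auto
    then obtain i where i: "m = v $ i" by auto
    have "m = (\<Sum>b\<in>UNIV. A $ i $ b * m)"
      using A by (simp add: stochastic_matrix_def flip: sum_distrib_right)
    also have "\<dots> \<le> (\<Sum>b\<in>UNIV. A $ i $ b * v $ b)"
      using A m by (intro sum_mono mult_left_mono) (auto simp: stochastic_matrix_def)
    finally show False using neg i by (auto simp: matrix_vector_mult_def dest!: spec[of _ i])
  qed
  from gordan_alternative[OF subspace_range_matrix_minus_id this] obtain \<pi>
    where \<pi>: "\<And>i. 0 \<le> \<pi> $ i" "(\<Sum>i\<in>UNIV. \<pi> $ i) = 1"
      "\<And>v. (\<Sum>i\<in>UNIV. \<pi> $ i * (A *v v - v) $ i) = 0" by auto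
  obtain p where "\<And>i. pmf p i = \<pi> $ i" using ex_pmf_of_vec[OF \<pi>(1,2)] by blast
  then have "invariant_distribution A p"
    by (intro invariant_distribution_of_orthogonal) (simp only: \<pi>(3))
  then show ?thesis ..
qed

lemma irreducible_invariant_pos:
  assumes A: "stochastic_matrix A" and irr: "irreducible_matrix A" and inv: "invariant_distribution A p"
  shows "0 < pmf p x"
proof -
  have nn: "0 \<le> A $ x $ b" for x b using A by (simp add: stochastic_matrix_def)
  obtain x0 where "x0 \<in> set_pmf p" using set_pmf_not_empty[of p] by auto
  then have x0: "0 < pmf p x0" by (simp add: pmf_positive)
  have "{x. 0 < pmf p x} = UNIV"
  proof (rule irreducible_closed_set[OF irr nn])
    fix x b assume x: "x \<in> {x. 0 < pmf p x}" and b: "0 < A $ x $ b"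
    then have "0 < pmf p x * A $ x $ b" by simp
    also have "\<dots> \<le> (\<Sum>x\<in>UNIV. pmf p x * A $ x $ b)"
      by (rule member_le_sum) (auto simp: nn)
    finally show "b \<in> {x. 0 < pmf p x}" using inv by (simp add: invariant_distribution_def)
  qed (use x0 in auto)
  then show ?thesis by auto
qed

text \<open>With \<open>t\<close> the least ratio, \<open>p - t q\<close> is a nonnegative invariant
  vector with a zero. Its set of positivity is closed under transitions, hence empty or everything,
  and the zero excludes the latter; comparing total masses gives \<open>t = 1\<close>.\<close>

lemma irreducible_invariant_unique:
  fixes A :: "real^'x::finite^'x"
  assumes A: "stochastic_matrix A" and irr: "irreducible_matrix A"
    and p: "invariant_distribution A p" and q: "invariant_distribution A q"
  shows "p = q"
proof -
  have nn: "0 \<le> A $ x $ b" for x b using A by (simp add: stochastic_matrix_def)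
  note qpos = irreducible_invariant_pos[OF A irr q]
  define t where "t = Min (range (\<lambda>x. pmf p x / pmf q x))"
  have "t \<le> pmf p x / pmf q x" for x by (simp add: t_def)
  then have le: "t * pmf q x \<le> pmf p x" for x using qpos[of x] pos_le_divide_eq by blast
  have "t \<in> range (\<lambda>x. pmf p x / pmf q x)" unfolding t_def by (rule Min_in) auto
  then obtain x1 where "t = pmf p x1 / pmf q x1" by auto
  then have x1: "t * pmf q x1 = pmf p x1" using qpos[of x1] by simp
  have eq: "pmf p x = t * pmf q x" for x
  proof (rule ccontr)
    assume "pmf p x \<noteq> t * pmf q x"
    then have x: "t * pmf q x < pmf p x" using le[of x] by simp
    have "{x. t * pmf q x < pmf p x} = UNIV"
    proof (rule irreducible_closed_set[OF irr nn])
      fix x b assume x: "x \<in> {x. t * pmf q x < pmf p x}" and b: "0 < A $ x $ b"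
      then have "0 < (pmf p x - t * pmf q x) * A $ x $ b" by simp
      also have "\<dots> \<le> (\<Sum>x\<in>UNIV. (pmf p x - t * pmf q x) * A $ x $ b)"
        by (rule member_le_sum) (auto simp: nn le)
      also have "\<dots> = (\<Sum>x\<in>UNIV. pmf p x * A $ x $ b) - t * (\<Sum>x\<in>UNIV. pmf q x * A $ x $ b)"
        by (simp add: algebra_simps sum_subtractf sum_distrib_left)
      finally show "b \<in> {x. t * pmf q x < pmf p x}"
        using p q by (simp add: invariant_distribution_def)
    qed (use x in auto)
    then have "x1 \<in> {x. t * pmf q x < pmf p x}" by simp
    with x1 show False by simp
  qed
  have "1 = (\<Sum>x\<in>UNIV. pmf p x)" by (simp add: sum_pmf_eq_1)
  also have "\<dots> = t * (\<Sum>x\<in>UNIV. pmf q x)" by (simp add: eq sum_distrib_left)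
  finally have "t = 1" by (simp add: sum_pmf_eq_1)
  then show ?thesis by (intro pmf_eqI) (simp add: eq)
qed

lemma invariant_stationary_distribution:
  assumes "stochastic_matrix A" "irreducible_matrix A"
  shows "invariant_distribution A (stationary_distribution A)"
  unfolding stationary_distribution_def
  using ex_invariant_distribution[OF assms(1)] irreducible_invariant_unique[OF assms]
  by (metis theI)

text \<open>The event that all \<open>N\<close> phases have unbounded sums has probability zero or
  one. If it were one, phase 0 would be unbounded almost surely, and the maximal ergodic inequality
  for the shift by \<open>N\<close> would make the mean of \<open>f\<close> nonnegative. The good
  phase may therefore depend on the path.\<close>

lemma (in hmm) exists_phase:
  fixes f :: "(nat \<Rightarrow> 'y) \<Rightarrow> real"
  assumes irr: "irreducible_matrix A" and inv: "invariant_distribution A \<pi>"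
    and f: "integrable (obs \<pi>) f" and neg: "(\<integral>y. f y \<partial>obs \<pi>) < 0" and N: "0 < N"
  shows "AE y in obs \<pi>. \<exists>j<N. \<exists>C. \<forall>k. (\<Sum>i<k. f (drop_seq (j + i * N) y)) \<le> C"
proof -
  interpret prob_space "obs \<pi>" by (rule prob_space_obs)
  have [measurable]: "f \<in> borel_measurable seqs" using f by (simp add: measurable_cong_sets[OF sets_obs refl])
  define E where "E j = {y. \<forall>C::nat. \<exists>k. real C < (\<Sum>i<k. f (drop_seq (j + i * N) y))}" for j
  have E_sets: "E j \<in> sets seqs" for j
  proof -
    have "{y \<in> space seqs. \<forall>C::nat. \<exists>k. real C < (\<Sum>i<k. f (drop_seq (j + i * N) y))} \<in> sets seqs"
      by measurable
    then show ?thesis by (simp add: E_def space_PiM)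
  qed
  have E_drop: "drop_seq 1 y \<in> E j \<longleftrightarrow> y \<in> E (Suc j)" for y j
    by (simp add: E_def)
  \<comment> \<open>Passing from phase 0 to phase \<open>N\<close> only drops the first summand,
    which does not affect unboundedness; this closes the cycle of phases under the shift by
    one.\<close>
  have E_N: "y \<in> E N \<longleftrightarrow> y \<in> E 0" for y
  proof -
    have S: "(\<Sum>i<Suc k. f (drop_seq (0 + i * N) y)) = f y + (\<Sum>i<k. f (drop_seq (N + i * N) y))" for k
      by (subst sum.lessThan_Suc_shift) simp
    show ?thesis
    proof
      assume a: "y \<in> E N"
      have "\<exists>k. real C < (\<Sum>i<k. f (drop_seq (0 + i * N) y))" for C
      proof -
        obtain C' :: nat where C': "real C + \<bar>f y\<bar> < real C'" using reals_Archimedean2 by blast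
        from a obtain k where k: "real C' < (\<Sum>i<k. f (drop_seq (N + i * N) y))" unfolding E_def by blast
        then have "real C < (\<Sum>i<Suc k. f (drop_seq (0 + i * N) y))" using C' unfolding S by linarith
        then show ?thesis ..
      qed
      then show "y \<in> E 0" unfolding E_def by blast
    next
      assume a: "y \<in> E 0"
      have "\<exists>k. real C < (\<Sum>i<k. f (drop_seq (N + i * N) y))" for C
      proof -
        obtain C' :: nat where C': "real C + \<bar>f y\<bar> < real C'" using reals_Archimedean2 by blast
        from a obtain k where k: "real C' < (\<Sum>i<k. f (drop_seq (0 + i * N) y))" unfolding E_def by blast
        have "k \<noteq> 0" using k C' by (cases k) auto
        then obtain k' where "k = Suc k'" using not0_implies_Suc by blast
        with k have "real C' < f y + (\<Sum>i<k'. f (drop_seq (N + i * N) y))" using S[of k'] by simp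
        then have "real C < (\<Sum>i<k'. f (drop_seq (N + i * N) y))" using C' by linarith
        then show ?thesis ..
      qed
      then show "y \<in> E N" unfolding E_def by blast
    qed
  qed
  \<comment> \<open>\<open>E 0\<close> is only invariant under \<open>drop_seq N\<close>, which need not be ergodic; \<open>F\<close> is invariant under \<open>drop_seq 1\<close>.\<close>
  define F where "F = (\<Inter>j<N. E j)"
  have F_sets: "F \<in> sets seqs"
    unfolding F_def using N by (intro sets.finite_INT) (auto simp: E_sets)
  have F_inv: "drop_seq 1 y \<in> F \<longleftrightarrow> y \<in> F" for y
  proof -
    have "drop_seq 1 y \<in> F \<longleftrightarrow> (\<forall>j<N. y \<in> E (Suc j))"
      by (auto simp: F_def E_drop simp del: One_nat_def)
    also have "\<dots> \<longleftrightarrow> (\<forall>j<N. y \<in> E j)"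
    proof
      assume a: "\<forall>j<N. y \<in> E (Suc j)"
      have "y \<in> E N" using a[rule_format, of "N - 1"] N by simp
      then have "y \<in> E 0" by (simp only: E_N)
      moreover have "y \<in> E j" if "j < N" "j \<noteq> 0" for j
        using a[rule_format, of "j - 1"] that by simp
      ultimately show "\<forall>j<N. y \<in> E j" by metis
    next
      assume a: "\<forall>j<N. y \<in> E j"
      then have EN: "y \<in> E N" using N by (simp only: E_N)
      have "y \<in> E (Suc j)" if "j < N" for j
        using a[rule_format, of "Suc j"] EN that by (cases "Suc j = N") simp_all
      then show "\<forall>j<N. y \<in> E (Suc j)" by blast
    qed
    finally show ?thesis by (auto simp: F_def)
  qed
  have "emeasure (obs \<pi>) F \<noteq> 1"
  proof
    assume F1: "emeasure (obs \<pi>) F = 1"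
    have "F \<subseteq> E 0" using N by (auto simp: F_def)
    then have "emeasure (obs \<pi>) F \<le> emeasure (obs \<pi>) (E 0)"
      by (intro emeasure_mono) (simp_all add: sets_obs E_sets)
    then have "emeasure (obs \<pi>) (E 0) = 1" using F1 emeasure_le_1[of "E 0"] by simp
    then have "AE y in obs \<pi>. y \<in> E 0"
      by (subst AE_in_set_eq_1) (auto simp: sets_obs E_sets measure_def)
    then have "(\<integral>y. indicator (E 0) y * f y \<partial>obs \<pi>) = (\<integral>y. f y \<partial>obs \<pi>)"
      using E_sets[of 0] by (intro integral_cong_AE) (auto simp: measurable_cong_sets[OF sets_obs refl])
    moreover have "0 \<le> (\<integral>y. indicator (E 0) y * f y \<partial>obs \<pi>)"
    proof -
      have "(drop_seq N ^^ i) y = drop_seq (i * N) y" for i and y :: "nat \<Rightarrow> 'y"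
        by (induction i arbitrary: y) (simp_all add: add.commute)
      then have "E 0 = {y \<in> space (obs \<pi>). \<forall>C::nat. \<exists>k. real C < (\<Sum>i<k. f ((drop_seq N ^^ i) y))}"
        by (simp add: E_def)
      moreover have "drop_seq N \<in> obs \<pi> \<rightarrow>\<^sub>M obs \<pi>"
        using measurable_drop_seq by (simp add: measurable_cong_sets[OF sets_obs sets_obs])
      ultimately show ?thesis
        using maximal_ergodic[OF prob_space_obs _ obs_invariant[OF inv] f, of N] by simp
    qed
    ultimately show False using neg by simp
  qed
  then have "emeasure (obs \<pi>) F = 0"
    using ergodic[OF irr F_sets F_inv] by blast
  then have "AE y in obs \<pi>. y \<notin> F"
    by (intro AE_not_in null_setsI) (auto simp: sets_obs F_sets)
  then show ?thesis
    by (rule AE_mp) (auto intro!: AE_I2 simp: F_def E_def not_less)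
qed

section \<open>Separation of non-equivalent laws\<close>

definition bounded_local :: "nat \<Rightarrow> ((nat \<Rightarrow> 'y::topological_space) \<Rightarrow> real) \<Rightarrow> bool" where
  "bounded_local n h \<longleftrightarrow> h \<in> borel_measurable seqs \<and> depends_on_first n h \<and> (\<exists>B. \<forall>y. \<bar>h y\<bar> \<le> B)"

lemma bounded_localD:
  assumes "bounded_local n h"
  shows "h \<in> borel_measurable seqs" "depends_on_first n h"
  using assms by (auto simp: bounded_local_def)

lemma bounded_local_bound:
  assumes "bounded_local n h"
  obtains B where "1 \<le> B" "\<And>y. \<bar>h y\<bar> \<le> B"
proof -
  from assms obtain B where "\<And>y. \<bar>h y\<bar> \<le> B" by (auto simp: bounded_local_def)
  then have "\<bar>h y\<bar> \<le> max 1 B" for y by (simp add: max.coboundedI2)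
  then show ?thesis by (rule that[rotated]) simp
qed

lemma bounded_local_mono: "bounded_local m h \<Longrightarrow> m \<le> n \<Longrightarrow> bounded_local n h"
  by (auto simp: bounded_local_def intro: depends_on_first_mono)

lemma bounded_local_const: "bounded_local n (\<lambda>_. c)"
  by (auto simp: bounded_local_def depends_on_first_const)

lemma bounded_local_add:
  assumes "bounded_local n f" "bounded_local n g"
  shows "bounded_local n (\<lambda>y. f y + g y)"
proof -
  obtain B where B: "\<And>y. \<bar>f y\<bar> \<le> B" using bounded_local_bound[OF assms(1)] by blast
  obtain C where C: "\<And>y. \<bar>g y\<bar> \<le> C" using bounded_local_bound[OF assms(2)] by blast
  have "\<bar>f y + g y\<bar> \<le> B + C" for y using B[of y] C[of y] by linarith
  then show ?thesis
    using assms unfolding bounded_local_def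
    by (auto intro: depends_on_first_comp2[where F="(+)"])
qed

lemma bounded_local_cmult:
  assumes "bounded_local n f"
  shows "bounded_local n (\<lambda>y. c * f y)"
proof -
  obtain B where B: "\<And>y. \<bar>f y\<bar> \<le> B" using bounded_local_bound[OF assms(1)] by blast
  have "\<bar>c * f y\<bar> \<le> \<bar>c\<bar> * B" for y using B[of y] by (simp add: abs_mult mult_left_mono)
  then show ?thesis
    using assms unfolding bounded_local_def
    by (auto intro: depends_on_first_comp[where F="(*) c"])
qed

lemma bounded_local_drop_seq:
  assumes "bounded_local n f"
  shows "bounded_local (m + n) (\<lambda>y. f (drop_seq m y))"
  using assms unfolding bounded_local_def by (auto intro: depends_on_first_drop_seq)

lemma bounded_local_sum:
  assumes "\<And>i. i \<in> I \<Longrightarrow> bounded_local n (f i)"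
  shows "bounded_local n (\<lambda>y. \<Sum>i\<in>I. f i y)"
  using assms by (induction I rule: infinite_finite_induct) (auto simp: bounded_local_const bounded_local_add)

lemma bounded_local_integrable:
  assumes "bounded_local n f" "prob_space P" "sets P = sets seqs"
  shows "integrable P f"
proof -
  interpret prob_space P by fact
  obtain B where "\<And>y. \<bar>f y\<bar> \<le> B" using bounded_local_bound[OF assms(1)] by blast
  then show ?thesis
    using bounded_localD(1)[OF assms(1)]
    by (intro integrable_const_bound[where B=B]) (auto simp: measurable_cong_sets[OF assms(3) refl])
qed

text \<open>For negative \<open>z\<close> and \<open>w = - z\<close> the claim says that
  \<open>(1 - w + w\<^sup>2) * exp w\<close> is at least one; the Taylor lower bound
  \<open>1 + w + w\<^sup>2 / 2\<close> for \<open>exp w\<close> already suffices.\<close>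

lemma exp_le_quadratic:
  fixes z :: real
  assumes "\<bar>z\<bar> \<le> 1"
  shows "exp z \<le> 1 + z + z\<^sup>2"
proof (cases "0 \<le> z")
  case True
  then show ?thesis using exp_bound assms by simp
next
  case False
  define w where "w = - z"
  have w: "0 \<le> w" "w \<le> 1" using False assms by (auto simp: w_def)
  have e: "1 + w + w\<^sup>2 / 2 \<le> exp w" using exp_lower_Taylor_quadratic w by simp
  have p: "0 \<le> 1 - w + w\<^sup>2" using w by simp
  have "0 \<le> w\<^sup>2 / 2 + w ^ 3 / 2 + w ^ 4 / 2" using w by simp
  also have "\<dots> = (1 - w + w\<^sup>2) * (1 + w + w\<^sup>2 / 2) - 1"
    by (simp add: field_simps power2_eq_square power3_eq_cube power4_eq_xxxx)
  finally have "1 \<le> (1 - w + w\<^sup>2) * (1 + w + w\<^sup>2 / 2)" by simp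
  also have "\<dots> \<le> (1 - w + w\<^sup>2) * exp w" using e p by (intro mult_left_mono)
  finally have "exp (- w) \<le> 1 - w + w\<^sup>2"
    by (simp add: exp_minus field_simps)
  then show ?thesis by (simp add: w_def)
qed

context hmm
begin

lemma integrable_bounded_local: "bounded_local n h \<Longrightarrow> integrable (obs \<nu>) h"
  by (rule bounded_local_integrable[OF _ prob_space_obs sets_obs])

lemma integral_obs_from_drop:
  assumes h: "bounded_local n h"
  shows "(\<integral>y. h (drop_seq 1 y) \<partial>obs_from x) = (\<Sum>b\<in>UNIV. A $ x $ b * (\<integral>y. h y \<partial>obs_from b))"
proof -
  obtain B where B: "\<And>y. \<bar>h y\<bar> \<le> B" using bounded_local_bound[OF h] by blast
  note hm = bounded_localD(1)[OF h]
  note [measurable] = hm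
  \<comment> \<open>Adding the bound \<open>B\<close> makes the function nonnegative, so the
    identity for \<open>nn_integral\<close> applies; \<open>B\<close> cancels at the end because the
    rows of \<open>A\<close> sum to one.\<close>
  have hB: "bounded_local n (\<lambda>y. h y + B)" by (intro bounded_local_add h bounded_local_const)
  have hB1: "bounded_local (1 + n) (\<lambda>y. h (drop_seq 1 y) + B)"
    using bounded_local_drop_seq[OF hB, of 1] .
  have nn: "0 \<le> h y + B" for y using B[of y] by linarith
  have int: "(\<integral>y. h y + B \<partial>obs_from b) = (\<integral>y. h y \<partial>obs_from b) + B" for b
    using prob_space.prob_space[OF prob_space_obs, of "return_pmf b"]
    by (simp add: integrable_bounded_local[OF h] prob_space.finite_measure[OF prob_space_obs] finite_measure.integrable_const)
  have int1: "(\<integral>y. h (drop_seq 1 y) + B \<partial>obs_from x) = (\<integral>y. h (drop_seq 1 y) \<partial>obs_from x) + B"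
    using prob_space.prob_space[OF prob_space_obs, of "return_pmf x"]
    by (simp add: integrable_bounded_local[OF bounded_local_drop_seq[OF h]] prob_space.finite_measure[OF prob_space_obs] finite_measure.integrable_const)
  have nnb: "0 \<le> (\<integral>y. h y + B \<partial>obs_from b)" for b
    using nn by simp
  have "ennreal (\<integral>y. h (drop_seq 1 y) + B \<partial>obs_from x) = (\<integral>\<^sup>+y. ennreal (h (drop_seq 1 y) + B) \<partial>obs_from x)"
    using nn by (intro nn_integral_eq_integral[symmetric] integrable_bounded_local[OF hB1]) auto
  also have "\<dots> = (\<Sum>b\<in>UNIV. ennreal (A $ x $ b) * (\<integral>\<^sup>+y. ennreal (h y + B) \<partial>obs_from b))"
    by (rule nn_integral_obs_from_drop) simp
  also have "\<dots> = (\<Sum>b\<in>UNIV. ennreal (A $ x $ b) * ennreal (\<integral>y. h y + B \<partial>obs_from b))"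
    using nn by (subst nn_integral_eq_integral[OF integrable_bounded_local[OF hB]]) auto
  also have "\<dots> = ennreal (\<Sum>b\<in>UNIV. A $ x $ b * (\<integral>y. h y + B \<partial>obs_from b))"
    by (simp add: A_nonneg nnb ennreal_mult sum_ennreal[symmetric] del: sum_ennreal)
  finally have "(\<integral>y. h (drop_seq 1 y) + B \<partial>obs_from x) = (\<Sum>b\<in>UNIV. A $ x $ b * (\<integral>y. h y + B \<partial>obs_from b))"
    using nn nnb by (subst (asm) ennreal_inj) (auto intro!: sum_nonneg mult_nonneg_nonneg A_nonneg)
  then show ?thesis
    unfolding int int1 by (simp add: distrib_left sum.distrib A_row_sum flip: sum_distrib_right)
qed

text \<open>
  The vectors \<open>E\<^sub>x h - P h + (A v - v)\<^sub>x\<close> form a subspace. By Gordan's alternative either some of them is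
  negative in every coordinate, or a probability vector annihilates all of them; the latter is then
  an invariant distribution whose observation law is \<open>P\<close>.
\<close>

lemma separating_local_function:
  assumes P: "prob_space P" and sets_P: "sets P = sets seqs"
    and diff: "\<And>p. invariant_distribution A p \<Longrightarrow> obs p \<noteq> P"
  shows "\<exists>n h v. bounded_local n h \<and>
    (\<forall>x. (\<integral>y. h y \<partial>obs_from x) - (\<integral>y. h y \<partial>P) + (A *v v - v) $ x < 0)"
proof (rule ccontr)
  assume none: "\<not> ?thesis"
  interpret P: prob_space P by (rule P)
  define e where "e h = (\<chi> x. (\<integral>y. h y \<partial>obs_from x) - (\<integral>y. h y \<partial>P))" for h :: "(nat \<Rightarrow> 'y) \<Rightarrow> real"
  define S where "S = {u. \<exists>n h v. bounded_local n h \<and> u = e h + (A *v v - v)}"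
  have e_add: "e (\<lambda>y. f y + g y) = e f + e g" if "bounded_local m f" "bounded_local n g" for m n f g
    using that
    by (simp add: e_def vec_eq_iff integrable_bounded_local[OF that(1)] integrable_bounded_local[OF that(2)]
        bounded_local_integrable[OF that(1) P sets_P] bounded_local_integrable[OF that(2) P sets_P])
  have e_scale: "e (\<lambda>y. c * f y) = c *\<^sub>R e f" for c f
    by (simp add: e_def vec_eq_iff algebra_simps)
  have e_0: "e (\<lambda>_. 0) = 0" by (simp add: e_def vec_eq_iff)
  have "subspace S"
  proof (rule subspaceI)
    have "0 = e (\<lambda>_. 0) + (A *v 0 - 0)" by (simp add: e_0)
    then show "0 \<in> S" unfolding S_def using bounded_local_const[of 0 0] by blast
  next
    fix u w assume "u \<in> S" "w \<in> S"
    then obtain m f v n g v' where f: "bounded_local m f" "u = e f + (A *v v - v)"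
      and g: "bounded_local n g" "w = e g + (A *v v' - v')"
      unfolding S_def by blast
    have "u + w = e (\<lambda>y. f y + g y) + (A *v (v + v') - (v + v'))"
      by (simp add: f(2) g(2) e_add[OF f(1) g(1)] matrix_vector_right_distrib)
    moreover have "bounded_local (max m n) (\<lambda>y. f y + g y)"
      by (intro bounded_local_add bounded_local_mono[OF f(1)] bounded_local_mono[OF g(1)]) auto
    ultimately show "u + w \<in> S" unfolding S_def by blast
  next
    fix c u assume "u \<in> S"
    then obtain m f v where f: "bounded_local m f" "u = e f + (A *v v - v)"
      unfolding S_def by blast
    have "c *\<^sub>R u = e (\<lambda>y. c * f y) + (A *v (c *\<^sub>R v) - (c *\<^sub>R v))"
      by (simp add: f(2) e_scale algebra_simps matrix_vector_mult_scaleR)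
    then show "c *\<^sub>R u \<in> S" unfolding S_def using bounded_local_cmult[OF f(1)] by blast
  qed
  moreover have "\<not> (\<exists>u\<in>S. \<forall>i. u $ i < 0)"
  proof
    assume "\<exists>u\<in>S. \<forall>i. u $ i < 0"
    then obtain n h v where "bounded_local n h" "\<forall>i. (e h + (A *v v - v)) $ i < 0"
      unfolding S_def by blast
    with none show False by (auto simp: e_def)
  qed
  ultimately obtain \<pi> where \<pi>: "\<And>i. 0 \<le> \<pi> $ i" "(\<Sum>i\<in>UNIV. \<pi> $ i) = 1"
    and orth: "\<And>u. u \<in> S \<Longrightarrow> (\<Sum>i\<in>UNIV. \<pi> $ i * u $ i) = 0"
    using gordan_alternative[of S] by blast
  obtain p where p: "\<And>i. pmf p i = \<pi> $ i" using ex_pmf_of_vec[OF \<pi>] by blast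
  \<comment> \<open>Taking \<open>h = 0\<close> in \<open>S\<close> leaves exactly the vectors whose
    annihilation means invariance. Taking \<open>v = 0\<close> and cylinder indicators for
    \<open>h\<close> below identifies the observation law.\<close>
  have "A *v v - v \<in> S" for v
  proof -
    have "A *v v - v = e (\<lambda>_. 0) + (A *v v - v)" by (simp add: e_0)
    then show ?thesis unfolding S_def using bounded_local_const[of 0 0] by blast
  qed
  then have inv: "invariant_distribution A p"
    by (intro invariant_distribution_of_orthogonal) (simp only: p orth)
  have "obs p = P"
  proof (rule measure_eqI_seqs)
    fix n and B :: "nat \<Rightarrow> 'y set" assume B: "\<And>k. B k \<in> sets borel"
    let ?C = "{y. \<forall>k\<le>Suc n. y k \<in> B k}"
    note C = cylinder_sets[where B=B and n="Suc n", OF B]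
    have "depends_on_first (Suc (Suc n)) (indicator ?C :: _ \<Rightarrow> real)"
      by (rule depends_on_first_cylinder)
    moreover have "\<bar>indicator S y :: real\<bar> \<le> 1" for S and y :: "nat \<Rightarrow> 'y"
      by (simp add: indicator_def)
    ultimately have loc: "bounded_local (Suc (Suc n)) (indicator ?C)"
      unfolding bounded_local_def using borel_measurable_indicator[OF C] by blast
    have "e (indicator ?C) = e (indicator ?C) + (A *v 0 - 0)" by simp
    then have "e (indicator ?C) \<in> S" unfolding S_def using loc by blast
    then have "(\<Sum>x\<in>UNIV. \<pi> $ x * (measure (obs_from x) ?C - measure P ?C)) = 0"
      using orth[of "e (indicator ?C)"] C by (simp add: e_def sets_obs sets_P)
    then have eq: "(\<Sum>x\<in>UNIV. pmf p x * measure (obs_from x) ?C) = measure P ?C"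
      using \<pi>(2) by (simp add: p right_diff_distrib sum_subtractf flip: sum_distrib_right)
    have "emeasure (obs p) ?C = (\<Sum>x\<in>UNIV. ennreal (pmf p x) * emeasure (obs_from x) ?C)"
      by (rule emeasure_obs_cylinder_mix[OF B])
    also have "\<dots> = (\<Sum>x\<in>UNIV. ennreal (pmf p x) * ennreal (measure (obs_from x) ?C))"
      by (intro sum.cong refl arg_cong2[where f="(*)"] finite_measure.emeasure_eq_measure
          prob_space.finite_measure prob_space_obs)
    also have "\<dots> = ennreal (\<Sum>x\<in>UNIV. pmf p x * measure (obs_from x) ?C)"
      by (simp add: ennreal_mult sum_ennreal[symmetric] del: sum_ennreal)
    also have "\<dots> = emeasure P ?C"
      unfolding eq by (rule P.emeasure_eq_measure[symmetric])
    finally show "emeasure (obs p) ?C = emeasure P ?C" .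
  qed (simp_all add: sets_obs sets_P prob_space.finite_measure[OF prob_space_obs])
  with diff[OF inv] show False by simp
qed

text \<open>The term \<open>A *v v - v\<close> telescopes along sums of shifts of \<open>h\<close>:
  after \<open>J\<close> steps only a bounded remainder is left, while the gap has grown to
  \<open>\<delta> * real J\<close>. The gap becomes uniform in the initial state even for a
  reducible chain.\<close>

lemma uniform_gap:
  assumes P: "prob_space P" and sets_P: "sets P = sets seqs" and P_inv: "\<And>n. distr P P (drop_seq n) = P"
    and diff: "\<And>p. invariant_distribution A p \<Longrightarrow> obs p \<noteq> P"
  shows "\<exists>m f \<eta>. 0 < m \<and> 0 < \<eta> \<and> bounded_local m f \<and> (\<forall>x. (\<integral>y. f y \<partial>obs_from x) \<le> (\<integral>y. f y \<partial>P) - \<eta>)"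
proof -
  interpret P: prob_space P by (rule P)
  obtain n h v where h: "bounded_local n h"
    and neg: "\<And>x. (\<integral>y. h y \<partial>obs_from x) - (\<integral>y. h y \<partial>P) + (A *v v - v) $ x < 0"
    using separating_local_function[OF P sets_P diff] by blast
  define s where "s = (\<integral>y. h y \<partial>P)"
  define \<delta> where "\<delta> = Min (range (\<lambda>x. - ((\<integral>y. h y \<partial>obs_from x) - s + (A *v v - v) $ x)))"
  have \<delta>: "(\<integral>y. h y \<partial>obs_from x) - s + (A *v v - v) $ x \<le> - \<delta>" for x
  proof -
    have "\<delta> \<le> - ((\<integral>y. h y \<partial>obs_from x) - s + (A *v v - v) $ x)" by (simp add: \<delta>_def)
    then show ?thesis by simp
  qed
  have "\<delta> \<in> range (\<lambda>x. - ((\<integral>y. h y \<partial>obs_from x) - s + (A *v v - v) $ x))"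
    unfolding \<delta>_def by (rule Min_in) auto
  then obtain x0 where "\<delta> = - ((\<integral>y. h y \<partial>obs_from x0) - s + (A *v v - v) $ x0)" by blast
  then have \<delta>_pos: "0 < \<delta>" using neg[of x0] by (simp add: s_def)
  define B where "B = Max (range (\<lambda>x. \<bar>v $ x\<bar>))"
  have B: "\<bar>v $ x\<bar> \<le> B" for x by (simp add: B_def)
  define f where "f J = (\<lambda>y. \<Sum>i<J. h (drop_seq i y))" for J
  have f_loc: "bounded_local (J + n) (f J)" for J
    unfolding f_def
    by (intro bounded_local_sum bounded_local_mono[OF bounded_local_drop_seq[OF h]]) auto
  have bound: "(\<integral>y. f J y \<partial>obs_from x) - real J * s \<le> v $ x + B - \<delta> * real J" for J x
  proof (induction J arbitrary: x)
    case 0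
    show ?case using B[of x] by (simp add: f_def abs_le_iff)
  next
    case (Suc J)
    have f_Suc: "f (Suc J) = (\<lambda>y. h y + f J (drop_seq 1 y))"
      by (simp add: f_def fun_eq_iff sum.lessThan_Suc_shift del: sum.lessThan_Suc)
    have "(\<integral>y. f (Suc J) y \<partial>obs_from x) = (\<integral>y. h y \<partial>obs_from x) + (\<integral>y. f J (drop_seq 1 y) \<partial>obs_from x)"
      unfolding f_Suc
      by (intro Bochner_Integration.integral_add integrable_bounded_local[OF h]
          integrable_bounded_local[OF bounded_local_drop_seq[OF f_loc]])
    also have "(\<integral>y. f J (drop_seq 1 y) \<partial>obs_from x) = (\<Sum>b\<in>UNIV. A $ x $ b * (\<integral>y. f J y \<partial>obs_from b))"
      by (rule integral_obs_from_drop[OF f_loc])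
    also have "\<dots> \<le> (\<Sum>b\<in>UNIV. A $ x $ b * (v $ b + B - \<delta> * real J + real J * s))"
    proof (intro sum_mono mult_left_mono A_nonneg)
      fix b show "(\<integral>y. f J y \<partial>obs_from b) \<le> v $ b + B - \<delta> * real J + real J * s"
        using Suc[of b] by simp
    qed
    also have "\<dots> = (A *v v) $ x + B - \<delta> * real J + real J * s"
    proof -
      have "(\<Sum>b\<in>UNIV. A $ x $ b * (v $ b + B - \<delta> * real J + real J * s)) =
         (\<Sum>b\<in>UNIV. A $ x $ b * v $ b) + (\<Sum>b\<in>UNIV. A $ x $ b) * (B - \<delta> * real J + real J * s)"
        unfolding sum_distrib_right sum.distrib[symmetric]
        by (intro sum.cong refl) (simp add: algebra_simps)
      then show ?thesis by (simp add: A_row_sum matrix_vector_mult_def)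
    qed
    finally show ?case using \<delta>[of x] by (simp add: algebra_simps)
  qed
  \<comment> \<open>The remainder \<open>v $ x + B\<close> is at most \<open>2 * B\<close>; the
    extra 1 is the gap finally obtained.\<close>
  obtain J :: nat where J: "2 * B + 1 < \<delta> * real J"
    using \<delta>_pos reals_Archimedean3 by (metis mult.commute)
  have B0: "0 \<le> B" using B abs_ge_zero order_trans by blast
  have "0 < J" using J B0 by (cases J) auto
  moreover have "(\<integral>y. f J y \<partial>P) = real J * s"
  proof -
    have "(\<integral>y. h (drop_seq i y) \<partial>P) = s" for i
    proof -
      have "drop_seq i \<in> P \<rightarrow>\<^sub>M P" using measurable_drop_seq by (simp add: measurable_cong_sets[OF sets_P sets_P])
      then have "(\<integral>y. h y \<partial>distr P P (drop_seq i)) = (\<integral>y. h (drop_seq i y) \<partial>P)"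
        using bounded_localD(1)[OF h] by (intro integral_distr) (auto simp: measurable_cong_sets[OF sets_P refl])
      then show ?thesis by (simp add: P_inv s_def)
    qed
    moreover have "(\<integral>y. f J y \<partial>P) = (\<Sum>i<J. \<integral>y. h (drop_seq i y) \<partial>P)"
      unfolding f_def
      by (intro Bochner_Integration.integral_sum bounded_local_integrable[OF bounded_local_drop_seq[OF h] P sets_P])
    ultimately show ?thesis by simp
  qed
  then have "(\<integral>y. f J y \<partial>obs_from x) \<le> (\<integral>y. f J y \<partial>P) - 1" for x
  proof -
    have "(\<integral>y. f J y \<partial>obs_from x) - real J * s \<le> v $ x + B - \<delta> * real J" by (rule bound)
    then show ?thesis using \<open>(\<integral>y. f J y \<partial>P) = real J * s\<close> J B[of x] by (simp add: abs_le_iff)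
  qed
  ultimately show ?thesis using f_loc[of J]
    by (intro exI[of _ "J + n"] exI[of _ "f J"] exI[of _ 1]) auto
qed

text \<open>Centred at its mean under \<open>P\<close>, the function has mean at most
  \<open>- \<eta>\<close> from every state. For small \<open>t\<close> the exponential of its block
  sum then loses a factor \<open>\<rho> < 1\<close> per block, whatever state has been reached,
  whereas under \<open>P\<close> stationarity keeps the mean of the sum at zero. Enough blocks beat
  any \<open>\<epsilon>\<close>.\<close>

lemma exponential_separation:
  assumes P: "prob_space P" and sets_P: "sets P = sets seqs" and P_inv: "\<And>n. distr P P (drop_seq n) = P"
    and diff: "\<And>p. invariant_distribution A p \<Longrightarrow> obs p \<noteq> P"
    and \<epsilon>: "0 < (\<epsilon>::real)"
  shows "\<exists>N F. 0 < N \<and> bounded_local N F \<and> (\<integral>y. F y \<partial>P) = 0 \<and>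
    (\<forall>x. (\<integral>\<^sup>+y. ennreal (exp (F y)) \<partial>obs_from x) \<le> ennreal \<epsilon>)"
proof -
  interpret P: prob_space P by (rule P)
  obtain m f \<eta> where m: "0 < m" and \<eta>: "0 < \<eta>" and f: "bounded_local m f"
    and gap: "\<And>x. (\<integral>y. f y \<partial>obs_from x) \<le> (\<integral>y. f y \<partial>P) - \<eta>"
    using uniform_gap[OF P sets_P P_inv diff] by blast
  define s where "s = (\<integral>y. f y \<partial>P)"
  obtain B where B: "1 \<le> B" "\<And>y. \<bar>f y\<bar> \<le> B" using bounded_local_bound[OF f] by blast
  \<comment> \<open>The first bound gives \<open>\<bar>\<phi> y\<bar> \<le> 1\<close>, as the
    quadratic estimate for \<open>exp\<close> demands. The second makes the quadratic term at most
    half of the linear gain \<open>t * \<eta>\<close>; the other half is the gain in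
    \<open>\<rho>\<close>.\<close>
  define t where "t = min (1 / (2 * B)) (\<eta> / (8 * B\<^sup>2))"
  have t: "0 < t" "t * (2 * B) \<le> 1" "t * (8 * B\<^sup>2) \<le> \<eta>"
    using B(1) \<eta> by (auto simp: t_def min_mult_distrib_right field_simps min_def split: if_splits)
  have s_B: "\<bar>s\<bar> \<le> B"
  proof -
    have "\<bar>s\<bar> \<le> (\<integral>y. \<bar>f y\<bar> \<partial>P)" unfolding s_def by (rule integral_abs_bound)
    also have "\<dots> \<le> (\<integral>y. B \<partial>P)"
      using bounded_local_integrable[OF f P sets_P] B(2) by (intro integral_mono) auto
    finally show ?thesis by (simp add: P.prob_space)
  qed
  define \<phi> where "\<phi> y = t * (f y + - s)" for y
  have \<phi>: "bounded_local m \<phi>"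
    unfolding \<phi>_def by (intro bounded_local_cmult bounded_local_add f bounded_local_const)
  note [measurable] = bounded_localD(1)[OF \<phi>]
  have \<phi>_le: "\<bar>\<phi> y\<bar> \<le> t * (2 * B)" for y
  proof -
    have "\<bar>f y + - s\<bar> \<le> 2 * B" using B(2)[of y] s_B by linarith
    then show ?thesis using t(1) by (simp add: \<phi>_def abs_mult)
  qed
  define \<rho> where "\<rho> = 1 - t * \<eta> / 2"
  have one_block: "(\<integral>\<^sup>+y. ennreal (exp (\<phi> y)) \<partial>obs_from x) \<le> ennreal \<rho>" for x
  proof -
    interpret R: prob_space "obs_from x" by (rule prob_space_obs)
    have le: "exp (\<phi> y) \<le> 1 + \<phi> y + (t * (2 * B))\<^sup>2" for y
    proof -
      have "exp (\<phi> y) \<le> 1 + \<phi> y + (\<phi> y)\<^sup>2"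
        using \<phi>_le[of y] t(2) by (intro exp_le_quadratic) linarith
      also have "(\<phi> y)\<^sup>2 \<le> (t * (2 * B))\<^sup>2"
        using power_mono[OF \<phi>_le[of y] abs_ge_zero, of 2] by (simp only: power2_abs)
      finally show ?thesis by simp
    qed
    have int: "integrable (obs_from x) \<phi>" by (rule integrable_bounded_local[OF \<phi>])
    have "(\<integral>\<^sup>+y. ennreal (exp (\<phi> y)) \<partial>obs_from x) \<le> (\<integral>\<^sup>+y. ennreal (1 + \<phi> y + (t * (2 * B))\<^sup>2) \<partial>obs_from x)"
      using le by (intro nn_integral_mono ennreal_leI)
    also have "\<dots> = ennreal (\<integral>y. 1 + \<phi> y + (t * (2 * B))\<^sup>2 \<partial>obs_from x)"
      using order_trans[OF exp_ge_zero le] int by (intro nn_integral_eq_integral) auto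
    also have "(\<integral>y. 1 + \<phi> y + (t * (2 * B))\<^sup>2 \<partial>obs_from x) = 1 + t * ((\<integral>y. f y \<partial>obs_from x) - s) + (t * (2 * B))\<^sup>2"
      using int integrable_bounded_local[OF f]
    proof -
      have "(\<integral>y. \<phi> y \<partial>obs_from x) = t * ((\<integral>y. f y \<partial>obs_from x) - s)"
        using integrable_bounded_local[OF f] by (simp add: \<phi>_def R.prob_space[simplified])
      then show ?thesis using int by (simp add: R.prob_space[simplified])
    qed
    also have "\<dots> \<le> 1 + t * (- \<eta>) + (t * (2 * B))\<^sup>2"
      using gap[of x] t(1) by (intro add_mono mult_left_mono) (auto simp: s_def)
    also have "(t * (2 * B))\<^sup>2 = t * (t * (8 * B\<^sup>2)) / 2"
      by (simp add: power2_eq_square)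
    also have "1 + t * (- \<eta>) + t * (t * (8 * B\<^sup>2)) / 2 \<le> \<rho>"
    proof -
      have "t * (t * (8 * B\<^sup>2)) \<le> t * \<eta>" using t by (intro mult_left_mono) auto
      then show ?thesis unfolding \<rho>_def by linarith
    qed
    finally show ?thesis by (simp add: ennreal_leI)
  qed
  have \<rho>: "\<rho> < 1" using t(1) \<eta> by (simp add: \<rho>_def)
  \<comment> \<open>Both means lie in the interval from \<open>- B\<close> to \<open>B\<close>, so
    \<open>\<eta>\<close> is at most \<open>2 * B\<close>; \<open>undefined\<close> is just some
    state.\<close>
  have \<rho>0: "0 \<le> \<rho>"
  proof -
    have "t * \<eta> \<le> t * (2 * B)"
    proof (intro mult_left_mono)
      have "\<eta> \<le> s - (\<integral>y. f y \<partial>obs_from undefined)" using gap[of undefined] by (simp add: s_def)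
      moreover have "\<bar>\<integral>y. f y \<partial>obs_from undefined\<bar> \<le> B"
      proof -
        interpret R: prob_space "obs_from undefined" by (rule prob_space_obs)
        have "\<bar>\<integral>y. f y \<partial>obs_from undefined\<bar> \<le> (\<integral>y. \<bar>f y\<bar> \<partial>obs_from undefined)" by (rule integral_abs_bound)
        also have "\<dots> \<le> (\<integral>y. B \<partial>obs_from undefined)"
          using integrable_bounded_local[OF f] B(2) by (intro integral_mono) auto
        finally show ?thesis by (simp add: R.prob_space[simplified])
      qed
      ultimately show "\<eta> \<le> 2 * B" using s_B by linarith
    qed (use t in auto)
    then show ?thesis using t(2) by (simp add: \<rho>_def)
  qed
  define F where "F n = (\<lambda>y. \<Sum>k<n. \<phi> (drop_seq (k * m) y))" for n
  have F_loc: "bounded_local (n * m) (F n)" for n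
    unfolding F_def
  proof (intro bounded_local_sum bounded_local_mono[OF bounded_local_drop_seq[OF \<phi>]])
    fix k assume "k \<in> {..<n}"
    then have "Suc k * m \<le> n * m" by (intro mult_le_mono1) auto
    then show "k * m + m \<le> n * m" by simp
  qed
  have F_int: "(\<integral>y. F n y \<partial>P) = 0" for n
  proof -
    have "(\<integral>y. \<phi> (drop_seq i y) \<partial>P) = 0" for i
    proof -
      have "drop_seq i \<in> P \<rightarrow>\<^sub>M P" using measurable_drop_seq by (simp add: measurable_cong_sets[OF sets_P sets_P])
      then have "(\<integral>y. \<phi> y \<partial>distr P P (drop_seq i)) = (\<integral>y. \<phi> (drop_seq i y) \<partial>P)"
        by (intro integral_distr) (auto simp: measurable_cong_sets[OF sets_P refl])
      moreover have "(\<integral>y. \<phi> y \<partial>P) = 0"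
        using bounded_local_integrable[OF f P sets_P] by (simp add: \<phi>_def s_def P.prob_space)
      ultimately show ?thesis by (simp add: P_inv)
    qed
    moreover have "(\<integral>y. F n y \<partial>P) = (\<Sum>k<n. \<integral>y. \<phi> (drop_seq (k * m) y) \<partial>P)"
      unfolding F_def
      by (intro Bochner_Integration.integral_sum bounded_local_integrable[OF bounded_local_drop_seq[OF \<phi>] P sets_P])
    ultimately show ?thesis by simp
  qed
  have F_exp: "(\<integral>\<^sup>+y. ennreal (exp (F n y)) \<partial>obs_from x) \<le> ennreal (\<rho> ^ n)" for n x
  proof (induction n arbitrary: x)
    case 0
    show ?case using prob_space.emeasure_space_1[OF prob_space_obs, of "return_pmf x"] by (simp add: F_def)
  next
    case (Suc n)
    note [measurable] = bounded_localD(1)[OF F_loc[of n]]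
    have "(\<integral>\<^sup>+y. ennreal (exp (F (Suc n) y)) \<partial>obs_from x) =
        (\<integral>\<^sup>+y. ennreal (exp (\<phi> y)) * ennreal (exp (F n (drop_seq m y))) \<partial>obs_from x)"
    proof (intro nn_integral_cong)
      fix y
      have "F (Suc n) y = \<phi> y + F n (drop_seq m y)"
        unfolding F_def by (subst sum.lessThan_Suc_shift) simp
      then show "ennreal (exp (F (Suc n) y)) = ennreal (exp (\<phi> y)) * ennreal (exp (F n (drop_seq m y)))"
        by (simp add: exp_add ennreal_mult)
    qed
    also have "\<dots> \<le> (\<integral>\<^sup>+y. ennreal (exp (\<phi> y)) * ennreal (\<rho> ^ n) \<partial>obs_from x)"
    proof (rule nn_integral_obs_from_markov_mono[where F'="\<lambda>_. ennreal (\<rho> ^ n)" and F="\<lambda>y. ennreal (exp (F n y))"])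
      show "depends_on_first m (\<lambda>y. ennreal (exp (\<phi> y)))"
        by (rule depends_on_first_comp[OF bounded_localD(2)[OF \<phi>]])
      show "(\<integral>\<^sup>+y. ennreal (exp (F n y)) \<partial>obs_from b) \<le> (\<integral>\<^sup>+y. ennreal (\<rho> ^ n) \<partial>obs_from b)" for b
        using Suc[of b] prob_space.emeasure_space_1[OF prob_space_obs, of "return_pmf b"] by simp
    qed measurable
    also have "\<dots> = (\<integral>\<^sup>+y. ennreal (exp (\<phi> y)) \<partial>obs_from x) * ennreal (\<rho> ^ n)"
      by (rule nn_integral_multc) measurable
    also have "\<dots> \<le> ennreal \<rho> * ennreal (\<rho> ^ n)"
      by (intro mult_right_mono one_block) simp
    finally show ?case using \<rho>0 by (simp add: ennreal_mult)
  qed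
  obtain n where n: "\<rho> ^ n < \<epsilon>" using real_arch_pow_inv[OF \<epsilon> \<rho>] by blast
  \<comment> \<open>One block more than required, so that \<open>N\<close> is positive even if
    \<open>n = 0\<close>.\<close>
  have n': "\<rho> ^ Suc n \<le> \<epsilon>"
    using n \<rho>0 \<rho> by (simp add: order_trans[OF mult_left_le_one_le[of "\<rho> ^ n" \<rho>]] less_imp_le)
  show ?thesis
  proof (intro exI[of _ "Suc n * m"] exI[of _ "F (Suc n)"] conjI allI)
    show "(\<integral>\<^sup>+y. ennreal (exp (F (Suc n) y)) \<partial>obs_from x) \<le> ennreal \<epsilon>" for x
      by (rule order_trans[OF F_exp]) (rule ennreal_leI[OF n'])
  qed (use m F_loc[of "Suc n"] F_int in auto)
qed

end

section \<open>Comparison of likelihoods\<close>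

context hmm
begin

text \<open>The factor \<open>CARD('x)\<close> is the value of \<open>total_likelihood\<close> at
  zero observations, where the induction starts; it does not grow with \<open>k\<close>.\<close>

lemma total_likelihood_mult_le:
  "total_likelihood (k * m) y \<le> real CARD('x) * (\<Prod>i<k. total_likelihood m (drop_seq (i * m) y))"
proof (induction k)
  case 0
  show ?case by (simp add: total_likelihood_def)
next
  case (Suc k)
  have "total_likelihood (Suc k * m) y \<le> total_likelihood (k * m) y * total_likelihood m (drop_seq (k * m) y)"
    using total_likelihood_append[of "k * m" m y] by (simp add: add.commute)
  also have "\<dots> \<le> (real CARD('x) * (\<Prod>i<k. total_likelihood m (drop_seq (i * m) y))) * total_likelihood m (drop_seq (k * m) y)"
    by (intro mult_right_mono Suc total_likelihood_nonneg)
  finally show ?case by (simp add: mult.assoc)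
qed

lemma mix_likelihood_le_total: "mix_likelihood \<nu> n y \<le> total_likelihood n y"
  unfolding mix_likelihood_def total_likelihood_def
  by (intro sum_mono mult_left_le_one_le state_likelihood_nonneg pmf_le_1) auto

text \<open>A lower bound on the emission densities that is common to all states makes the hidden
  path irrelevant: the transition probabilities sum to one and drop out.\<close>

lemma state_likelihood_lower:
  assumes c: "\<And>i. i < n \<Longrightarrow> 0 \<le> c (drop_seq i y)" "\<And>i x. i < n \<Longrightarrow> c (drop_seq i y) \<le> G x (y i)"
  shows "(\<Prod>i<n. c (drop_seq i y)) \<le> state_likelihood A G n x y"
  using c
proof (induction n arbitrary: x y)
  case (Suc n)
  have IH: "(\<Prod>i<n. c (drop_seq i (drop_seq 1 y))) \<le> state_likelihood A G n b (drop_seq 1 y)" for b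
  proof (rule Suc.IH)
    fix i assume "i < n"
    then show "0 \<le> c (drop_seq i (drop_seq 1 y))" using Suc.prems(1)[of "Suc i"] by simp
  next
    fix i x assume "i < n"
    then show "c (drop_seq i (drop_seq 1 y)) \<le> G x (drop_seq 1 y i)"
      using Suc.prems(2)[of "Suc i" x] by (simp add: drop_seq_apply[of "Suc 0" y i])
  qed
  have nn: "0 \<le> (\<Prod>i<n. c (drop_seq i (drop_seq 1 y)))"
    using Suc.prems(1)[of "Suc _"] by (intro prod_nonneg) simp
  have "(\<Prod>i<Suc n. c (drop_seq i y)) = c y * (\<Prod>i<n. c (drop_seq i (drop_seq 1 y)))"
    by (subst prod.lessThan_Suc_shift) simp
  also have "\<dots> \<le> G x (y 0) * (\<Prod>i<n. c (drop_seq i (drop_seq 1 y)))"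
    using Suc.prems(2)[of 0 x] by (intro mult_right_mono nn) simp
  also have "(\<Prod>i<n. c (drop_seq i (drop_seq 1 y))) =
      (\<Sum>b\<in>UNIV. A $ x $ b * (\<Prod>i<n. c (drop_seq i (drop_seq 1 y))))"
    by (simp only: A_row_sum mult_1_left flip: sum_distrib_right)
  also have "G x (y 0) * \<dots> \<le> G x (y 0) * (\<Sum>b\<in>UNIV. A $ x $ b * state_likelihood A G n b (drop_seq 1 y))"
    by (intro mult_left_mono sum_mono IH A_nonneg G_nonneg)
  finally show ?case by simp
qed simp

lemma mix_likelihood_lower:
  assumes c: "\<And>i. i < n \<Longrightarrow> 0 \<le> c (drop_seq i y)" "\<And>i x. i < n \<Longrightarrow> c (drop_seq i y) \<le> G x (y i)"
  shows "(\<Prod>i<n. c (drop_seq i y)) \<le> mix_likelihood \<nu> n y"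
proof -
  have "(\<Prod>i<n. c (drop_seq i y)) = (\<Sum>x\<in>UNIV. pmf \<nu> x * (\<Prod>i<n. c (drop_seq i y)))"
    by (simp add: sum_pmf_eq_1 flip: sum_distrib_right)
  also have "\<dots> \<le> mix_likelihood \<nu> n y"
    unfolding mix_likelihood_def by (intro sum_mono mult_left_mono state_likelihood_lower c) auto
  finally show ?thesis .
qed

text \<open>Only an inequality, because \<open>q y / 0 = 0\<close> loses the mass of \<open>q\<close> where the likelihood vanishes.\<close>

lemma nn_integral_obs_quotient_le:
  assumes f: "f \<in> borel_measurable seqs" "depends_on_first n f"
    and q: "q \<in> borel_measurable seqs" "depends_on_first n q" and q_nonneg: "\<And>y. 0 \<le> q y"
  shows "(\<integral>\<^sup>+y. f y * ennreal (q y / mix_likelihood \<nu> n y) \<partial>obs \<nu>) \<le> iter_integral \<mu> n (\<lambda>y. f y * ennreal (q y))"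
proof -
  note [measurable] = f(1) q(1)
  have "(\<integral>\<^sup>+y. f y * ennreal (q y / mix_likelihood \<nu> n y) \<partial>obs \<nu>) =
      iter_integral \<mu> n (\<lambda>y. (f y * ennreal (q y / mix_likelihood \<nu> n y)) * ennreal (mix_likelihood \<nu> n y))"
    by (intro nn_integral_obs_eq_iter_integral depends_on_first_comp2[where F="(*)"]
        depends_on_first_comp2[where F="\<lambda>a b. ennreal (a / b)"] f q depends_on_first_mix_likelihood) measurable
  also have "\<dots> \<le> iter_integral \<mu> n (\<lambda>y. f y * ennreal (q y))"
  proof (rule iter_integral_mono)
    fix y
    have "ennreal (q y / mix_likelihood \<nu> n y) * ennreal (mix_likelihood \<nu> n y) \<le> ennreal (q y)"
      using mix_likelihood_nonneg[of \<nu> n y] q_nonneg[of y] by (simp flip: ennreal_mult add: ennreal_leI)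
    then show "(f y * ennreal (q y / mix_likelihood \<nu> n y)) * ennreal (mix_likelihood \<nu> n y) \<le> f y * ennreal (q y)"
      unfolding mult.assoc by (rule mult_left_mono) simp
  qed
  finally show ?thesis .
qed

lemma AE_mix_likelihood_pos: "AE y in obs \<nu>. \<forall>n. 0 < mix_likelihood \<nu> n y"
proof (subst AE_all_countable, intro allI)
  fix n
  have "(\<integral>\<^sup>+y. indicator {0} (mix_likelihood \<nu> n y) \<partial>obs \<nu>) =
      iter_integral \<mu> n (\<lambda>y. indicator {0} (mix_likelihood \<nu> n y) * ennreal (mix_likelihood \<nu> n y))"
    by (intro nn_integral_obs_eq_iter_integral depends_on_first_comp[OF depends_on_first_mix_likelihood]) measurable
  also have "(\<lambda>y. indicator {0} (mix_likelihood \<nu> n y) * ennreal (mix_likelihood \<nu> n y)) = (\<lambda>_. 0)"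
    by (simp add: fun_eq_iff indicator_def)
  finally have "(\<integral>\<^sup>+y. indicator {0} (mix_likelihood \<nu> n y) \<partial>obs \<nu>) = 0"
    by (simp add: iter_integral_zero)
  then have "AE y in obs \<nu>. (indicator {0} (mix_likelihood \<nu> n y) :: ennreal) = 0"
    by (subst (asm) nn_integral_0_iff_AE) auto
  then show "AE y in obs \<nu>. 0 < mix_likelihood \<nu> n y"
    by eventually_elim (use mix_likelihood_nonneg[of \<nu> n] in \<open>auto simp: indicator_def less_le split: if_splits\<close>)
qed

section \<open>Product densities over blocks\<close>

lemma iter_integral_prod:
  assumes f: "f \<in> borel_measurable seqs" "depends_on_first m f"
  shows "iter_integral \<mu> (k * m) (\<lambda>y. \<Prod>i<k. f (drop_seq (i * m) y)) = iter_integral \<mu> m f ^ k"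
proof (induction k)
  case (Suc k)
  note [measurable] = f(1)
  have eq: "(\<lambda>y. \<Prod>i<Suc k. f (drop_seq (i * m) y)) = (\<lambda>y. f y * (\<Prod>i<k. f (drop_seq (i * m) (drop_seq m y))))"
    by (subst prod.lessThan_Suc_shift) simp
  have "iter_integral \<mu> (m + k * m) (\<lambda>y. f y * (\<Prod>i<k. f (drop_seq (i * m) (drop_seq m y)))) =
     iter_integral \<mu> m f * iter_integral \<mu> (k * m) (\<lambda>y. \<Prod>i<k. f (drop_seq (i * m) y))"
    by (rule iter_integral_append[OF f, where g="\<lambda>y. \<Prod>i<k. f (drop_seq (i * m) y)"]) measurable
  then show ?case unfolding eq by (simp add: Suc)
qed simp

text \<open>
  The observations are cut into \<open>j\<close> single ones, \<open>k\<close> blocks of length \<open>N\<close> and \<open>r\<close> single ones; the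
  pieces are independent under this density and have the stationary marginal laws.
\<close>

definition block_density :: "'x pmf \<Rightarrow> nat \<Rightarrow> nat \<Rightarrow> nat \<Rightarrow> nat \<Rightarrow> (nat \<Rightarrow> 'y) \<Rightarrow> real" where
  "block_density \<nu> N j k r y =
     (\<Prod>i<j. mix_likelihood \<nu> 1 (drop_seq i y)) *
     ((\<Prod>i<k. mix_likelihood \<nu> N (drop_seq (j + i * N) y)) *
      (\<Prod>i<r. mix_likelihood \<nu> 1 (drop_seq (j + k * N + i) y)))"

lemma depends_on_first_prod_drop_seq:
  assumes "depends_on_first m f"
  shows "depends_on_first (k * m) (\<lambda>y. \<Prod>i<k. f (drop_seq (i * m) y))"
proof (rule depends_on_first_prod)
  fix i assume "i \<in> {..<k}"
  then have "Suc i * m \<le> k * m" by (intro mult_le_mono1) auto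
  then show "depends_on_first (k * m) (\<lambda>y. f (drop_seq (i * m) y))"
    by (intro depends_on_first_mono[OF depends_on_first_drop_seq[OF assms]]) simp
qed

text \<open>The nested shape to which \<open>iter_integral_append\<close> and
  \<open>iter_integral_prod\<close> apply; single observations count as blocks of length one, hence
  the \<open>i * 1\<close>.\<close>

lemma block_density_eq:
  "block_density \<nu> N j k r y =
     (\<Prod>i<j. mix_likelihood \<nu> 1 (drop_seq (i * 1) y)) *
     ((\<lambda>z. (\<Prod>i<k. mix_likelihood \<nu> N (drop_seq (i * N) z)) *
       (\<lambda>w. \<Prod>i<r. mix_likelihood \<nu> 1 (drop_seq (i * 1) w)) (drop_seq (k * N) z)) (drop_seq (j * 1) y))"
  by (simp add: block_density_def)

lemma measurable_block_density [measurable]: "block_density \<nu> N j k r \<in> borel_measurable seqs"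
  unfolding block_density_def[abs_def] by measurable

lemma depends_on_first_block_density: "depends_on_first (j + k * N + r) (block_density \<nu> N j k r)"
proof -
  have "depends_on_first (j * 1 + (k * N + r * 1)) (block_density \<nu> N j k r)"
    unfolding block_density_eq[abs_def]
    by (intro depends_on_first_comp2[where F="(*)"] depends_on_first_drop_seq)
       (rule depends_on_first_mono[OF depends_on_first_prod_drop_seq[OF depends_on_first_mix_likelihood]]
          depends_on_first_comp2[where F="(*)"] depends_on_first_drop_seq
          depends_on_first_prod_drop_seq[OF depends_on_first_mix_likelihood]; simp)+
  then show ?thesis by (simp add: add.assoc)
qed

lemma block_density_nonneg: "0 \<le> block_density \<nu> N j k r y"
  unfolding block_density_def by (intro mult_nonneg_nonneg prod_nonneg mix_likelihood_nonneg)

lemma iter_integral_block_density: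
  "iter_integral \<mu> (j + k * N + r) (\<lambda>y. ennreal (block_density \<nu> N j k r y)) = 1"
proof -
  let ?f = "\<lambda>m y. ennreal (mix_likelihood \<nu> m y)"
  have d: "depends_on_first m (?f m)" for m
    by (rule depends_on_first_comp[OF depends_on_first_mix_likelihood])
  have eq: "(\<lambda>y. ennreal (block_density \<nu> N j k r y)) =
    (\<lambda>y. (\<Prod>i<j. ?f 1 (drop_seq (i * 1) y)) *
     ((\<lambda>z. (\<Prod>i<k. ?f N (drop_seq (i * N) z)) *
       (\<lambda>w. \<Prod>i<r. ?f 1 (drop_seq (i * 1) w)) (drop_seq (k * N) z)) (drop_seq (j * 1) y)))"
    unfolding block_density_eq
    by (simp add: ennreal_mult prod_ennreal mix_likelihood_nonneg prod_nonneg)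
  have "iter_integral \<mu> (j * 1 + (k * N + r * 1)) (\<lambda>y. ennreal (block_density \<nu> N j k r y)) =
     iter_integral \<mu> (j * 1) (\<lambda>y. \<Prod>i<j. ?f 1 (drop_seq (i * 1) y)) *
     iter_integral \<mu> (k * N + r * 1) (\<lambda>z. (\<Prod>i<k. ?f N (drop_seq (i * N) z)) *
       (\<lambda>w. \<Prod>i<r. ?f 1 (drop_seq (i * 1) w)) (drop_seq (k * N) z))"
    unfolding eq
    by (rule iter_integral_append[OF _ depends_on_first_prod_drop_seq[OF d]]) measurable
  also have "iter_integral \<mu> (k * N + r * 1) (\<lambda>z. (\<Prod>i<k. ?f N (drop_seq (i * N) z)) *
       (\<lambda>w. \<Prod>i<r. ?f 1 (drop_seq (i * 1) w)) (drop_seq (k * N) z)) =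
     iter_integral \<mu> (k * N) (\<lambda>z. \<Prod>i<k. ?f N (drop_seq (i * N) z)) *
     iter_integral \<mu> (r * 1) (\<lambda>w. \<Prod>i<r. ?f 1 (drop_seq (i * 1) w))"
    by (rule iter_integral_append[OF _ depends_on_first_prod_drop_seq[OF d]]) measurable
  also have "iter_integral \<mu> (k * N) (\<lambda>z. \<Prod>i<k. ?f N (drop_seq (i * N) z)) = 1"
    by (subst iter_integral_prod[OF _ d]) (measurable, simp add: iter_integral_mix_likelihood del: One_nat_def iter_integral.simps)
  also have "iter_integral \<mu> (r * 1) (\<lambda>z. \<Prod>i<r. ?f 1 (drop_seq (i * 1) z)) = 1"
    by (subst iter_integral_prod[OF _ d]) (measurable, simp add: iter_integral_mix_likelihood del: One_nat_def iter_integral.simps)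
  also have "iter_integral \<mu> (j * 1) (\<lambda>z. \<Prod>i<j. ?f 1 (drop_seq (i * 1) z)) = 1"
    by (subst iter_integral_prod[OF _ d]) (measurable, simp add: iter_integral_mix_likelihood del: One_nat_def iter_integral.simps)
  finally show ?thesis by (simp add: add.assoc)
qed

text \<open>Weighted by \<open>1 / (real k + 1)\<^sup>2\<close>, the density quotients have summable
  means, so their sum over \<open>k\<close> is finite almost surely; that sum serves as
  \<open>C\<close>. The bound holds for all \<open>j\<close> and \<open>r\<close> at once because
  the phase is chosen later along the path.\<close>

lemma AE_block_density_le:
  "AE y in obs \<nu>. \<forall>j r. \<exists>C\<ge>0. \<forall>k. block_density \<nu> N j k r y \<le> C * (real k + 1)\<^sup>2 * mix_likelihood \<nu> (j + k * N + r) y"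
proof -
  have "AE y in obs \<nu>. \<exists>C\<ge>0. \<forall>k. block_density \<nu> N j k r y \<le> C * (real k + 1)\<^sup>2 * mix_likelihood \<nu> (j + k * N + r) y" for j r
  proof -
    define h where "h k y = ennreal (1 / (real k + 1)\<^sup>2) *
        ennreal (block_density \<nu> N j k r y / mix_likelihood \<nu> (j + k * N + r) y)" for k y
    have [measurable]: "h k \<in> borel_measurable seqs" for k unfolding h_def by measurable
    have h_int: "(\<integral>\<^sup>+y. h k y \<partial>obs \<nu>) \<le> ennreal (1 / (real k + 1)\<^sup>2)" for k
    proof -
      have "(\<integral>\<^sup>+y. h k y \<partial>obs \<nu>) \<le> iter_integral \<mu> (j + k * N + r)
          (\<lambda>y. ennreal (1 / (real k + 1)\<^sup>2) * ennreal (block_density \<nu> N j k r y))"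
        unfolding h_def
        by (rule nn_integral_obs_quotient_le[OF _ depends_on_first_const _ depends_on_first_block_density block_density_nonneg]) auto
      also have "\<dots> = ennreal (1 / (real k + 1)\<^sup>2)"
        by (subst iter_integral_cmult) (auto simp: iter_integral_block_density)
      finally show ?thesis .
    qed
    have "summable (\<lambda>k. 1 / (real k + 1)\<^sup>2)"
      using inverse_power_summable[of 2, where 'a=real] summable_Suc_iff[of "\<lambda>k. inverse ((of_nat k :: real)\<^sup>2)"]
      by (simp add: field_simps)
    then have fin: "(\<Sum>k. ennreal (1 / (real k + 1)\<^sup>2)) < \<infinity>"
      by (subst suminf_ennreal2) auto
    have "(\<integral>\<^sup>+y. (\<Sum>k. h k y) \<partial>obs \<nu>) = (\<Sum>k. \<integral>\<^sup>+y. h k y \<partial>obs \<nu>)"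
      by (intro nn_integral_suminf) measurable
    also have "\<dots> \<le> (\<Sum>k. ennreal (1 / (real k + 1)\<^sup>2))"
      by (intro suminf_le h_int) auto
    finally have "(\<integral>\<^sup>+y. (\<Sum>k. h k y) \<partial>obs \<nu>) \<noteq> \<infinity>" using fin by (auto simp: top_unique)
    then have "AE y in obs \<nu>. (\<Sum>k. h k y) \<noteq> \<infinity>"
      by (intro nn_integral_noteq_infinite) measurable
    then show ?thesis
      using AE_mix_likelihood_pos[of \<nu>]
    proof eventually_elim
      case (elim y)
      obtain C where C: "0 \<le> C" "(\<Sum>k. h k y) = ennreal C"
        using elim(1) by (cases "\<Sum>k. h k y") auto
      have "block_density \<nu> N j k r y \<le> C * (real k + 1)\<^sup>2 * mix_likelihood \<nu> (j + k * N + r) y" for k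
      proof -
        have pos: "0 < mix_likelihood \<nu> (j + k * N + r) y" "0 < (real k + 1)\<^sup>2"
          using elim(2) by (simp_all add: add_nonneg_pos)
        have "h k y = (\<Sum>k\<in>{k}. h k y)" by simp
        also have "\<dots> \<le> (\<Sum>k. h k y)" by (intro sum_le_suminf) auto
        finally have "h k y \<le> ennreal C" using C(2) by simp
        then have "ennreal (1 / (real k + 1)\<^sup>2 * (block_density \<nu> N j k r y / mix_likelihood \<nu> (j + k * N + r) y)) \<le> ennreal C"
          unfolding h_def using pos block_density_nonneg by (subst ennreal_mult) auto
        then have "1 / (real k + 1)\<^sup>2 * (block_density \<nu> N j k r y / mix_likelihood \<nu> (j + k * N + r) y) \<le> C"
          using C(1) by (simp only: ennreal_le_iff)
        then show ?thesis using pos by (simp add: field_simps)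
      qed
      with C(1) show ?case by blast
    qed
  qed
  then show ?thesis by (simp add: AE_all_countable)
qed

end

text \<open>The tilt \<open>exp F\<close> is small in mean under \<theta> from every state, while
  \<open>F\<close> has mean zero under the truth, so adding it to the logarithm leaves the
  expectation unchanged. Integrability is a premise of the inner implication because it comes later,
  from domination. The constant \<open>c\<close> bounds the logarithm from below and keeps
  \<open>ln 0 = 0\<close> from hiding a vanishing ratio.\<close>

lemma kl_gap:
  fixes \<mu> :: "'y::polish_space measure" and A A0 :: "real^'x::finite^'x"
  assumes H: "hmm \<mu> A G" and H0: "hmm \<mu> A0 G0" and inv: "invariant_distribution A0 \<pi>"
    and diff: "\<And>p. invariant_distribution A p \<Longrightarrow> observation_law \<mu> p A G \<noteq> observation_law \<mu> \<pi> A0 G0"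
  shows "\<exists>N c. 0 < N \<and> 0 < c \<and>
    (integrable (observation_law \<mu> \<pi> A0 G0)
       (\<lambda>y. ln (hmm.total_likelihood A G N y / hmm.mix_likelihood A0 G0 \<pi> N y + c)) \<longrightarrow>
     (\<integral>y. ln (hmm.total_likelihood A G N y / hmm.mix_likelihood A0 G0 \<pi> N y + c) \<partial>observation_law \<mu> \<pi> A0 G0) < 0)"
proof -
  interpret H: hmm \<mu> A G by fact
  interpret H0: hmm \<mu> A0 G0 by fact
  let ?P = "H0.obs \<pi>"
  interpret P: prob_space ?P by (rule H0.prob_space_obs)
  define d where "d = real CARD('x)"
  have d: "0 < d" by (simp add: d_def)
  obtain N F where N: "0 < N" and F: "bounded_local N F" and F0: "(\<integral>y. F y \<partial>?P) = 0"
    and F_exp: "\<And>x. (\<integral>\<^sup>+y. ennreal (exp (F y)) \<partial>H.obs_from x) \<le> ennreal (1 / (4 * d))"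
    using H.exponential_separation[OF H0.prob_space_obs H0.sets_obs H0.obs_invariant[OF inv] diff, of "1 / (4 * d)"] d
    by auto
  obtain B where B: "\<And>y. \<bar>F y\<bar> \<le> B" using bounded_local_bound[OF F] by blast
  note [measurable] = bounded_localD(1)[OF F]
  \<comment> \<open>With this value \<open>exp (F y) * c\<close> is at most 1/4. The bound
    \<open>1 / (4 * d)\<close> contributes another 1/4, because there are \<open>d\<close> initial
    states to sum over. Hence \<open>X\<close> below has mean at most 1/2, and the logarithm has
    mean at most -1/2.\<close>
  define c where "c = exp (- B) / 4"
  have c: "0 < c" by (simp add: c_def)
  define l where "l y = H.total_likelihood N y / H0.mix_likelihood \<pi> N y" for y
  have l: "0 \<le> l y" for y by (simp add: l_def H.total_likelihood_nonneg H0.mix_likelihood_nonneg)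
  have [measurable]: "l \<in> borel_measurable seqs" unfolding l_def by measurable
  have "(\<integral>y. ln (l y + c) \<partial>?P) < 0" if int: "integrable ?P (\<lambda>y. ln (l y + c))"
  proof -
    have "(\<integral>\<^sup>+y. ennreal (exp (F y)) * ennreal (l y) \<partial>?P) \<le>
        iter_integral \<mu> N (\<lambda>y. ennreal (exp (F y)) * ennreal (H.total_likelihood N y))"
      unfolding l_def
      by (rule H0.nn_integral_obs_quotient_le)
         (auto intro: depends_on_first_comp[OF bounded_localD(2)[OF F]] H.depends_on_first_total_likelihood
           H.total_likelihood_nonneg)
    also have "\<dots> = (\<Sum>x\<in>UNIV. \<integral>\<^sup>+y. ennreal (exp (F y)) \<partial>H.obs_from x)"
      by (rule H.nn_integral_total_likelihood) (auto intro: depends_on_first_comp[OF bounded_localD(2)[OF F]])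
    also have "\<dots> \<le> (\<Sum>x\<in>(UNIV::'x set). ennreal (1 / (4 * d)))"
      by (intro sum_mono F_exp)
    also have "\<dots> = ennreal (1 / 4)"
      using d by (simp add: d_def flip: ennreal_of_nat_eq_real_of_nat) (simp add: ennreal_of_nat_eq_real_of_nat flip: ennreal_mult)
    finally have le1: "(\<integral>\<^sup>+y. ennreal (exp (F y)) * ennreal (l y) \<partial>?P) \<le> ennreal (1 / 4)" .
    have le2: "exp (F y) * c \<le> 1 / 4" for y
    proof -
      have "exp (F y) * c \<le> exp B * c"
        using B[of y] c by (intro mult_right_mono) (auto simp: abs_le_iff)
      then show ?thesis by (simp add: c_def exp_minus)
    qed
    define X where "X y = exp (F y) * (l y + c)" for y
    have X: "0 < X y" for y using l[of y] c by (simp add: X_def add_nonneg_pos)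
    have [measurable]: "X \<in> borel_measurable seqs" unfolding X_def by measurable
    have "(\<integral>\<^sup>+y. ennreal (X y) \<partial>?P) \<le> (\<integral>\<^sup>+y. ennreal (exp (F y)) * ennreal (l y) + ennreal (1 / 4) \<partial>?P)"
    proof (intro nn_integral_mono)
      fix y
      have "X y \<le> exp (F y) * l y + 1 / 4" using le2[of y] by (simp add: X_def distrib_left)
      then have "ennreal (X y) \<le> ennreal (exp (F y) * l y + 1 / 4)" by (rule ennreal_leI)
      then show "ennreal (X y) \<le> ennreal (exp (F y)) * ennreal (l y) + ennreal (1 / 4)"
        using l[of y] by (simp add: ennreal_mult)
    qed
    also have "\<dots> = (\<integral>\<^sup>+y. ennreal (exp (F y)) * ennreal (l y) \<partial>?P) + ennreal (1 / 4)"
      using P.emeasure_space_1 by (subst nn_integral_add) auto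
    also have "\<dots> \<le> ennreal (1 / 4) + ennreal (1 / 4)" by (intro add_right_mono le1)
    also have "\<dots> = ennreal (1 / 2)" by (subst ennreal_plus[symmetric]) auto
    finally have X_le: "(\<integral>\<^sup>+y. ennreal (X y) \<partial>?P) \<le> ennreal (1 / 2)" .
    have X_int: "integrable ?P X"
    proof (rule integrableI_nonneg)
      show "(\<integral>\<^sup>+y. ennreal (X y) \<partial>?P) < \<infinity>" by (rule le_less_trans[OF X_le]) (simp only: infinity_ennreal_def ennreal_less_top)
    qed (use X in \<open>auto intro: less_imp_le\<close>)
    have F_int: "integrable ?P F" by (rule H0.integrable_bounded_local[OF F])
    have "(\<integral>y. ln (l y + c) \<partial>?P) = (\<integral>y. ln (l y + c) + F y \<partial>?P)"
      using int F_int F0 by simp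
    also have "\<dots> \<le> (\<integral>y. X y - 1 \<partial>?P)"
    proof (intro integral_mono Bochner_Integration.integrable_add Bochner_Integration.integrable_diff int F_int X_int)
      fix y
      have "ln (l y + c) + F y = ln (X y)"
        using l[of y] c by (simp add: X_def ln_mult add_nonneg_pos)
      then show "ln (l y + c) + F y \<le> X y - 1"
        using ln_le_minus_one[OF X[of y]] by simp
    qed simp
    also have "\<dots> = (\<integral>y. X y \<partial>?P) - 1" using X_int by (simp add: P.prob_space[simplified])
    also have "(\<integral>y. X y \<partial>?P) \<le> 1 / 2" using X_le by (intro integral_real_bounded) auto
    finally show ?thesis by simp
  qed
  then show ?thesis using N c unfolding l_def by blast
qed

section \<open>Compact families of hidden Markov models\<close>

lemma e2ennreal_abs_elog: "e2ennreal \<bar>elog t\<bar> = (if 0 < t then ennreal \<bar>ln t\<bar> else \<top>)"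
  by (simp add: elog_def)

lemma e2ennreal_pos_elog: "e2ennreal (max 0 (elog t)) = (if 0 < t then ennreal (max 0 (ln t)) else 0)"
proof -
  have "max 0 (ereal a) = ereal (max 0 a)" for a by (simp add: max_def)
  then show ?thesis by (simp add: elog_def max_def e2ennreal_neg)
qed

text \<open>The countable dense set \<open>D\<close> makes suprema over balls measurable;
  \<open>lam_le_on_open\<close> returns from \<open>D\<close> to all parameters by continuity. The
  integrability conditions are transported to the observation law, which is all that the estimates
  see.\<close>

locale hmm_family =
  fixes \<mu> :: "'y::polish_space measure"
    and Q :: "'p::metric_space \<Rightarrow> real^'x::finite^'x"
    and g :: "'p \<Rightarrow> 'x \<Rightarrow> 'y \<Rightarrow> real"
    and \<theta>\<^sub>0 :: 'p and D :: "'p set"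
  assumes compact_UNIV: "compact (UNIV :: 'p set)"
    and sets_\<mu>: "sets \<mu> = sets borel"
    and sigma_finite_\<mu>: "sigma_finite_measure \<mu>"
    and Q_stochastic: "\<And>\<theta>. stochastic_matrix (Q \<theta>)"
    and g_measurable: "\<And>\<theta> x. g \<theta> x \<in> borel_measurable borel"
    and g_nonneg: "\<And>\<theta> x y. 0 \<le> g \<theta> x y"
    and g_density: "\<And>\<theta> x. (\<integral>\<^sup>+ y. ennreal (g \<theta> x y) \<partial>\<mu>) = 1"
    and irr: "irreducible_matrix (Q \<theta>\<^sub>0)"
    and Q_cont: "continuous_on UNIV Q"
    and g_cont: "\<And>x y. continuous_on UNIV (\<lambda>\<theta>. g \<theta> x y)"
    and D_countable: "countable D"
    and D_dense: "\<And>U. open U \<Longrightarrow> U \<noteq> {} \<Longrightarrow> D \<inter> U \<noteq> {}"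
    and log_g_integrable: "\<And>x. (\<integral>\<^sup>+ y. e2ennreal \<bar>elog (g \<theta>\<^sub>0 x (y 0))\<bar>
          \<partial>observation_law \<mu> (stationary_distribution (Q \<theta>\<^sub>0)) (Q \<theta>\<^sub>0) (g \<theta>\<^sub>0)) < \<infinity>"
    and sup_log_g_integrable: "\<And>\<theta>. \<exists>U. open U \<and> \<theta> \<in> U \<and>
          (\<forall>x. (\<integral>\<^sup>+ y. (SUP \<theta>'\<in>D \<inter> U. e2ennreal (max 0 (elog (g \<theta>' x (y 0)))))
            \<partial>observation_law \<mu> (stationary_distribution (Q \<theta>\<^sub>0)) (Q \<theta>\<^sub>0) (g \<theta>\<^sub>0)) < \<infinity>)"
begin

sublocale H: hmm \<mu> "Q \<theta>" "g \<theta>" for \<theta>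
  by (intro hmm.intro sets_\<mu> sigma_finite_\<mu> Q_stochastic g_measurable g_nonneg g_density)

abbreviation \<pi> where "\<pi> \<equiv> stationary_distribution (Q \<theta>\<^sub>0)"
abbreviation P where "P \<equiv> observation_law \<mu> \<pi> (Q \<theta>\<^sub>0) (g \<theta>\<^sub>0)"
abbreviation lam where "lam \<theta> \<equiv> hmm.total_likelihood (Q \<theta>) (g \<theta>)"
abbreviation p where "p \<equiv> hmm.mix_likelihood (Q \<theta>\<^sub>0) (g \<theta>\<^sub>0) \<pi>"

sublocale P: prob_space P by (rule H.prob_space_obs)

lemmas sets_P [measurable_cong] = H.sets_obs[where \<nu>=\<pi> and \<theta>=\<theta>\<^sub>0]

lemma space_P [simp]: "space P = UNIV" by (rule H.space_obs)

lemma measurable_P_iff: "f \<in> measurable P M \<longleftrightarrow> f \<in> measurable seqs M"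
  by (simp add: measurable_cong_sets[OF sets_P refl])

lemma \<pi>_inv: "invariant_distribution (Q \<theta>\<^sub>0) \<pi>"
  by (rule invariant_stationary_distribution[OF Q_stochastic irr])

lemma distr_P: "distr P P (drop_seq i) = P"
  by (rule H.obs_invariant[OF \<pi>_inv])

lemma drop_seq_P: "drop_seq i \<in> P \<rightarrow>\<^sub>M P"
  using measurable_drop_seq by (simp add: measurable_cong_sets[OF sets_P sets_P])

lemma AE_drop_seq: "AE y in P. R y \<Longrightarrow> AE y in P. R (drop_seq i y)"
  by (rule AE_distrD[OF drop_seq_P]) (unfold distr_P)

lemma integrable_drop_seq: "integrable P f \<Longrightarrow> integrable P (\<lambda>y. f (drop_seq i y) :: real)"
  by (rule integrable_distr[OF drop_seq_P]) (unfold distr_P)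

lemma continuous_state_likelihood: "continuous_on UNIV (\<lambda>\<theta>. state_likelihood (Q \<theta>) (g \<theta>) n x y)"
proof (induction n arbitrary: x y)
  case (Suc n)
  have "continuous_on UNIV (\<lambda>\<theta>. Q \<theta> $ x $ b)" for b
    by (intro continuous_on_component Q_cont)
  with Suc show ?case
    by (simp add: continuous_on_mult continuous_on_sum g_cont)
qed simp

lemma continuous_lam: "continuous_on UNIV (\<lambda>\<theta>. lam \<theta> n y)"
  unfolding H.total_likelihood_def by (intro continuous_on_sum continuous_state_likelihood)

lemma bdd_above_lam: "bdd_above ((\<lambda>\<theta>. lam \<theta> n y) ` S)"
proof -
  have "compact (range (\<lambda>\<theta>. lam \<theta> n y))"
    by (rule compact_continuous_image[OF continuous_lam compact_UNIV])
  then have "bdd_above (range (\<lambda>\<theta>. lam \<theta> n y))"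
    by (intro bounded_imp_bdd_above compact_imp_bounded)
  then show ?thesis by (rule bdd_above_mono) auto
qed

definition sup_lam :: "'p set \<Rightarrow> nat \<Rightarrow> (nat \<Rightarrow> 'y) \<Rightarrow> real" where
  "sup_lam U n y = (SUP \<theta>\<in>D \<inter> U. lam \<theta> n y)"

lemma sup_lam_upper: "\<theta> \<in> D \<inter> U \<Longrightarrow> lam \<theta> n y \<le> sup_lam U n y"
  unfolding sup_lam_def by (intro cSUP_upper bdd_above_lam)

lemma sup_lam_least:
  "open U \<Longrightarrow> U \<noteq> {} \<Longrightarrow> (\<And>\<theta>. \<theta> \<in> D \<inter> U \<Longrightarrow> lam \<theta> n y \<le> c) \<Longrightarrow> sup_lam U n y \<le> c"
  unfolding sup_lam_def by (intro cSUP_least D_dense) auto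

lemma sup_lam_nonneg: "open U \<Longrightarrow> U \<noteq> {} \<Longrightarrow> 0 \<le> sup_lam U n y"
  using D_dense[of U] order_trans[OF H.total_likelihood_nonneg sup_lam_upper] by blast

lemma measurable_sup_lam [measurable]: "sup_lam U n \<in> borel_measurable seqs"
  unfolding sup_lam_def[abs_def]
  by (intro borel_measurable_cSUP countable_Int1 D_countable bdd_above_lam H.measurable_total_likelihood)

lemma sup_lam_mono: "open U \<Longrightarrow> U \<noteq> {} \<Longrightarrow> U \<subseteq> V \<Longrightarrow> sup_lam U n y \<le> sup_lam V n y"
  by (intro sup_lam_least sup_lam_upper) auto

lemma sup_lam_mult_le:
  assumes "open U" "U \<noteq> {}"
  shows "sup_lam U (k * m) y \<le> real CARD('x) * (\<Prod>i<k. sup_lam U m (drop_seq (i * m) y))"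
proof (intro sup_lam_least assms)
  fix \<theta> assume \<theta>: "\<theta> \<in> D \<inter> U"
  show "lam \<theta> (k * m) y \<le> real CARD('x) * (\<Prod>i<k. sup_lam U m (drop_seq (i * m) y))"
    by (rule order_trans[OF H.total_likelihood_mult_le])
       (intro mult_left_mono prod_mono conjI H.total_likelihood_nonneg sup_lam_upper[OF \<theta>]; simp)
qed

lemma sup_lam_ball_tendsto:
  assumes r: "0 < r"
  shows "(\<lambda>m. sup_lam (ball \<theta> (r / real (Suc m))) n y) \<longlonglongrightarrow> lam \<theta> n y"
proof (rule LIMSEQ_I)
  fix e :: real assume e: "0 < e"
  have "isCont (\<lambda>\<theta>. lam \<theta> n y) \<theta>"
    using continuous_lam by (simp add: continuous_on_eq_continuous_at)
  then obtain d where d: "0 < d" "\<And>\<theta>'. dist \<theta>' \<theta> < d \<Longrightarrow> dist (lam \<theta>' n y) (lam \<theta> n y) < e / 2"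
    using e unfolding continuous_at_eps_delta by (metis half_gt_zero)
  obtain m0 :: nat where m0: "r / d < real m0" using reals_Archimedean2 by blast
  have "norm (sup_lam (ball \<theta> (r / real (Suc m))) n y - lam \<theta> n y) < e" if "m0 \<le> m" for m
  proof -
    let ?B = "ball \<theta> (r / real (Suc m))"
    have "r / d < real (Suc m)" using m0 that by simp
    then have rd: "r / real (Suc m) < d" using d(1) by (simp add: field_simps)
    have "\<theta> \<in> ?B" using r by simp
    then have B: "open ?B" "?B \<noteq> {}" by auto
    have near: "\<bar>lam \<theta>' n y - lam \<theta> n y\<bar> < e / 2" if "\<theta>' \<in> ?B" for \<theta>'
      using d(2)[of \<theta>'] that rd by (simp add: dist_commute[of \<theta>' \<theta>] dist_real_def)
    have "sup_lam ?B n y \<le> lam \<theta> n y + e / 2"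
    proof (rule sup_lam_least[OF B])
      fix \<theta>' assume "\<theta>' \<in> D \<inter> ?B"
      then have "\<theta>' \<in> ?B" by blast
      from near[OF this] show "lam \<theta>' n y \<le> lam \<theta> n y + e / 2" by linarith
    qed
    moreover obtain \<theta>' where \<theta>': "\<theta>' \<in> D \<inter> ?B" using D_dense[OF B] by blast
    moreover have "lam \<theta> n y - e / 2 \<le> sup_lam ?B n y"
    proof -
      have "\<theta>' \<in> ?B" using \<theta>' by blast
      from near[OF this] sup_lam_upper[OF \<theta>', of n y] show ?thesis by linarith
    qed
    ultimately show ?thesis using e by (simp add: abs_less_iff)
  qed
  then show "\<exists>m0. \<forall>m\<ge>m0. norm (sup_lam (ball \<theta> (r / real (Suc m))) n y - lam \<theta> n y) < e" by blast
qed

section \<open>Integrable bounds from (F2) and (F3)\<close>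

definition psi :: "(nat \<Rightarrow> 'y) \<Rightarrow> real" where
  "psi y = (\<Sum>x\<in>UNIV. \<bar>ln (g \<theta>\<^sub>0 x (y 0))\<bar>)"

lemma measurable_g_coord [measurable]: "(\<lambda>y. g \<theta> x (y (i::nat))) \<in> borel_measurable seqs"
  by (rule measurable_compose[OF _ g_measurable]) simp

lemma measurable_psi [measurable]: "psi \<in> borel_measurable seqs"
  unfolding psi_def[abs_def] by measurable

lemma psi_nonneg: "0 \<le> psi y" by (simp add: psi_def sum_nonneg)

lemma psi_integrable: "integrable P psi"
  unfolding psi_def[abs_def]
proof (intro Bochner_Integration.integrable_sum)
  fix x
  have "(\<integral>\<^sup>+y. ennreal \<bar>ln (g \<theta>\<^sub>0 x (y 0))\<bar> \<partial>P) \<le> (\<integral>\<^sup>+y. e2ennreal \<bar>elog (g \<theta>\<^sub>0 x (y 0))\<bar> \<partial>P)"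
    by (intro nn_integral_mono) (auto simp: e2ennreal_abs_elog)
  also note log_g_integrable[of x]
  finally show "integrable P (\<lambda>y. \<bar>ln (g \<theta>\<^sub>0 x (y 0))\<bar>)"
    by (intro integrableI_nonneg) auto
qed

text \<open>At a zero of the density \<open>elog\<close> has infinite absolute value, so the finite
  integral in (F2) makes such zeros a null event, and stationarity carries this to all times. The
  event matters for \<open>psi\<close>, in which \<open>ln 0\<close> would count as 0.\<close>

lemma AE_g_pos: "AE y in P. \<forall>i x. 0 < g \<theta>\<^sub>0 x (y i)"
proof -
  have "AE y in P. 0 < g \<theta>\<^sub>0 x (y 0)" for x
  proof -
    have "AE y in P. e2ennreal \<bar>elog (g \<theta>\<^sub>0 x (y 0))\<bar> \<noteq> \<infinity>"
      using log_g_integrable[of x] unfolding e2ennreal_abs_elog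
      by (intro nn_integral_noteq_infinite) auto
    then show ?thesis by eventually_elim (auto simp: e2ennreal_abs_elog split: if_splits)
  qed
  then have "AE y in P. 0 < g \<theta>\<^sub>0 x (drop_seq i y 0)" for x i by (rule AE_drop_seq)
  moreover have "drop_seq i y 0 = y i" for i and y :: "nat \<Rightarrow> 'y" by (simp add: drop_seq_apply[of i y 0])
  ultimately have "AE y in P. 0 < g \<theta>\<^sub>0 x (y i)" for x i by simp
  then show ?thesis by (simp add: AE_all_countable AE_finite_all)
qed

text \<open>\<open>exp (- psi y)\<close> lies below the true emission densities of all states at
  once, so the lower bound for products of minimal densities applies.\<close>

lemma p_lower:
  assumes "\<And>i x. 0 < g \<theta>\<^sub>0 x (y i)"
  shows "(\<Prod>i<n. exp (- psi (drop_seq i y))) \<le> p n y"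
proof (rule H.mix_likelihood_lower)
  fix i x
  have "\<bar>ln (g \<theta>\<^sub>0 x (y i))\<bar> \<le> psi (drop_seq i y)"
    unfolding psi_def drop_seq_apply[of i y 0]
    using member_le_sum[of x UNIV "\<lambda>x. \<bar>ln (g \<theta>\<^sub>0 x (y i))\<bar>"] by simp
  then have "exp (- psi (drop_seq i y)) \<le> exp (ln (g \<theta>\<^sub>0 x (y i)))" by (simp add: abs_le_iff)
  then show "exp (- psi (drop_seq i y)) \<le> g \<theta>\<^sub>0 x (y i)" using assms by simp
qed simp

lemma lam_1: "lam \<theta> 1 y = (\<Sum>x\<in>UNIV. g \<theta> x (y 0))"
  by (simp add: H.total_likelihood_def H.A_row_sum)

text \<open>If \<open>k x\<close> bounds the positive log-densities in state \<open>x\<close>, every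
  density is at most the exponential of the sum of the \<open>k x\<close>, and
  \<open>1 + sup_lam U 1 y\<close> exceeds this by a factor of at most \<open>1 + ?d\<close>. The
  added 1 keeps the logarithm nonnegative, so an upper bound suffices.\<close>

lemma ln_sup_lam_1_integrable:
  assumes "open U" "U \<noteq> {}" "U \<subseteq> V"
    and fin: "\<And>x. (\<integral>\<^sup>+ y. (SUP \<theta>'\<in>D \<inter> V. e2ennreal (max 0 (elog (g \<theta>' x (y 0))))) \<partial>P) < \<infinity>"
  shows "integrable P (\<lambda>y. ln (1 + sup_lam U 1 y))"
proof (rule integrableI_nonneg)
  let ?d = "real CARD('x)"
  let ?K = "\<lambda>x y. SUP \<theta>'\<in>D \<inter> V. e2ennreal (max 0 (elog (g \<theta>' x (y (0::nat)))))"
  have [measurable]: "?K x \<in> borel_measurable seqs" for x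
    unfolding e2ennreal_pos_elog by (intro borel_measurable_SUP countable_Int1 D_countable) measurable
  have le: "ennreal (ln (1 + sup_lam U 1 y)) \<le> ennreal (ln (1 + ?d)) + (\<Sum>x\<in>UNIV. ?K x y)" for y
  proof (cases "\<exists>x. ?K x y = \<top>")
    case True
    then obtain x where "?K x y = \<top>" ..
    moreover have "?K x y \<le> (\<Sum>x\<in>UNIV. ?K x y)" by (rule member_le_sum) auto
    ultimately have "\<top> \<le> (\<Sum>x\<in>UNIV. ?K x y)" by (simp only:)
    then have "(\<Sum>x\<in>UNIV. ?K x y) = \<top>" by (simp only: top_unique)
    then show ?thesis by (simp only: add_top_right_ennreal top_greatest)
  next
    case False
    define k where "k x = enn2real (?K x y)" for x
    have "?K x y \<noteq> \<top>" for x using False by blast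
    then have k: "?K x y = ennreal (k x)" "0 \<le> k x" for x
      unfolding k_def by (simp_all only: ennreal_enn2real_if if_False enn2real_nonneg)
    have g_le: "g \<theta>' x (y 0) \<le> exp (\<Sum>x\<in>UNIV. k x)" if "\<theta>' \<in> D \<inter> U" for \<theta>' x
    proof (cases "0 < g \<theta>' x (y 0)")
      case True
      have "e2ennreal (max 0 (elog (g \<theta>' x (y 0)))) \<le> ?K x y"
        using that assms(3) by (intro SUP_upper) auto
      then have "ennreal (max 0 (ln (g \<theta>' x (y 0)))) \<le> ennreal (k x)"
        unfolding k using True by (simp add: e2ennreal_pos_elog)
      then have "ln (g \<theta>' x (y 0)) \<le> k x" using k(2)[of x] by (simp add: ennreal_le_iff)
      also have "k x \<le> (\<Sum>x\<in>UNIV. k x)" using member_le_sum[of x UNIV k] k(2) by simp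
      finally show ?thesis using True by (metis exp_le_cancel_iff exp_ln)
    next
      case False
      then show ?thesis by (meson exp_ge_zero not_le order_trans less_imp_le)
    qed
    have "sup_lam U 1 y \<le> ?d * exp (\<Sum>x\<in>UNIV. k x)"
    proof (rule sup_lam_least[OF assms(1,2)])
      fix \<theta>' assume "\<theta>' \<in> D \<inter> U"
      then have "lam \<theta>' 1 y \<le> (\<Sum>x\<in>(UNIV::'x set). exp (\<Sum>x\<in>UNIV. k x))"
        unfolding lam_1 by (intro sum_mono g_le)
      then show "lam \<theta>' 1 y \<le> ?d * exp (\<Sum>x\<in>UNIV. k x)" by simp
    qed
    moreover have "1 \<le> exp (\<Sum>x\<in>UNIV. k x)" using k(2) by (simp add: sum_nonneg)
    ultimately have "1 + sup_lam U 1 y \<le> (1 + ?d) * exp (\<Sum>x\<in>UNIV. k x)"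
      unfolding distrib_right by linarith
    then have "ln (1 + sup_lam U 1 y) \<le> ln ((1 + ?d) * exp (\<Sum>x\<in>UNIV. k x))"
      using sup_lam_nonneg[OF assms(1,2), of 1 y] by (intro ln_mono) auto
    also have "\<dots> = ln (1 + ?d) + (\<Sum>x\<in>UNIV. k x)" by (subst ln_mult) auto
    finally have "ennreal (ln (1 + sup_lam U 1 y)) \<le> ennreal (ln (1 + ?d) + (\<Sum>x\<in>UNIV. k x))"
      by (rule ennreal_leI)
    also have "\<dots> = ennreal (ln (1 + ?d)) + (\<Sum>x\<in>UNIV. ?K x y)"
      using k(2) by (simp add: k(1) sum_ennreal sum_nonneg)
    finally show ?thesis .
  qed
  have "(\<integral>\<^sup>+y. ennreal (ln (1 + sup_lam U 1 y)) \<partial>P) \<le> (\<integral>\<^sup>+y. ennreal (ln (1 + ?d)) + (\<Sum>x\<in>UNIV. ?K x y) \<partial>P)"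
    by (intro nn_integral_mono le)
  also have "\<dots> = ennreal (ln (1 + ?d)) + (\<Sum>x\<in>UNIV. \<integral>\<^sup>+y. ?K x y \<partial>P)"
    using P.emeasure_space_1 by (simp add: nn_integral_add nn_integral_sum)
  also have "\<dots> < \<infinity>" using fin by simp
  finally show "(\<integral>\<^sup>+y. ennreal (ln (1 + sup_lam U 1 y)) \<partial>P) < \<infinity>" .
  show "AE y in P. 0 \<le> ln (1 + sup_lam U 1 y)"
    using sup_lam_nonneg[OF assms(1,2)] by simp
qed measurable

lemma negative_drift_ball:
  assumes diff: "\<And>q. invariant_distribution (Q \<theta>) q \<Longrightarrow> observation_law \<mu> q (Q \<theta>) (g \<theta>) \<noteq> P"
  shows "\<exists>r N c. 0 < r \<and> 0 < N \<and> 0 < c \<and> integrable P (\<lambda>y. ln (1 + sup_lam (ball \<theta> r) 1 y)) \<and>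
    integrable P (\<lambda>y. ln (sup_lam (ball \<theta> r) N y / p N y + c)) \<and>
    (\<integral>y. ln (sup_lam (ball \<theta> r) N y / p N y + c) \<partial>P) < 0"
proof -
  obtain N c where N: "0 < N" and c: "0 < c" and
    neg: "integrable P (\<lambda>y. ln (lam \<theta> N y / p N y + c)) \<Longrightarrow> (\<integral>y. ln (lam \<theta> N y / p N y + c) \<partial>P) < 0"
    using kl_gap[OF H.hmm_axioms H.hmm_axioms \<pi>_inv diff] by blast
  obtain V where V: "open V" "\<theta> \<in> V"
    and fin: "\<And>x. (\<integral>\<^sup>+ y. (SUP \<theta>'\<in>D \<inter> V. e2ennreal (max 0 (elog (g \<theta>' x (y 0))))) \<partial>P) < \<infinity>"
    using sup_log_g_integrable[of \<theta>] by blast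
  obtain r where r: "0 < r" "ball \<theta> r \<subseteq> V" using V open_contains_ball by blast
  define B where "B m = ball \<theta> (r / real (Suc m))" for m
  have B: "open (B m)" "B m \<noteq> {}" "B m \<subseteq> ball \<theta> r" for m
  proof -
    have "r / real (Suc m) \<le> r / 1" using r(1) by (intro divide_left_mono) auto
    then show "B m \<subseteq> ball \<theta> r" unfolding B_def by (intro subset_ball) simp
    have "\<theta> \<in> B m" using r(1) by (simp add: B_def)
    then show "open (B m)" "B m \<noteq> {}" by (auto simp: B_def)
  qed
  have int1: "integrable P (\<lambda>y. ln (1 + sup_lam U 1 y))" if "open U" "U \<noteq> {}" "U \<subseteq> ball \<theta> r" for U
    using that r(2) by (intro ln_sup_lam_1_integrable[OF _ _ _ fin]) auto
  define d where "d = real CARD('x)"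
  have d: "0 < d" by (simp add: d_def)
  define s where "s m y = ln (sup_lam (B m) N y / p N y + c)" for m y
  \<comment> \<open>Below, \<open>s m y\<close> is at least \<open>ln c\<close>. Above,
    \<open>N\<close> one-step suprema bound the numerator and \<open>p_lower\<close> the
    denominator; \<open>c\<close> is absorbed into the factor \<open>d + c\<close> because the
    product is at least one. The bound does not depend on \<open>m\<close>.\<close>
  define w where "w y = \<bar>ln c\<bar> + \<bar>ln (d + c)\<bar> + (\<Sum>i<N. ln (1 + sup_lam (ball \<theta> r) 1 (drop_seq i y)) + psi (drop_seq i y))" for y
  have w_int: "integrable P w"
  proof -
    have "integrable P (\<lambda>y. ln (1 + sup_lam (ball \<theta> r) 1 y))"
      using int1[of "ball \<theta> r"] r(1) by auto
    from integrable_drop_seq[OF this] integrable_drop_seq[OF psi_integrable]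
    have "integrable P (\<lambda>y. \<Sum>i<N. ln (1 + sup_lam (ball \<theta> r) 1 (drop_seq i y)) + psi (drop_seq i y))"
      by (intro Bochner_Integration.integrable_sum Bochner_Integration.integrable_add)
    then show ?thesis unfolding w_def by (intro Bochner_Integration.integrable_add P.integrable_const)
  qed
  have s_bound: "AE y in P. norm (s m y) \<le> w y" for m
    using AE_g_pos
  proof eventually_elim
    case (elim y)
    let ?S = "\<lambda>i. sup_lam (ball \<theta> r) 1 (drop_seq i y)"
    have S0: "0 \<le> ?S i" for i using r(1) by (intro sup_lam_nonneg) auto
    have q: "0 \<le> sup_lam (B m) N y / p N y"
      by (intro divide_nonneg_nonneg sup_lam_nonneg B H.mix_likelihood_nonneg)
    have low: "(\<Prod>i<N. exp (- psi (drop_seq i y))) \<le> p N y" using elim by (intro p_lower) auto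
    have pos: "0 < (\<Prod>i<N. exp (- psi (drop_seq i y)))" by (intro prod_pos) auto
    have "sup_lam (B m) N y \<le> sup_lam (ball \<theta> r) (N * 1) y"
      using sup_lam_mono[OF B(1,2,3), of m N y] by simp
    also have "\<dots> \<le> d * (\<Prod>i<N. ?S i)"
      using sup_lam_mult_le[of "ball \<theta> r" N 1 y] r(1) by (simp add: d_def)
    also have "\<dots> \<le> d * (\<Prod>i<N. 1 + ?S i)"
      using d S0 by (intro mult_left_mono prod_mono) auto
    finally have up: "sup_lam (B m) N y \<le> d * (\<Prod>i<N. 1 + ?S i)" .
    have prod1: "1 \<le> (\<Prod>i<N. (1 + ?S i) * exp (psi (drop_seq i y)))"
    proof (rule prod_ge_1)
      fix i
      show "1 \<le> (1 + ?S i) * exp (psi (drop_seq i y))"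
        using mult_mono[of 1 "1 + ?S i" 1 "exp (psi (drop_seq i y))"] S0[of i] psi_nonneg by simp
    qed
    have "sup_lam (B m) N y / p N y \<le> (d * (\<Prod>i<N. 1 + ?S i)) / (\<Prod>i<N. exp (- psi (drop_seq i y)))"
      using d S0 by (intro frac_le up low pos mult_nonneg_nonneg prod_nonneg) auto
    also have "\<dots> = d * (\<Prod>i<N. (1 + ?S i) * exp (psi (drop_seq i y)))"
      by (simp add: prod.distrib exp_minus prod_inversef[symmetric] divide_inverse)
    finally have "sup_lam (B m) N y / p N y + c \<le> d * (\<Prod>i<N. (1 + ?S i) * exp (psi (drop_seq i y))) + c" by simp
    also have "\<dots> \<le> (d + c) * (\<Prod>i<N. (1 + ?S i) * exp (psi (drop_seq i y)))"
      using mult_left_mono[OF prod1, of c] c by (simp add: distrib_right)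
    finally have "s m y \<le> ln ((d + c) * (\<Prod>i<N. (1 + ?S i) * exp (psi (drop_seq i y))))"
      unfolding s_def using q c by (intro ln_mono) auto
    also have "\<dots> = ln (d + c) + ln (\<Prod>i<N. (1 + ?S i) * exp (psi (drop_seq i y)))"
      using d c prod1 by (subst ln_mult_pos) auto
    also have "ln (\<Prod>i<N. (1 + ?S i) * exp (psi (drop_seq i y))) = (\<Sum>i<N. ln ((1 + ?S i) * exp (psi (drop_seq i y))))"
    proof (intro ln_prod)
      fix i
      have "0 < 1 + ?S i" using S0[of i] by linarith
      then have "0 < (1 + ?S i) * exp (psi (drop_seq i y))" by simp
      then show "(1 + ?S i) * exp (psi (drop_seq i y)) \<noteq> 0" by (rule less_imp_neq[symmetric])
    qed simp
    also have "\<dots> = (\<Sum>i<N. ln (1 + ?S i) + psi (drop_seq i y))"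
      using S0 by (intro sum.cong refl) (subst ln_mult_pos, simp_all add: add_pos_nonneg)
    finally have "s m y \<le> ln (d + c) + (\<Sum>i<N. ln (1 + ?S i) + psi (drop_seq i y))" .
    moreover have "ln c \<le> s m y" unfolding s_def using q c by (intro ln_mono) auto
    moreover have "0 \<le> (\<Sum>i<N. ln (1 + ?S i) + psi (drop_seq i y))"
      using S0 psi_nonneg by (intro sum_nonneg add_nonneg_nonneg) auto
    ultimately show ?case unfolding w_def real_norm_def by linarith
  qed
  have s_lim: "AE y in P. (\<lambda>m. s m y) \<longlonglongrightarrow> ln (lam \<theta> N y / p N y + c)"
    using H.AE_mix_likelihood_pos[of \<theta>\<^sub>0 \<pi>]
  proof eventually_elim
    case (elim y)
    have "0 < lam \<theta> N y / p N y + c"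
      using c by (intro add_nonneg_pos divide_nonneg_nonneg H.total_likelihood_nonneg H.mix_likelihood_nonneg)
    moreover have "p N y \<noteq> 0" using elim by (metis less_irrefl)
    ultimately show ?case
      unfolding s_def B_def by (intro tendsto_intros sup_lam_ball_tendsto r(1)) auto
  qed
  have [measurable]: "s m \<in> borel_measurable seqs" for m unfolding s_def by measurable
  have lim_meas: "(\<lambda>y. ln (lam \<theta> N y / p N y + c)) \<in> borel_measurable P"
    unfolding measurable_P_iff by measurable
  have s_meas: "s m \<in> borel_measurable P" for m unfolding measurable_P_iff by measurable
  note dom = integrable_dominated_convergence[OF lim_meas s_meas w_int s_lim s_bound]
    integrable_dominated_convergence2[OF lim_meas s_meas w_int s_lim s_bound]
    integral_dominated_convergence[OF lim_meas s_meas w_int s_lim s_bound]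
  \<comment> \<open>Domination has made the limit integrable, which discharges the premise left open
    by \<open>kl_gap\<close>.\<close>
  have "(\<integral>y. ln (lam \<theta> N y / p N y + c) \<partial>P) < 0" using neg dom(1) by blast
  then have "\<forall>\<^sub>F m in sequentially. (\<integral>y. s m y \<partial>P) < 0"
    using dom(3) by (rule order_tendstoD[rotated])
  then obtain m where m: "(\<integral>y. s m y \<partial>P) < 0" by (auto simp: eventually_sequentially)
  show ?thesis
    using m c N r(1) dom(2)[of m] int1[OF B, of m] unfolding s_def B_def
    by (intro exI[of _ "r / real (Suc m)"] exI[of _ N] exI[of _ c]) auto
qed

end

section \<open>Exponential decay near a non-equivalent parameter\<close>

context hmm_family
begin

text \<open>Made for the leftover single observations, which sit near time \<open>n\<close> rather
  than at a fixed place. Truncation at a high level \<open>K\<close> pushes the mean excess below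
  \<open>\<delta>\<close>; then \<open>exists_phase\<close> with period one, whose only phase is 0,
  bounds the sums of the excess minus \<open>\<delta>\<close>.\<close>

lemma sum_excess:
  assumes V: "integrable P V" and \<delta>: "0 < \<delta>"
  shows "\<exists>K\<ge>0. AE y in P. \<exists>C. \<forall>n. (\<Sum>i<n. max 0 (V (drop_seq i y) - K)) \<le> C + \<delta> * real n"
proof -
  have [measurable]: "V \<in> borel_measurable seqs"
    using V by (simp add: measurable_P_iff[symmetric] borel_measurable_integrable)
  have "(\<lambda>m. \<integral>y. max 0 (V y - real m) \<partial>P) \<longlonglongrightarrow> (\<integral>y. 0 \<partial>P)"
  proof (rule integral_dominated_convergence[where w="\<lambda>y. \<bar>V y\<bar>"])
    show "AE y in P. (\<lambda>m. max 0 (V y - real m)) \<longlonglongrightarrow> 0"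
    proof (intro AE_I2 tendsto_eventually)
      fix y
      obtain m0 :: nat where "V y < real m0" using reals_Archimedean2 by blast
      then show "\<forall>\<^sub>F m in sequentially. max 0 (V y - real m) = 0"
        by (intro eventually_sequentiallyI[of m0]) simp
    qed
  qed (use V in \<open>auto simp: measurable_P_iff\<close>)
  then have "\<forall>\<^sub>F m in sequentially. (\<integral>y. max 0 (V y - real m) \<partial>P) < \<delta>"
    using \<delta> by (intro order_tendstoD) auto
  then obtain m :: nat where m: "(\<integral>y. max 0 (V y - real m) \<partial>P) < \<delta>" by (auto simp: eventually_sequentially)
  have int: "integrable P (\<lambda>y. max 0 (V y - real m))"
    using V by auto
  have "AE y in P. \<exists>j<1. \<exists>C. \<forall>k. (\<Sum>i<k. max 0 (V (drop_seq (j + i * 1) y) - real m) - \<delta>) \<le> C"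
    using m int by (intro H.exists_phase[OF irr \<pi>_inv]) (auto simp: P.prob_space[simplified])
  then have "AE y in P. \<exists>C. \<forall>n. (\<Sum>i<n. max 0 (V (drop_seq i y) - real m)) \<le> C + \<delta> * real n"
    by eventually_elim (simp add: sum_subtractf algebra_simps)
  then show ?thesis by (intro exI[of _ "real m"]) simp
qed

text \<open>Each of the three stretches costs one factor \<open>CARD('x)\<close>, hence the cube.
  The 1 inside \<open>V\<close> and the \<open>c\<close> inside \<open>W\<close> only enlarge the
  majorant.\<close>

lemma block_bound:
  assumes U: "open U" "U \<noteq> {}" and \<theta>: "\<theta> \<in> D \<inter> U"
    and p_pos: "\<And>i n. 0 < p n (drop_seq i y)"
    and V: "\<And>z. V z = ln (1 + sup_lam U 1 z / p 1 z)"
    and W: "\<And>z. W z = ln (sup_lam U N z / p N z + c)" and c: "0 < c"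
  shows "lam \<theta> (j + k * N + r) y \<le> real CARD('x) ^ 3 *
    exp ((\<Sum>i<j. V (drop_seq i y)) + (\<Sum>i<k. W (drop_seq (j + i * N) y)) + (\<Sum>i<r. V (drop_seq (j + k * N + i) y))) *
    H.block_density \<theta>\<^sub>0 \<pi> N j k r y"
proof -
  let ?d = "real CARD('x)"
  have S1: "sup_lam U 1 (drop_seq i y) \<le> exp (V (drop_seq i y)) * p 1 (drop_seq i y)" for i
  proof -
    have nn: "0 \<le> sup_lam U 1 (drop_seq i y) / p 1 (drop_seq i y)"
      using sup_lam_nonneg[OF U] p_pos[of 1 i] by (simp add: less_imp_le del: One_nat_def)
    then have "exp (V (drop_seq i y)) = 1 + sup_lam U 1 (drop_seq i y) / p 1 (drop_seq i y)"
      by (simp add: V add_pos_nonneg del: One_nat_def)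
    then show ?thesis using p_pos[of 1 i] by (simp add: distrib_right del: One_nat_def)
  qed
  have SN: "sup_lam U N (drop_seq i y) \<le> exp (W (drop_seq i y)) * p N (drop_seq i y)" for i
  proof -
    have nn: "0 \<le> sup_lam U N (drop_seq i y) / p N (drop_seq i y)"
      using sup_lam_nonneg[OF U] p_pos[of N i] by (simp add: less_imp_le)
    then have "exp (W (drop_seq i y)) = sup_lam U N (drop_seq i y) / p N (drop_seq i y) + c"
      using c by (simp add: W add_nonneg_pos)
    then show ?thesis using p_pos[of N i] c by (simp add: distrib_right)
  qed
  have L: "lam \<theta> (k * m) z \<le> ?d * (\<Prod>i<k. sup_lam U m (drop_seq (i * m) z))" for k m z
    by (rule order_trans[OF H.total_likelihood_mult_le])
       (intro mult_left_mono prod_mono conjI H.total_likelihood_nonneg sup_lam_upper[OF \<theta>]; simp)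
  have Pr: "0 \<le> ?d * (\<Prod>i<k. sup_lam U m (drop_seq (i * m) z))" for k m z
    by (intro mult_nonneg_nonneg prod_nonneg sup_lam_nonneg[OF U]) simp
  have "lam \<theta> (j * 1 + (k * N + r * 1)) y \<le>
      lam \<theta> (j * 1) y * (lam \<theta> (k * N) (drop_seq j y) * lam \<theta> (r * 1) (drop_seq (k * N) (drop_seq j y)))"
    using order_trans[OF H.total_likelihood_append mult_left_mono[OF H.total_likelihood_append H.total_likelihood_nonneg]]
    by simp
  also have "\<dots> \<le> (?d * (\<Prod>i<j. sup_lam U 1 (drop_seq (i * 1) y))) *
      ((?d * (\<Prod>i<k. sup_lam U N (drop_seq (i * N) (drop_seq j y)))) *
       (?d * (\<Prod>i<r. sup_lam U 1 (drop_seq (i * 1) (drop_seq (k * N) (drop_seq j y))))))"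
    by (intro mult_mono L Pr mult_nonneg_nonneg H.total_likelihood_nonneg)
  also have "\<dots> = ?d ^ 3 * ((\<Prod>i<j. sup_lam U 1 (drop_seq i y)) *
      ((\<Prod>i<k. sup_lam U N (drop_seq (j + i * N) y)) * (\<Prod>i<r. sup_lam U 1 (drop_seq (j + k * N + i) y))))"
    by (simp add: power3_eq_cube mult_ac)
  also have "\<dots> \<le> ?d ^ 3 * ((\<Prod>i<j. exp (V (drop_seq i y)) * p 1 (drop_seq i y)) *
      ((\<Prod>i<k. exp (W (drop_seq (j + i * N) y)) * p N (drop_seq (j + i * N) y)) *
       (\<Prod>i<r. exp (V (drop_seq (j + k * N + i) y)) * p 1 (drop_seq (j + k * N + i) y))))"
    by (intro mult_left_mono mult_mono prod_mono conjI S1 SN sup_lam_nonneg[OF U] prod_nonneg mult_nonneg_nonneg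
        exp_ge_zero H.mix_likelihood_nonneg) simp_all
  also have "\<dots> = ?d ^ 3 *
    exp ((\<Sum>i<j. V (drop_seq i y)) + (\<Sum>i<k. W (drop_seq (j + i * N) y)) + (\<Sum>i<r. V (drop_seq (j + k * N + i) y))) *
    H.block_density \<theta>\<^sub>0 \<pi> N j k r y"
    by (simp add: prod.distrib exp_add exp_sum H.block_density_def mult_ac del: One_nat_def)
  finally show ?thesis by (simp add: add.assoc)
qed

lemma lam_le_on_open:
  assumes U: "open U" and le: "\<And>\<theta>. \<theta> \<in> D \<inter> U \<Longrightarrow> lam \<theta> n y \<le> c" and \<theta>: "\<theta> \<in> U"
  shows "lam \<theta> n y \<le> c"
proof (rule ccontr)
  assume n: "\<not> lam \<theta> n y \<le> c"
  let ?O = "{\<theta>. c < lam \<theta> n y}"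
  have "open ?O"
    using open_Collect_less[OF continuous_on_const continuous_lam] .
  then have "open (U \<inter> ?O)" using U by (rule open_Int[rotated])
  moreover have "U \<inter> ?O \<noteq> {}" using n \<theta> by auto
  ultimately obtain \<theta>' where "\<theta>' \<in> D \<inter> (U \<inter> ?O)" using D_dense by blast
  then show False using le[of \<theta>'] by auto
qed

text \<open>The radius is fixed before the path, while the constants may vary with the path and with
  the phase of its blocks. This order of quantifiers allows a finite cover by balls, followed by a
  finite union of null sets.\<close>

lemma exponential_bound:
  assumes diff: "\<And>q. invariant_distribution (Q \<theta>) q \<Longrightarrow> observation_law \<mu> q (Q \<theta>) (g \<theta>) \<noteq> P"
  shows "\<exists>r>0. AE y in P. \<exists>C \<gamma> n0. 0 < \<gamma> \<and>
    (\<forall>n\<ge>n0. \<forall>\<theta>'\<in>ball \<theta> r. lam \<theta>' n y \<le> C * (real n + 1)\<^sup>2 * exp (- \<gamma> * real n) * p n y)"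
proof -
  obtain r N c where r: "0 < r" and N: "0 < N" and c: "0 < c"
    and int1: "integrable P (\<lambda>y. ln (1 + sup_lam (ball \<theta> r) 1 y))"
    and intW: "integrable P (\<lambda>y. ln (sup_lam (ball \<theta> r) N y / p N y + c))"
    and negW: "(\<integral>y. ln (sup_lam (ball \<theta> r) N y / p N y + c) \<partial>P) < 0"
    using negative_drift_ball[OF diff] by blast
  define U where "U = ball \<theta> r"
  have "\<theta> \<in> U" using r by (simp add: U_def)
  then have U: "open U" "U \<noteq> {}" by (auto simp: U_def)
  define W where "W z = ln (sup_lam U N z / p N z + c)" for z
  define V where "V z = ln (1 + sup_lam U 1 z / p 1 z)" for z
  have q1: "0 \<le> sup_lam U 1 z / p 1 z" for z
    by (intro divide_nonneg_nonneg sup_lam_nonneg U H.mix_likelihood_nonneg)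
  have V_nonneg: "0 \<le> V z" for z using q1[of z] by (simp add: V_def del: One_nat_def)
  have V_int: "integrable P V"
  proof (rule Bochner_Integration.integrable_bound[OF Bochner_Integration.integrable_add[OF int1 psi_integrable]])
    show "V \<in> borel_measurable P" unfolding measurable_P_iff V_def[abs_def] by measurable
    show "AE y in P. norm (V y) \<le> norm (ln (1 + sup_lam (ball \<theta> r) 1 y) + psi y)"
      using AE_g_pos
    proof eventually_elim
      case (elim y)
      let ?s = "sup_lam U 1 y"
      have s: "0 \<le> ?s" by (rule sup_lam_nonneg[OF U])
      have le: "exp (- psi y) \<le> p 1 y" using p_lower[of y 1] elim by simp
      then have "0 < p 1 y" by (rule less_le_trans[OF exp_gt_zero])
      then have "?s / p 1 y \<le> ?s / exp (- psi y)"
        using s le by (intro divide_left_mono mult_pos_pos) auto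
      then have "1 + ?s / p 1 y \<le> exp (psi y) + ?s * exp (psi y)"
        using psi_nonneg[of y] by (intro add_mono) (auto simp: exp_minus field_simps)
      then have "V y \<le> ln ((1 + ?s) * exp (psi y))"
        unfolding V_def using q1[of y] by (intro ln_mono) (auto simp: distrib_right)
      also have "\<dots> = ln (1 + ?s) + psi y"
        using s by (subst ln_mult_pos) auto
      finally show ?case using V_nonneg[of y] by (simp add: U_def del: One_nat_def)
    qed
  qed
  \<comment> \<open>Half of the drift of \<open>W\<close> is kept as slack: \<open>W + e\<close>
    still has mean \<open>- e\<close>, and each block then contributes a decay of
    \<open>e\<close>.\<close>
  define e where "e = - (\<integral>y. W y \<partial>P) / 2"
  have e: "0 < e" using negW by (simp add: e_def W_def U_def)
  have W_int: "integrable P W" using intW by (simp add: W_def[abs_def] U_def)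
  have phase: "AE y in P. \<exists>j<N. \<exists>C. \<forall>k. (\<Sum>i<k. W (drop_seq (j + i * N) y) + e) \<le> C"
  proof (rule H.exists_phase[OF irr \<pi>_inv _ _ N])
    show "integrable P (\<lambda>y. W y + e)" using W_int by simp
    have "(\<integral>y. W y + e \<partial>P) = (\<integral>y. W y \<partial>P) + e"
      using W_int by (simp add: P.prob_space[simplified])
    then show "(\<integral>y. W y + e \<partial>P) < 0" using e by (simp add: e_def)
  qed
  \<comment> \<open>About \<open>n / N\<close> blocks yield a decay of \<open>2 * \<delta>\<close>
    per observation. One \<open>\<delta>\<close> is spent on the leftover observations; the other
    remains as the rate.\<close>
  define \<delta> where "\<delta> = e / (2 * real N)"
  have \<delta>: "0 < \<delta>" using e N by (simp add: \<delta>_def)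
  obtain K where K: "0 \<le> K"
    and excess: "AE y in P. \<exists>C. \<forall>n. (\<Sum>i<n. max 0 (V (drop_seq i y) - K)) \<le> C + \<delta> * real n"
    using sum_excess[OF V_int \<delta>] by blast
  have pos: "AE y in P. \<forall>i n. 0 < p n (drop_seq i y)"
    using AE_drop_seq[OF H.AE_mix_likelihood_pos[of \<theta>\<^sub>0 \<pi>]] by (simp add: AE_all_countable)
  have "AE y in P. \<exists>C \<gamma> n0. 0 < \<gamma> \<and>
    (\<forall>n\<ge>n0. \<forall>\<theta>'\<in>U. lam \<theta>' n y \<le> C * (real n + 1)\<^sup>2 * exp (- \<gamma> * real n) * p n y)"
    using phase excess pos H.AE_block_density_le[of \<theta>\<^sub>0 \<pi> N]
  proof eventually_elim
    case (elim y)
    obtain j C1 where j: "j < N" and C1: "\<And>k. (\<Sum>i<k. W (drop_seq (j + i * N) y) + e) \<le> C1"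
      using elim(1) by blast
    obtain C2 where C2: "\<And>n. (\<Sum>i<n. max 0 (V (drop_seq i y) - K)) \<le> C2 + \<delta> * real n"
      using elim(2) by blast
    have p_pos: "0 < p n (drop_seq i y)" for i n using elim(3) by blast
    have p_pos0: "0 < p n y" for n using p_pos[of n 0] by simp
    have "\<forall>r'. \<exists>C\<ge>0. \<forall>k. H.block_density \<theta>\<^sub>0 \<pi> N j k r' y \<le> C * (real k + 1)\<^sup>2 * p (j + k * N + r') y"
      using elim(4) by blast
    then obtain Cb where Cb: "\<And>r'. 0 \<le> Cb r'"
      "\<And>r' k. H.block_density \<theta>\<^sub>0 \<pi> N j k r' y \<le> Cb r' * (real k + 1)\<^sup>2 * p (j + k * N + r') y"
      by metis
    \<comment> \<open>The remainder \<open>r'\<close> varies with \<open>n\<close>, so the constants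
      of all \<open>N\<close> possible remainders are summed.\<close>
    define C3 where "C3 = (\<Sum>r'<N. Cb r')"
    define C4 where "C4 = (\<Sum>i<N. V (drop_seq i y))"
    define C5 where "C5 = C4 + C1 + 2 * e + real N * K + C2"
    define C where "C = real CARD('x) ^ 3 * exp C5 * C3"
    have C3: "0 \<le> C3" unfolding C3_def by (intro sum_nonneg Cb)
    have "lam \<theta>' n y \<le> C * (real n + 1)\<^sup>2 * exp (- \<delta> * real n) * p n y"
      if n: "N \<le> n" and \<theta>': "\<theta>' \<in> D \<inter> U" for n \<theta>'
    proof -
      \<comment> \<open>As \<open>j < N \<le> n\<close>, the observations after the phase
        \<open>j\<close> are cut into \<open>k\<close> blocks and fewer than \<open>N\<close>
        leftovers.\<close>
      define k where "k = (n - j) div N"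
      define r' where "r' = (n - j) mod N"
      have r': "r' < N" using N by (simp add: r'_def)
      have n_eq: "n = j + k * N + r'" using n j by (simp add: k_def r'_def)
      have kn: "k \<le> n"
      proof -
        have "k * 1 \<le> k * N" using N by (intro mult_le_mono2) simp
        also have "k * N \<le> n" by (simp add: n_eq)
        finally show ?thesis by simp
      qed
      have "real n = real j + real k * real N + real r'" by (simp add: n_eq)
      also have "\<dots> \<le> (real k + 2) * real N" using j r' by (simp add: distrib_right)
      finally have nk: "real n \<le> (real k + 2) * real N" .
      have b1: "(\<Sum>i<j. V (drop_seq i y)) \<le> C4"
        unfolding C4_def using j V_nonneg by (intro sum_mono2) auto
      have b2: "(\<Sum>i<k. W (drop_seq (j + i * N) y)) \<le> C1 - e * real k"
        using C1[of k] by (simp add: sum.distrib mult.commute)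
      have b3: "(\<Sum>i<r'. V (drop_seq (j + k * N + i) y)) \<le> real N * K + C2 + \<delta> * real n"
      proof -
        have "(\<Sum>i<r'. V (drop_seq (j + k * N + i) y)) \<le>
            (\<Sum>i<r'. K + max 0 (V (drop_seq (j + k * N + i) y) - K))"
          by (intro sum_mono) auto
        also have "\<dots> = real r' * K + (\<Sum>i<r'. max 0 (V (drop_seq (j + k * N + i) y) - K))"
          by (simp add: sum.distrib)
        also have "(\<Sum>i<r'. max 0 (V (drop_seq (j + k * N + i) y) - K)) =
            (\<Sum>i\<in>(\<lambda>i. j + k * N + i) ` {..<r'}. max 0 (V (drop_seq i y) - K))"
          by (subst sum.reindex) (auto simp: inj_on_def)
        also have "\<dots> \<le> (\<Sum>i<n. max 0 (V (drop_seq i y) - K))"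
          by (intro sum_mono2) (auto simp: n_eq)
        also have "\<dots> \<le> C2 + \<delta> * real n" by (rule C2)
        also have "real r' * K \<le> real N * K" using r' K by (intro mult_right_mono) auto
        finally show ?thesis by simp
      qed
      have "e * (real n / real N) \<le> e * (real k + 2)"
        using nk N e by (intro mult_left_mono) (auto simp: field_simps)
      then have b4: "2 * \<delta> * real n \<le> e * real k + 2 * e"
        using N by (simp add: \<delta>_def field_simps)
      have ex: "(\<Sum>i<j. V (drop_seq i y)) + (\<Sum>i<k. W (drop_seq (j + i * N) y)) +
          (\<Sum>i<r'. V (drop_seq (j + k * N + i) y)) \<le> C5 - \<delta> * real n"
        using b1 b2 b3 b4 unfolding C5_def by linarith
      have bd: "H.block_density \<theta>\<^sub>0 \<pi> N j k r' y \<le> C3 * (real n + 1)\<^sup>2 * p n y"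
      proof -
        have "H.block_density \<theta>\<^sub>0 \<pi> N j k r' y \<le> Cb r' * (real k + 1)\<^sup>2 * p n y"
          using Cb(2)[of k r'] by (simp add: n_eq)
        also have "\<dots> \<le> C3 * (real n + 1)\<^sup>2 * p n y"
        proof (intro mult_right_mono mult_mono power_mono)
          show "Cb r' \<le> C3" unfolding C3_def using r' Cb(1) by (intro member_le_sum) auto
        qed (use kn C3 p_pos0[of n] in auto)
        finally show ?thesis .
      qed
      have "lam \<theta>' n y \<le> real CARD('x) ^ 3 *
        exp ((\<Sum>i<j. V (drop_seq i y)) + (\<Sum>i<k. W (drop_seq (j + i * N) y)) + (\<Sum>i<r'. V (drop_seq (j + k * N + i) y))) *
        H.block_density \<theta>\<^sub>0 \<pi> N j k r' y"
        unfolding n_eq by (rule block_bound[OF U \<theta>' p_pos V_def W_def c])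
      also have "\<dots> \<le> real CARD('x) ^ 3 * exp (C5 - \<delta> * real n) * (C3 * (real n + 1)\<^sup>2 * p n y)"
        using ex bd by (intro mult_mono) (auto simp: H.block_density_nonneg)
      also have "\<dots> = C * (real n + 1)\<^sup>2 * exp (- \<delta> * real n) * p n y"
        by (simp add: C_def exp_diff exp_minus divide_inverse mult_ac)
      finally show ?thesis .
    qed
    then have "\<forall>n\<ge>N. \<forall>\<theta>'\<in>U. lam \<theta>' n y \<le> C * (real n + 1)\<^sup>2 * exp (- \<delta> * real n) * p n y"
      using lam_le_on_open[OF U(1)] by blast
    then show ?case using \<delta> by blast
  qed
  then show ?thesis using r unfolding U_def by blast
qed

end

section \<open>Consistency\<close>

lemma compact_UNIV_countable_dense:
  assumes "compact (UNIV :: 'p::metric_space set)"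
  shows "\<exists>D :: 'p set. countable D \<and> (\<forall>U. open U \<longrightarrow> U \<noteq> {} \<longrightarrow> D \<inter> U \<noteq> {})"
proof -
  have "\<forall>e>0. \<exists>k. finite k \<and> k \<subseteq> (UNIV :: 'p set) \<and> UNIV \<subseteq> (\<Union>x\<in>k. ball x e)"
    using assms by (intro seq_compact_imp_totally_bounded compact_imp_seq_compact)
  then have "\<forall>n. \<exists>k :: 'p set. finite k \<and> UNIV \<subseteq> (\<Union>x\<in>k. ball x (1 / real (Suc n)))"
    by (metis of_nat_0_less_iff zero_less_Suc zero_less_divide_1_iff)
  then obtain k :: "nat \<Rightarrow> 'p set" where k: "\<And>n. finite (k n)" "\<And>n. UNIV \<subseteq> (\<Union>x\<in>k n. ball x (1 / real (Suc n)))"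
    by metis
  have "(\<Union>n. k n) \<inter> U \<noteq> {}" if U: "open U" "U \<noteq> {}" for U
  proof -
    obtain a where a: "a \<in> U" using U by blast
    then obtain e where e: "0 < e" "ball a e \<subseteq> U" using U(1) open_contains_ball by blast
    obtain n :: nat where n: "1 / real (Suc n) < e" using e(1) nat_approx_posE by blast
    obtain x where "x \<in> k n" "a \<in> ball x (1 / real (Suc n))" using k(2)[of n] by blast
    then have "x \<in> ball a e" using n by (simp add: dist_commute)
    with e \<open>x \<in> k n\<close> show ?thesis by blast
  qed
  moreover have "countable (\<Union>n. k n)" using k(1) by (intro countable_UN) (auto intro: countable_finite)
  ultimately show ?thesis by blast
qed

theorem mainTheorem6:
  fixes \<mu> :: "'y::polish_space measure"
    and Q :: "'p::metric_space \<Rightarrow> real^'x::finite^'x"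
    and g :: "'p \<Rightarrow> 'x \<Rightarrow> 'y \<Rightarrow> real"
    and \<theta>\<^sub>0 :: 'p
    and \<nu> :: "'x pmf"
    and \<theta>h :: "nat \<Rightarrow> (nat \<Rightarrow> 'y) \<Rightarrow> 'p"
  assumes compact_parameters: "compact (UNIV :: 'p set)"
    and sets_\<mu>: "sets \<mu> = sets borel"
    and \<mu>_sigma_finite: "sigma_finite_measure \<mu>"
    and Q_stochastic: "\<And>\<theta>. stochastic_matrix (Q \<theta>)"
    and g_measurable:
      "(\<lambda>(\<theta>, x, y). g \<theta> x y) \<in> borel_measurable (borel \<Otimes>\<^sub>M count_space UNIV \<Otimes>\<^sub>M borel)"
    and g_nonneg: "\<And>\<theta> x y. 0 \<le> g \<theta> x y"
    and g_density: "\<And>\<theta> x. (\<integral>\<^sup>+ y. ennreal (g \<theta> x y) \<partial>\<mu>) = 1"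
    and F1: "irreducible_matrix (Q \<theta>\<^sub>0)"
    and F2: "\<And>x. (\<integral>\<^sup>+ (_, y). e2ennreal \<bar>elog (g \<theta>\<^sub>0 x (y 0))\<bar>
                     \<partial>stationary_hmm_law \<mu> (Q \<theta>\<^sub>0) (g \<theta>\<^sub>0)) < \<infinity>"
    and F3: "\<And>\<theta>. \<exists>U. open U \<and> \<theta> \<in> U \<and>
               (\<forall>x. (\<integral>\<^sup>+ (_, y). (SUP \<theta>'\<in>U. e2ennreal (max 0 (elog (g \<theta>' x (y 0)))))
                       \<partial>stationary_hmm_law \<mu> (Q \<theta>\<^sub>0) (g \<theta>\<^sub>0)) < \<infinity>)"
    and F4_Q: "continuous_on UNIV Q"
    and F4_g: "\<And>x y. continuous_on UNIV (\<lambda>\<theta>. g \<theta> x y)"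
    and \<nu>_charges: "\<And>x. 0 < pmf \<nu> x"
    and mle: "approximate_mle \<mu> Q g \<theta>\<^sub>0 \<nu> \<theta>h"
  shows "AE (x, y) in stationary_hmm_law \<mu> (Q \<theta>\<^sub>0) (g \<theta>\<^sub>0).
           (\<lambda>n. infdist (\<theta>h n (restrict y {..n})) (parameter_class \<mu> Q g \<theta>\<^sub>0)) \<longlonglongrightarrow> 0"
proof -
  let ?J = "stationary_hmm_law \<mu> (Q \<theta>\<^sub>0) (g \<theta>\<^sub>0)"
  let ?\<pi> = "stationary_distribution (Q \<theta>\<^sub>0)"
  let ?P = "observation_law \<mu> ?\<pi> (Q \<theta>\<^sub>0) (g \<theta>\<^sub>0)"
  have g_meas: "g \<theta> x \<in> borel_measurable borel" for \<theta> x
  proof -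
    have "(\<lambda>y. (\<theta>, x, y)) \<in> borel \<rightarrow>\<^sub>M borel \<Otimes>\<^sub>M count_space UNIV \<Otimes>\<^sub>M borel" by measurable
    from measurable_compose[OF this g_measurable] show ?thesis by simp
  qed
  interpret H: hmm \<mu> "Q \<theta>" "g \<theta>" for \<theta>
    by (intro hmm.intro sets_\<mu> \<mu>_sigma_finite Q_stochastic g_meas g_nonneg g_density)
  have P_distr: "?P = distr ?J seqs snd"
    by (simp add: observation_law_def stationary_hmm_law_def)
  have snd_meas: "snd \<in> ?J \<rightarrow>\<^sub>M seqs"
    unfolding stationary_hmm_law_def by (rule H.measurable_snd_hmm_law)
  have nn_P: "(\<integral>\<^sup>+y. f y \<partial>?P) = (\<integral>\<^sup>+(_, y). f y \<partial>?J)" if "f \<in> borel_measurable seqs" for f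
    unfolding P_distr split_beta' by (rule nn_integral_distr[OF snd_meas]) (simp add: that)
  obtain D :: "'p set" where D: "countable D" "\<And>U. open U \<Longrightarrow> U \<noteq> {} \<Longrightarrow> D \<inter> U \<noteq> {}"
    using compact_UNIV_countable_dense[OF compact_parameters] by blast
  have coord [measurable]: "(\<lambda>y. g \<theta> x (y (0::nat))) \<in> borel_measurable seqs" for \<theta> x
    by (rule measurable_compose[OF _ g_meas]) simp
  interpret F: hmm_family \<mu> Q g \<theta>\<^sub>0 D
  proof (rule hmm_family.intro)
    show "(\<integral>\<^sup>+ y. e2ennreal \<bar>elog (g \<theta>\<^sub>0 x (y 0))\<bar> \<partial>?P) < \<infinity>" for x
      using F2[of x] by (subst nn_P) (auto simp: e2ennreal_abs_elog)
    fix \<theta>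
    obtain U where U: "open U" "\<theta> \<in> U"
      and fin: "\<And>x. (\<integral>\<^sup>+ (_, y). (SUP \<theta>'\<in>U. e2ennreal (max 0 (elog (g \<theta>' x (y 0))))) \<partial>?J) < \<infinity>"
      using F3[of \<theta>] by blast
    have "(\<integral>\<^sup>+ y. (SUP \<theta>'\<in>D \<inter> U. e2ennreal (max 0 (elog (g \<theta>' x (y 0))))) \<partial>?P) < \<infinity>" for x
    proof -
      have "(\<lambda>y. SUP \<theta>'\<in>D \<inter> U. e2ennreal (max 0 (elog (g \<theta>' x (y (0::nat)))))) \<in> borel_measurable seqs"
        unfolding e2ennreal_pos_elog by (intro borel_measurable_SUP countable_Int1 D) measurable
      then have "(\<integral>\<^sup>+ y. (SUP \<theta>'\<in>D \<inter> U. e2ennreal (max 0 (elog (g \<theta>' x (y 0))))) \<partial>?P) =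
          (\<integral>\<^sup>+ (_, y). (SUP \<theta>'\<in>D \<inter> U. e2ennreal (max 0 (elog (g \<theta>' x (y 0))))) \<partial>?J)"
        by (rule nn_P)
      \<comment> \<open>The supremum over all of \<open>U\<close> may fail to be measurable; its
        \<open>nn_integral\<close> is then a lower integral, which is still monotone and so controls
        the measurable supremum over \<open>D \<inter> U\<close>.\<close>
      also have "\<dots> \<le> (\<integral>\<^sup>+ (_, y). (SUP \<theta>'\<in>U. e2ennreal (max 0 (elog (g \<theta>' x (y 0))))) \<partial>?J)"
        by (intro nn_integral_mono) (auto intro!: SUP_subset_mono)
      finally show ?thesis using fin[of x] by (rule le_less_trans)
    qed
    then show "\<exists>U. open U \<and> \<theta> \<in> U \<and>
        (\<forall>x. (\<integral>\<^sup>+ y. (SUP \<theta>'\<in>D \<inter> U. e2ennreal (max 0 (elog (g \<theta>' x (y 0))))) \<partial>?P) < \<infinity>)"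
      using U by blast
  qed (assumption | rule compact_parameters sets_\<mu> \<mu>_sigma_finite Q_stochastic g_meas g_nonneg g_density F1 F4_Q F4_g D)+
  let ?cl = "parameter_class \<mu> Q g \<theta>\<^sub>0"
  let ?good = "\<lambda>r \<theta> y. \<exists>C \<gamma> n0. 0 < \<gamma> \<and>
    (\<forall>n\<ge>n0. \<forall>\<theta>'\<in>ball \<theta> r. F.lam \<theta>' n y \<le> C * (real n + 1)\<^sup>2 * exp (- \<gamma> * real n) * F.p n y)"
  have "\<exists>r>0. AE y in ?P. ?good r \<theta> y" if "\<theta> \<notin> ?cl" for \<theta>
  proof (rule F.exponential_bound)
    fix q assume "invariant_distribution (Q \<theta>) q"
    then show "observation_law \<mu> q (Q \<theta>) (g \<theta>) \<noteq> ?P"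
      using that F.\<pi>_inv unfolding parameter_class_def equivalent_parameters_def by blast
  qed
  then have "\<forall>\<theta>\<in>- ?cl. \<exists>r. 0 < r \<and> (AE y in ?P. ?good r \<theta> y)" by blast
  from bchoice[OF this] obtain r where "\<forall>\<theta>\<in>- ?cl. 0 < r \<theta> \<and> (AE y in ?P. ?good (r \<theta>) \<theta> y)" ..
  then have r: "\<And>\<theta>. \<theta> \<notin> ?cl \<Longrightarrow> 0 < r \<theta>" "\<And>\<theta>. \<theta> \<notin> ?cl \<Longrightarrow> AE y in ?P. ?good (r \<theta>) \<theta> y"
    by blast+
  \<comment> \<open>Parameters at distance at least \<open>1 / real (Suc m)\<close> from the class
    form a compact set, covered by finitely many balls. Over all \<open>m\<close> these are
    countably many balls, so one null set serves them all.\<close>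
  have "\<exists>T. finite T \<and> T \<inter> ?cl = {} \<and> {\<theta>. 1 / real (Suc m) \<le> infdist \<theta> ?cl} \<subseteq> (\<Union>\<theta>\<in>T. ball \<theta> (r \<theta>))" for m
  proof -
    let ?S = "{\<theta>. 1 / real (Suc m) \<le> infdist \<theta> ?cl}"
    have "closed ?S"
      by (intro closed_Collect_le continuous_intros)
    then have "compact ?S"
      using compact_Int_closed[OF compact_parameters] by simp
    moreover have "?S \<inter> ?cl = {}" using infdist_zero by auto
    moreover have "\<And>\<theta>. \<theta> \<in> ?S \<Longrightarrow> open (ball \<theta> (r \<theta>))" by simp
    moreover have "?S \<subseteq> (\<Union>\<theta>\<in>?S. ball \<theta> (r \<theta>))"
    proof
      fix \<theta> assume \<theta>: "\<theta> \<in> ?S"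
      then have "\<theta> \<notin> ?cl" using \<open>?S \<inter> ?cl = {}\<close> by blast
      then have "\<theta> \<in> ball \<theta> (r \<theta>)" using r(1) by simp
      with \<theta> show "\<theta> \<in> (\<Union>\<theta>\<in>?S. ball \<theta> (r \<theta>))" by blast
    qed
    ultimately obtain T where "T \<subseteq> ?S" "finite T" "?S \<subseteq> (\<Union>\<theta>\<in>T. ball \<theta> (r \<theta>))"
      using compactE_image[of ?S ?S "\<lambda>\<theta>. ball \<theta> (r \<theta>)"] by blast
    then show ?thesis using \<open>?S \<inter> ?cl = {}\<close> by blast
  qed
  then obtain T where T: "\<And>m. finite (T m)" "\<And>m. T m \<inter> ?cl = {}"
    "\<And>m. {\<theta>. 1 / real (Suc m) \<le> infdist \<theta> ?cl} \<subseteq> (\<Union>\<theta>\<in>T m. ball \<theta> (r \<theta>))"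
    by metis
  have "AE y in ?P. ?good (r \<theta>) \<theta> y" if "\<theta> \<in> T m" for \<theta> m
    using r(2) T(2)[of m] that by blast
  then have "\<forall>m. \<forall>\<theta>\<in>T m. AE y in ?P. ?good (r \<theta>) \<theta> y" by blast
  then have "AE y in ?P. \<forall>m. \<forall>\<theta>\<in>T m. ?good (r \<theta>) \<theta> y"
    by (simp only: AE_all_countable AE_finite_all[OF T(1)])
  then have AE1: "AE z in ?J. \<forall>m. \<forall>\<theta>\<in>T m. ?good (r \<theta>) \<theta> (snd z)"
    unfolding P_distr by (rule AE_distrD[OF snd_meas])
  have "AE y in ?P. \<forall>n. 0 < F.p n y" by (rule H.AE_mix_likelihood_pos)
  then have AE2: "AE z in ?J. \<forall>n. 0 < F.p n (snd z)"
    unfolding P_distr by (rule AE_distrD[OF snd_meas])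
  obtain R :: "nat \<Rightarrow> (nat \<Rightarrow> 'x) \<times> (nat \<Rightarrow> 'y) \<Rightarrow> real" where
    R0: "AE (x, y) in ?J. (\<lambda>n. R n (x, y)) \<longlonglongrightarrow> 0" and
    R1: "AE (x, y) in ?J. \<forall>n\<ge>1.
           (let \<theta>n = \<theta>h n (restrict y {..n}) in
            ereal (1 / real n) * log_likelihood \<nu> (Q \<theta>n) (g \<theta>n) n y
              \<ge> (SUP \<theta>. ereal (1 / real n) * log_likelihood \<nu> (Q \<theta>) (g \<theta>) n y)
                 - ereal (R n (x, y)))"
    using mle unfolding approximate_mle_def by blast
  \<comment> \<open>The least weight is positive because the state space is finite; it compares the
    likelihood under \<open>\<nu>\<close> with the stationary one at the true parameter.\<close>
  define \<nu>m where "\<nu>m = Min (range (pmf \<nu>))"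
  have "\<nu>m \<in> range (pmf \<nu>)" unfolding \<nu>m_def by (rule Min_in) auto
  then have \<nu>m_pos: "0 < \<nu>m" using \<nu>_charges by auto
  have \<nu>m_le: "\<nu>m \<le> pmf \<nu> x" for x by (simp add: \<nu>m_def)
  have lik_le: "likelihood \<nu> (Q \<theta>) (g \<theta>) n y \<le> F.lam \<theta> (Suc n) y" for \<theta> n y
    using H.mix_likelihood_le_total[of \<theta> \<nu> "Suc n" y]
    unfolding likelihood_eq_state_likelihood[OF Q_stochastic] H.mix_likelihood_def .
  have lik_ge: "\<nu>m * F.p (Suc n) y \<le> likelihood \<nu> (Q \<theta>\<^sub>0) (g \<theta>\<^sub>0) n y" for n y
  proof -
    have "\<nu>m * F.p (Suc n) y \<le> \<nu>m * F.lam \<theta>\<^sub>0 (Suc n) y"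
      using \<nu>m_pos by (intro mult_left_mono H.mix_likelihood_le_total) auto
    also have "\<dots> \<le> likelihood \<nu> (Q \<theta>\<^sub>0) (g \<theta>\<^sub>0) n y"
      unfolding likelihood_eq_state_likelihood[OF Q_stochastic] H.total_likelihood_def sum_distrib_left
      by (intro sum_mono mult_right_mono \<nu>m_le H.state_likelihood_nonneg)
    finally show ?thesis .
  qed
  \<comment> \<open>A deterministic statement along one path. Inside the ball, near-maximality keeps
    the normalised log-likelihood above that of the true parameter up to a null sequence, whereas
    the exponential bound places it lower by nearly \<open>\<gamma>\<close>.\<close>
  have avoid: "\<forall>\<^sub>F n in sequentially. \<theta>s n \<notin> ball \<theta> s"
    if good: "?good s \<theta> y" and pos: "\<forall>n. 0 < F.p n y" and R: "\<rho> \<longlonglongrightarrow> 0"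
      and mle: "\<And>n. 1 \<le> n \<Longrightarrow> ereal (1 / real n) * log_likelihood \<nu> (Q (\<theta>s n)) (g (\<theta>s n)) n y
              \<ge> (SUP \<theta>. ereal (1 / real n) * log_likelihood \<nu> (Q \<theta>) (g \<theta>) n y) - ereal (\<rho> n)"
    for s \<theta> y \<rho> \<theta>s
  proof -
    obtain C \<gamma> n0 where \<gamma>: "0 < \<gamma>" and b: "\<And>n \<theta>'. n0 \<le> n \<Longrightarrow> \<theta>' \<in> ball \<theta> s \<Longrightarrow>
        F.lam \<theta>' n y \<le> C * (real n + 1)\<^sup>2 * exp (- \<gamma> * real n) * F.p n y"
      using good by blast
    \<comment> \<open>\<open>max 1 C\<close> secures a positive factor, whose logarithm is taken
      below; dividing by \<open>\<nu>m\<close> pays for replacing the stationary likelihood by the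
      one under \<open>\<nu>\<close>.\<close>
    define C' where "C' = max 1 C / \<nu>m"
    have C': "0 < C'" using \<nu>m_pos by (simp add: C'_def)
    define a where "a = ln C' + 2 * ln 3"
    have "(\<lambda>n. a / real n + 2 * (ln (real n) / real n) - \<gamma> + \<rho> n) \<longlonglongrightarrow> 0 + 2 * 0 - \<gamma> + 0"
      by (intro tendsto_intros lim_const_over_n lim_ln_over_n R)
    then have "\<forall>\<^sub>F n in sequentially. a / real n + 2 * (ln (real n) / real n) - \<gamma> + \<rho> n < 0"
      using \<gamma> by (intro order_tendstoD) auto
    then show ?thesis
      using eventually_ge_at_top[of "max 1 n0"]
    proof eventually_elim
      case (elim n)
      then have n: "1 \<le> n" "n0 \<le> Suc n" by auto
      show ?case
      proof
        assume \<theta>s: "\<theta>s n \<in> ball \<theta> s"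
        define l where "l = likelihood \<nu> (Q (\<theta>s n)) (g (\<theta>s n)) n y"
        define l0 where "l0 = likelihood \<nu> (Q \<theta>\<^sub>0) (g \<theta>\<^sub>0) n y"
        have l0_ge: "\<nu>m * F.p (Suc n) y \<le> l0" unfolding l0_def by (rule lik_ge)
        then have l0: "0 < l0" using pos \<nu>m_pos by (meson less_le_trans mult_pos_pos)
        have "l \<le> C * (real (Suc n) + 1)\<^sup>2 * exp (- \<gamma> * real (Suc n)) * F.p (Suc n) y"
          unfolding l_def using lik_le b[OF n(2) \<theta>s] by (rule order_trans)
        also have "\<dots> \<le> max 1 C * (real (Suc n) + 1)\<^sup>2 * exp (- \<gamma> * real (Suc n)) * F.p (Suc n) y"
          using pos by (intro mult_right_mono) (auto intro: less_imp_le)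
        also have "\<dots> = C' * (real (Suc n) + 1)\<^sup>2 * exp (- \<gamma> * real (Suc n)) * (\<nu>m * F.p (Suc n) y)"
          using \<nu>m_pos by (simp add: C'_def)
        also have "\<dots> \<le> C' * (real (Suc n) + 1)\<^sup>2 * exp (- \<gamma> * real (Suc n)) * l0"
          using C' by (intro mult_left_mono l0_ge) auto
        \<comment> \<open>The bound was used at \<open>Suc n\<close> because
          \<open>likelihood\<close> at \<open>n\<close> involves \<open>n + 1\<close> observations.
          For \<open>n \<ge> 1\<close> one has \<open>n + 2 \<le> 3 * n\<close>, a product whose
          logarithm splits.\<close>
        also have "\<dots> \<le> C' * (3 * real n)\<^sup>2 * exp (- \<gamma> * real n) * l0"
          using C' \<gamma> n l0 by (intro mult_mono mult_right_mono mult_left_mono power_mono) auto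
        finally have l_le: "l \<le> C' * (3 * real n)\<^sup>2 * exp (- \<gamma> * real n) * l0" .
        have "ereal (1 / real n) * elog l0 \<le> (SUP \<theta>. ereal (1 / real n) * log_likelihood \<nu> (Q \<theta>) (g \<theta>) n y)"
          unfolding l0_def log_likelihood_def by (rule SUP_upper) simp
        then have "ereal (1 / real n) * elog l0 - ereal (\<rho> n) \<le> ereal (1 / real n) * elog l"
          using mle[OF n(1)] unfolding l_def log_likelihood_def
          by (meson ereal_minus_mono order_refl order_trans)
        then have ineq: "ereal (ln l0 / real n - \<rho> n) \<le> ereal (1 / real n) * elog l"
          using l0 by (simp add: elog_def)
        \<comment> \<open>A vanishing likelihood would have \<open>elog\<close> equal to
          \<open>-\<infinity>\<close>, which the finite lower bound from the true parameter
          excludes.\<close>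
        have l: "0 < l"
        proof (rule ccontr)
          assume "\<not> 0 < l"
          then have "ereal (1 / real n) * elog l = - \<infinity>" using n(1) by (simp add: elog_def)
          with ineq show False by simp
        qed
        then have ineq': "ln l0 / real n - \<rho> n \<le> ln l / real n" using ineq by (simp add: elog_def)
        have "ln l \<le> ln (C' * (3 * real n)\<^sup>2 * exp (- \<gamma> * real n) * l0)"
          using l l_le by (intro ln_mono) auto
        also have "\<dots> = ln C' + 2 * (ln 3 + ln (real n)) - \<gamma> * real n + ln l0"
          using C' l0 n(1) ln_realpow[of "3::real" 2] by (simp add: ln_mult_pos ln_realpow)
        finally have "ln l \<le> a + 2 * ln (real n) - \<gamma> * real n + ln l0" by (simp add: a_def)
        then have "ln l / real n \<le> (a + 2 * ln (real n) - \<gamma> * real n + ln l0) / real n"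
          by (intro divide_right_mono) auto
        also have "\<dots> = a / real n + 2 * (ln (real n) / real n) - \<gamma> + ln l0 / real n"
          using n(1) by (simp add: add_divide_distrib diff_divide_distrib)
        finally show False using ineq' elim(1) by linarith
      qed
    qed
  qed
  have "AE z in ?J. (\<lambda>n. infdist (\<theta>h n (restrict (snd z) {..n})) ?cl) \<longlonglongrightarrow> 0"
    using AE1 AE2 R0 R1
  proof eventually_elim
    case (elim z)
    define \<theta>s where "\<theta>s n = \<theta>h n (restrict (snd z) {..n})" for n
    have "(\<lambda>n. R n z) \<longlonglongrightarrow> 0" using elim(3) by (simp add: split_beta)
    moreover have "ereal (1 / real n) * log_likelihood \<nu> (Q (\<theta>s n)) (g (\<theta>s n)) n (snd z)
              \<ge> (SUP \<theta>. ereal (1 / real n) * log_likelihood \<nu> (Q \<theta>) (g \<theta>) n (snd z)) - ereal (R n z)" if "1 \<le> n" for n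
      using elim(4) that by (simp add: split_beta Let_def \<theta>s_def)
    ultimately have av: "\<forall>\<^sub>F n in sequentially. \<theta>s n \<notin> ball \<theta> (r \<theta>)" if "\<theta> \<in> T m" for \<theta> m
      using avoid[OF _ elim(2)] elim(1) that by blast
    have "(\<lambda>n. infdist (\<theta>s n) ?cl) \<longlonglongrightarrow> 0"
    proof (rule LIMSEQ_I)
      fix e :: real assume "0 < e"
      then obtain m where m: "1 / real (Suc m) < e" using nat_approx_posE by blast
      have "\<forall>\<^sub>F n in sequentially. \<forall>\<theta>\<in>T m. \<theta>s n \<notin> ball \<theta> (r \<theta>)"
        using av by (intro eventually_ball_finite T(1)) blast
      then have "\<forall>\<^sub>F n in sequentially. norm (infdist (\<theta>s n) ?cl - 0) < e"
      proof eventually_elim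
        case (elim n)
        then have "\<theta>s n \<notin> {\<theta>. 1 / real (Suc m) \<le> infdist \<theta> ?cl}" using T(3)[of m] by blast
        then show ?case using m infdist_nonneg[of "\<theta>s n" ?cl] by simp
      qed
      then show "\<exists>n0. \<forall>n\<ge>n0. norm (infdist (\<theta>s n) ?cl - 0) < e"
        by (simp add: eventually_sequentially)
    qed
    then show ?case by (simp add: \<theta>s_def)
  qed
  then show ?thesis by (simp add: split_beta)
qed

end
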